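(* Let $\Pi(\cdot)$ be the unique mild solution on $\mathcal H$ of $$ \dot\Pi+\Pi(\tilde\Delta+\tilde A)+(\tilde\Delta+\tilde A^* )\Pi+\tilde C^*\Pi\tilde C+\tilde Q-\delta^{-1}\Pi\tilde B\tilde B^*\Pi=0,\qquad \Pi(T)=\tilde G, $$ and, for $N\ge1$, let $\Pi_N(\cdot)$ be the unique solution on $\mathcal H_N$ of the matrix Riccati equation $$ \dot\Pi_N+\Pi_N(\tilde\Delta_N+\tilde A_N)+(\tilde\Delta_N+\tilde A_N^* )\Pi_N+\tilde C_N^*\Pi_N\tilde C_N+\tilde Q_N-\delta^{-1}\Pi_N\tilde B_N\tilde B_N^*\Pi_N=0,\qquad \Pi_N(T)=\tilde G_N. $$ Then for every $Z\in\mathcal H$, as $N\to\infty$, $$\|\Pi(t)Z-P_N^*\Pi_N(t)P_NZ\|_{\mathcal H}\to0\quad\text{for every }t\in[0,T],$$ and $$\sup_{t\in[0,T]}\|\Pi(t)Z-P_N^*\Pi_N(t)P_NZ\|_{\mathcal H}\to0.$$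
   Context: Fix $T>0$. $H^1(0,1)$ carries the scalar product $\langle u,v\rangle_{H^1}=\int_0^1uv\,dx+\int_0^1u'v'\,dx$, and $\mathcal H=\mathbb R^d\times\mathbb R\times H^1(0,1)$ is the product Hilbert space. $\Delta$ is the second derivative with Neumann conditions, $\mathrm{Dom}(\Delta)=\{z\in H^2(0,1):z_x(0)=z_x(1)=0\}$; as an operator generating a strongly continuous semigroup on $H^1(0,1)$ it is restricted to those $z\in\mathrm{Dom}(\Delta)$ with $\Delta z\in H^1(0,1)$ (the semigroup is the restriction of the Neumann heat semigroup to $H^1(0,1)$). Data: constants $c\in\mathbb R$, $\mu>c$, $r>0$, $\delta>0$; constant matrices $A,C\in\mathbb R^{d\times d}$, $B,D\in\mathbb R^{d\times1}$; symmetric positive semidefinite $Q,G\in\mathbb R^{d\times d}$. The function $\rho\in H^1(0,1)$ is the unique solution of $-\Delta\rho+(\mu-c)\rho=0$ on $(0,1)$, $\rho_x(0)=0$, $\rho_x(1)=1$. By the Riesz theorem there is a unique $\gamma_0\in H^1(0,1)$ with $z(0)=\langle\gamma_0,z\rangle_{H^1}$ for all $z\in H^1(0,1)$; write $\gamma_0^*z=z(0)$. The operators on $\mathcal H$ (blocks ordered as $\mathbb R^d,\mathbb R,H^1(0,1)$) are $$\tilde\Delta=\begin{pmatrix}0&0&0\\0&0&0\\0&0&\Delta\end{pmatrix},\quad\tilde A=\begin{pmatrix}A&-B\rho(0)&B\gamma_0^*\\0&\mu&0\\0&0&c\end{pmatrix},\quad\tilde C=\begin{pmatrix}C&-D\rho(0)&D\gamma_0^*\\0&0&0\\0&0&0\end{pmatrix},$$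 $$\tilde B=\begin{pmatrix}0\\1\\-\rho\end{pmatrix},\quad\tilde Q=\begin{pmatrix}Q&0&0\\0&r&0\\0&0&0\end{pmatrix},\quad\tilde G=\begin{pmatrix}G&0&0\\0&0&0\\0&0&0\end{pmatrix},$$ with $\tilde B$ viewed as the bounded operator $\mathbb R\to\mathcal H$, $v\mapsto v\tilde B$. Adjoints are Hilbert-space adjoints. $S(\cdot)$ denotes the strongly continuous semigroup on $\mathcal H$ generated by $\tilde\Delta$. A mild solution of the first Riccati equation is a strongly continuous family $\Pi:[0,T]\to\mathcal L(\mathcal H)$ of self-adjoint operators such that for all $t\in[0,T]$, $Z\in\mathcal H$, $$\Pi(t)Z=S(T-t)^*\tilde GS(T-t)Z+\int_t^TS(\tau-t)^*\bigl(\tilde A^*\Pi(\tau)+\Pi(\tau)\tilde A+\tilde Q+\tilde C^*\Pi(\tau)\tilde C-\delta^{-1}\Pi(\tau)\tilde B\tilde B^*\Pi(\tau)\bigr)S(\tau-t)Z\,d\tau.$$ It exists, is unique and is nonnegative; likewise $\Pi_N$ exists, is unique, symmetric and nonnegative. Discretization: $\phi_n(x)=A_n\cos(n\pi x)$, $n\ge0$, with $A_0=1$ and $A_n=\sqrt{2/(1+\pi^2n^2)}$ for $n\ge1$, are the Neumann eigenfunctions ($-\Delta\phi_n=\pi^2n^2\phi_n$), forming an orthonormal basis of $H^1(0,1)$. Let $H^1_N=\mathrm{Span}(\phi_0,\dots,\phi_N)$, $\mathcal H_N=\mathbb R^d\times\mathbb R\times H^1_N$, and let $P_N:\mathcal H\to\mathcal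 H_N$ be the orthogonal projection $P_N(X,Y,z)=(X,Y,\sum_{n=0}^N\langle z,\phi_n\rangle_{H^1}\phi_n)$, whose adjoint $P_N^*$ is the inclusion $\mathcal H_N\to\mathcal H$. Set $\tilde\Delta_N=P_N\tilde\Delta P_N^*$, $\tilde A_N=P_N\tilde AP_N^*$, $\tilde C_N=P_N\tilde CP_N^*$, $\tilde B_N=P_N\tilde B$, $\tilde Q_N=P_N\tilde QP_N^*$, $\tilde G_N=P_N\tilde GP_N^*$. *)

theory Defs
  imports "HOL-Analysis.Analysis"
begin

abbreviation leb01 :: "real measure"
  where "leb01 \<equiv> restrict_space lborel {0..1}"

text \<open>Borel representatives of the elements of $L^2(0,1)$; almost everywhere equal functions are not identified.\<close>

definition L2_01 :: "(real \<Rightarrow> real) set"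
  where "L2_01 = {g \<in> borel_measurable leb01. integrable leb01 (\<lambda>x. (g x)\<^sup>2)}"

text \<open>The space $C^1_c(0,1)$, extended by zero to the whole line. Testing against $C^1_c$ or against
  $C^\infty_c$ gives the same weak derivatives.\<close>

definition test_functions :: "(real \<Rightarrow> real) set"
  where "test_functions =
    {\<phi>. \<phi> C1_differentiable_on UNIV \<and> (\<exists>a b. 0 < a \<and> b < 1 \<and> (\<forall>x. x \<notin> {a..b} \<longrightarrow> \<phi> x = 0))}"

definition weak_deriv :: "(real \<Rightarrow> real) \<Rightarrow> (real \<Rightarrow> real) \<Rightarrow> bool"
  where "weak_deriv u g \<longleftrightarrow>
    (\<forall>\<phi>\<in>test_functions. (\<integral>x. u x * deriv \<phi> x \<partial>leb01) = - (\<integral>x. g x * \<phi> x \<partial>leb01))"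

lemma finite_leb01: "finite_measure leb01"
  by (intro finite_measureI) (simp add: emeasure_restrict_space space_restrict_space)

interpretation leb01: finite_measure leb01 by (rule finite_leb01)

lemma L2_measurable: "g \<in> L2_01 \<Longrightarrow> g \<in> borel_measurable leb01"
  by (simp add: L2_01_def)

lemma L2_mult:
  assumes "f \<in> L2_01" "g \<in> L2_01"
  shows "integrable leb01 (\<lambda>x. f x * g x)"
proof (rule Bochner_Integration.integrable_bound)
  show "integrable leb01 (\<lambda>x. (f x)\<^sup>2 + (g x)\<^sup>2)"
    using assms by (auto simp: L2_01_def)
  show "(\<lambda>x. f x * g x) \<in> borel_measurable leb01"
    using assms by (auto simp: L2_01_def)
  have "norm (a * b) \<le> norm (a\<^sup>2 + b\<^sup>2)" for a b :: real
  proof -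
    have "2 * (\<bar>a\<bar> * \<bar>b\<bar>) \<le> a\<^sup>2 + b\<^sup>2"
      using sum_squares_bound[of "\<bar>a\<bar>" "\<bar>b\<bar>"] by simp
    moreover have "0 \<le> \<bar>a\<bar> * \<bar>b\<bar>" by simp
    ultimately have "\<bar>a\<bar> * \<bar>b\<bar> \<le> a\<^sup>2 + b\<^sup>2" by linarith
    then show ?thesis by (simp add: abs_mult)
  qed
  then show "AE x in leb01. norm (f x * g x) \<le> norm ((f x)\<^sup>2 + (g x)\<^sup>2)" by simp
qed

lemma L2_add: 
  assumes "f \<in> L2_01" "g \<in> L2_01"
  shows "(\<lambda>x. f x + g x) \<in> L2_01"
proof -
  have "(\<lambda>x. (f x + g x)\<^sup>2) = (\<lambda>x. (f x)\<^sup>2 + (g x)\<^sup>2 + 2 * (f x * g x))"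
    by (simp add: power2_sum algebra_simps)
  then show ?thesis using assms L2_mult[OF assms] by (auto simp: L2_01_def)
qed

lemma L2_scale: "f \<in> L2_01 \<Longrightarrow> (\<lambda>x. c * f x) \<in> L2_01"
  by (auto simp: L2_01_def power_mult_distrib)

lemma L2_diff: "f \<in> L2_01 \<Longrightarrow> g \<in> L2_01 \<Longrightarrow> (\<lambda>x. f x - g x) \<in> L2_01"
  using L2_add[of f "\<lambda>x. -1 * g x"] L2_scale[of g "-1"] by simp

lemma L2_integrable: "f \<in> L2_01 \<Longrightarrow> integrable leb01 f"
  unfolding L2_01_def by (auto intro: leb01.square_integrable_imp_integrable)

lemma L2_continuous:
  assumes "continuous_on {0..1} f"
  shows "f \<in> L2_01"
proof -
  have m: "f \<in> borel_measurable leb01"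
    using borel_measurable_continuous_on_restrict[OF assms] 
    by (simp add: measurable_def space_restrict_space sets_restrict_space)
  obtain B where B: "\<And>x. x \<in> {0..1} \<Longrightarrow> norm (f x) \<le> B"
    using compact_imp_bounded[OF compact_continuous_image[OF assms]] 
    unfolding bounded_iff by (metis compact_Icc image_eqI)
  have "integrable leb01 (\<lambda>x. (f x)\<^sup>2)"
  proof (rule leb01.integrable_const_bound[where B="B\<^sup>2"])
    show "AE x in leb01. norm ((f x)\<^sup>2) \<le> B\<^sup>2"
      using B by (intro AE_I2) (fastforce simp: space_restrict_space abs_le_square_iff[symmetric])
    show "(\<lambda>x. (f x)\<^sup>2) \<in> borel_measurable leb01" using m by auto
  qed
  with m show ?thesis by (simp add: L2_01_def)
qed

lemma test_functions_continuous:
  assumes "\<phi> \<in> test_functions"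
  shows "continuous_on S \<phi>" "continuous_on S (deriv \<phi>)"
    "\<And>x. (\<phi> has_field_derivative deriv \<phi> x) (at x)"
proof -
  obtain D where D: "\<And>x. (\<phi> has_vector_derivative D x) (at x)" "continuous_on UNIV D"
    using assms by (auto simp: test_functions_def C1_differentiable_on_def)
  have d: "(\<phi> has_field_derivative D x) (at x)" for x
    using D(1) by (simp add: has_real_derivative_iff_has_vector_derivative)
  then have e: "deriv \<phi> = D" by (auto intro: DERIV_imp_deriv)
  show "continuous_on S (deriv \<phi>)" unfolding e using D(2) continuous_on_subset by blast
  show "\<And>x. (\<phi> has_field_derivative deriv \<phi> x) (at x)" using d e by simp
  then show "continuous_on S \<phi>" 
    by (meson DERIV_isCont continuous_at_imp_continuous_on)
qed

lemma test_L2: "\<phi> \<in> test_functions \<Longrightarrow> \<phi> \<in> L2_01" "\<phi> \<in> test_functions \<Longrightarrow> deriv \<phi> \<in> L2_01"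
  by (auto intro: L2_continuous test_functions_continuous)

lemma weak_deriv_add:
  assumes "weak_deriv u g" "weak_deriv v h" "u \<in> L2_01" "v \<in> L2_01" "g \<in> L2_01" "h \<in> L2_01"
  shows "weak_deriv (\<lambda>x. u x + v x) (\<lambda>x. g x + h x)"
  using assms by (auto simp: weak_deriv_def algebra_simps L2_mult test_L2)

lemma weak_deriv_scale:
  assumes "weak_deriv u g" 
  shows "weak_deriv (\<lambda>x. c * u x) (\<lambda>x. c * g x)"
  using assms by (auto simp: weak_deriv_def algebra_simps)

lemma weak_deriv_cong:
  assumes "weak_deriv u g" "\<And>x. x \<in> {0..1} \<Longrightarrow> u x = v x"
  shows "weak_deriv v g"
proof -
  have "(\<integral>x. v x * deriv \<phi> x \<partial>leb01) = (\<integral>x. u x * deriv \<phi> x \<partial>leb01)" for \<phi>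
    by (rule Bochner_Integration.integral_cong) (auto simp: space_restrict_space assms)
  with assms show ?thesis by (simp add: weak_deriv_def)
qed

lemma AE_leb01_interior: "AE x in leb01. 0 < x \<and> x < 1"
proof -
  have "{0::real,1} \<in> null_sets lborel" by (intro finite_imp_null_set_lborel) auto
  then have "AE x in lborel. x \<notin> {0::real,1}" by (rule AE_not_in)
  then have "AE x in lborel. x \<in> {0..1} \<longrightarrow> 0 < x \<and> x < (1::real)"
    by eventually_elim auto
  then show ?thesis by (subst AE_restrict_space_iff) (auto simp del: AE_conj_iff)
qed

definition sqpos :: "real \<Rightarrow> real" where "sqpos x = (max 0 x)\<^sup>2"

lemma sqpos_deriv: "(sqpos has_real_derivative 2 * max 0 x) (at x)"
proof -
  consider "x > 0" | "x < 0" | "x = 0" by linarith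
  then show ?thesis
  proof cases
    case 1
    have "((\<lambda>x. x\<^sup>2) has_real_derivative 2 * max 0 x) (at x)"
      using 1 by (auto intro!: derivative_eq_intros)
    then show ?thesis
      by (rule has_field_derivative_transform_within_open[of _ _ _ "{0<..}"]) (use 1 in \<open>auto simp: sqpos_def\<close>)
  next
    case 2
    have "((\<lambda>x. 0) has_real_derivative 2 * max 0 x) (at x)"
      using 2 by (auto intro!: derivative_eq_intros)
    then show ?thesis
      by (rule has_field_derivative_transform_within_open[of _ _ _ "{..<0}"]) (use 2 in \<open>auto simp: sqpos_def\<close>)
  next
    case 3
    have "((\<lambda>h. sqpos h / h) \<longlongrightarrow> 0) (at 0)"
    proof (rule tendsto_0_le[where f="\<lambda>h. h" and K=1])
      show "((\<lambda>h::real. h) \<longlongrightarrow> 0) (at 0)" by (rule tendsto_ident_at)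
      have "norm (sqpos h / h) \<le> norm h * 1" for h
        by (cases "h > 0"; auto simp: sqpos_def power2_eq_square max_def)
      then show "\<forall>\<^sub>F h in at 0. norm (sqpos h / h) \<le> norm h * 1" by simp
    qed
    then show ?thesis using 3 by (simp add: DERIV_def sqpos_def)
  qed
qed

lemma C1_I:
  assumes "\<And>x::real. (f has_real_derivative D x) (at x)" "continuous_on UNIV D"
  shows "f C1_differentiable_on UNIV"
  using assms unfolding C1_differentiable_on_def has_real_derivative_iff_has_vector_derivative by blast

definition bump :: "real \<Rightarrow> real \<Rightarrow> real \<Rightarrow> real"
  where "bump a b x = sqpos (x - a) * sqpos (b - x)"

lemma bump_nonneg: "0 \<le> bump a b x" by (simp add: bump_def sqpos_def)
lemma bump_pos: "a < x \<Longrightarrow> x < b \<Longrightarrow> 0 < bump a b x" by (simp add: bump_def sqpos_def)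
lemma bump_zero: "x \<notin> {a<..<b} \<Longrightarrow> bump a b x = 0" by (auto simp: bump_def sqpos_def max_def)

lemma bump_deriv: "(bump a b has_real_derivative
   2 * max 0 (x - a) * sqpos (b - x) - sqpos (x - a) * (2 * max 0 (b - x))) (at x)"
proof -
  note [derivative_intros] = DERIV_chain2[OF sqpos_deriv]
  show ?thesis unfolding bump_def[abs_def] by (auto intro!: derivative_eq_intros simp: algebra_simps)
qed

lemma continuous_sqpos [continuous_intros]: "continuous_on S f \<Longrightarrow> continuous_on S (\<lambda>x. sqpos (f x))"
  unfolding sqpos_def by (intro continuous_intros)

lemma continuous_bump [continuous_intros]: "continuous_on S (bump a b)"
  unfolding bump_def[abs_def] by (intro continuous_intros)

lemma approx_test:
  assumes "0 < a" "b < 1" "0 \<le> k"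
  shows "(\<lambda>x. k * bump a b x / (1 + k * bump a b x)) \<in> test_functions"
proof -
  let ?D = "\<lambda>x. 2 * max 0 (x - a) * sqpos (b - x) - sqpos (x - a) * (2 * max 0 (b - x))"
  have p: "1 + k * bump a b x \<noteq> 0" for x
    using mult_nonneg_nonneg[OF assms(3) bump_nonneg[of a b x]] by linarith
  have "(\<lambda>x. k * bump a b x / (1 + k * bump a b x)) C1_differentiable_on UNIV"
  proof (rule C1_I)
    show "((\<lambda>x. k * bump a b x / (1 + k * bump a b x)) has_real_derivative
       (k * ?D x * (1 + k * bump a b x) - (k * bump a b x) * (k * ?D x)) / (1 + k * bump a b x)^2) (at x)" for x
      using p[of x] by (auto intro!: derivative_eq_intros bump_deriv simp: power2_eq_square)
    show "continuous_on UNIV (\<lambda>x. (k * ?D x * (1 + k * bump a b x) - (k * bump a b x) * (k * ?D x)) / (1 + k * bump a b x)^2)"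
      by (intro continuous_intros) (use p in auto)
  qed
  moreover have "\<forall>x. x \<notin> {a..b} \<longrightarrow> k * bump a b x / (1 + k * bump a b x) = 0"
    by (auto simp: bump_zero)
  ultimately show ?thesis using assms by (auto simp: test_functions_def)
qed

lemma fundamental_aux:
  assumes f: "integrable leb01 f" and z: "\<And>\<phi>. \<phi> \<in> test_functions \<Longrightarrow> (\<integral>x. f x * \<phi> x \<partial>leb01) = 0"
  shows "(\<integral>x. f x * indicator {a<..} x \<partial>leb01) = 0"
proof -
  define c where "c = max a 0"
  define p where "p n x = real n * bump (c + 1 / real (n+1)) (1 - 1 / real (n+1)) x" for n x
  define \<phi> where "\<phi> n x = p n x / (1 + p n x)" for n x
  have t: "\<phi> n \<in> test_functions" for n
    using approx_test[of "c + 1 / real (n+1)" "1 - 1 / real (n+1)" "real n"]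
    by (simp add: \<phi>_def[abs_def] p_def c_def add_nonneg_pos)
  have p0: "0 \<le> p n x" for n x by (simp add: p_def bump_nonneg)
  have lim: "(\<lambda>n. \<phi> n x) \<longlonglongrightarrow> indicator {a<..} x" if x: "0 < x" "x < 1" for x
  proof (cases "a < x")
    case False
    then have "\<phi> n x = 0" for n
    proof -
      have "x \<le> c + 1 / real (n+1)" using False by (simp add: c_def max_def add_increasing2)
      then show ?thesis unfolding \<phi>_def p_def by (subst bump_zero) auto
    qed
    then show ?thesis using False by simp
  next
    case True
    then have cx: "c < x" using x by (simp add: c_def)
    have q: "(\<lambda>n. bump (c + 1 / real (n+1)) (1 - 1 / real (n+1)) x) \<longlonglongrightarrow> bump (c+0) (1-0) x"
      unfolding bump_def sqpos_def Suc_eq_plus1[symmetric]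
      by (intro tendsto_intros LIMSEQ_Suc[OF lim_1_over_n])
    have "filterlim (\<lambda>n. p n x) at_top sequentially"
      unfolding p_def
      by (rule filterlim_at_top_mult_tendsto_pos[OF q _ filterlim_real_sequentially, folded mult.commute])
         (use cx x in \<open>auto intro: bump_pos\<close>)
    then have "(\<lambda>n. inverse (1 + p n x)) \<longlonglongrightarrow> 0"
      by (intro tendsto_inverse_0_at_top filterlim_tendsto_add_at_top[OF tendsto_const])
    then have "(\<lambda>n. 1 - inverse (1 + p n x)) \<longlonglongrightarrow> 1 - 0" by (intro tendsto_intros)
    moreover have "1 - inverse (1 + p n x) = \<phi> n x" for n
      using p0[of n x] by (simp add: \<phi>_def field_simps)
    ultimately show ?thesis using True by simp
  qed
  have b: "norm (\<phi> n x) \<le> 1" for n x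
    using p0[of n x] by (simp add: \<phi>_def)
  have "(\<lambda>n. \<integral>x. f x * \<phi> n x \<partial>leb01) \<longlonglongrightarrow> (\<integral>x. f x * indicator {a<..} x \<partial>leb01)"
  proof (rule integral_dominated_convergence[where w="\<lambda>x. norm (f x)"])
    have [measurable]: "f \<in> borel_measurable leb01" using f by auto
    have [measurable]: "\<phi> n \<in> borel_measurable leb01" for n using test_L2[OF t] L2_measurable by auto
    show "(\<lambda>x. f x * indicator {a<..} x) \<in> borel_measurable leb01"
      by (intro borel_measurable_times borel_measurable_indicator') (auto simp: sets_restrict_space)
    show "\<And>n. (\<lambda>x. f x * \<phi> n x) \<in> borel_measurable leb01" by measurable
    show "integrable leb01 (\<lambda>x. norm (f x))" using f by auto
    show "AE x in leb01. (\<lambda>n. f x * \<phi> n x) \<longlonglongrightarrow> f x * indicator {a<..} x"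
      using AE_leb01_interior by eventually_elim (intro tendsto_mult_left lim, auto)
    show "\<And>n. AE x in leb01. norm (f x * \<phi> n x) \<le> norm (f x)"
      using b by (auto simp: abs_mult mult_left_le)
  qed
  then show ?thesis using z[OF t] by (simp add: LIMSEQ_const_iff)
qed

lemma fundamental_lemma:
  assumes f: "integrable leb01 f" and z: "\<And>\<phi>. \<phi> \<in> test_functions \<Longrightarrow> (\<integral>x. f x * \<phi> x \<partial>leb01) = 0"
  shows "AE x in leb01. f x = 0"
proof -
  have [measurable]: "f \<in> borel_measurable leb01" using f by auto
  have mi[measurable]: "A \<in> sets borel \<Longrightarrow> indicat_real A \<in> borel_measurable leb01" for A
    by (intro borel_measurable_indicator') (auto simp: sets_restrict_space)
  have fi: "integrable leb01 (\<lambda>x. f x * indicator A x)" if "A \<in> sets borel" for A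
    by (rule Bochner_Integration.integrable_bound[OF f]) (use that in \<open>auto simp: indicator_def intro!: borel_measurable_times mi[unfolded indicator_def]\<close>)
  have tot: "(\<integral>x. f x \<partial>leb01) = 0"
  proof -
    have "(\<integral>x. f x \<partial>leb01) = (\<integral>x. f x * indicator {-1<..} x \<partial>leb01)"
      by (rule Bochner_Integration.integral_cong) (auto simp: space_restrict_space)
    then show ?thesis using fundamental_aux[OF f z] by simp
  qed
  have main: "(\<integral>x. f x * indicator A x \<partial>leb01) = 0" if "A \<in> sets borel" for A
  proof -
    have "A \<in> sigma_sets UNIV (range (\<lambda>a::real. {a<..}))"
      using that unfolding borel_Ioi by simp
    then show ?thesis
    proof (induct rule: sigma_sets_induct_disjoint[rotated 2, consumes 1, case_names basic empty compl union Int sub])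
      show "Int_stable (range (\<lambda>a::real. {a<..}))"
        by (auto simp: Int_stable_def lessThan_Int_lessThan)
    next
      case (basic A) then show ?case using fundamental_aux[OF f z] by auto
    next
      case empty then show ?case by simp
    next
      case (compl A)
      then have A: "A \<in> sets borel" unfolding borel_Ioi by simp
      have "(\<integral>x. f x * indicator (UNIV - A) x \<partial>leb01) = (\<integral>x. f x - f x * indicator A x \<partial>leb01)"
        by (rule Bochner_Integration.integral_cong) (auto simp: indicator_def)
      also have "\<dots> = 0" using compl f fi[OF A] tot by simp
      finally show ?case .
    next
      case (union A)
      then have A: "\<And>i. A i \<in> sets borel" unfolding borel_Ioi by auto
      have "(\<lambda>n. \<integral>x. f x * indicator (\<Union>i<n. A i) x \<partial>leb01) \<longlonglongrightarrow> (\<integral>x. f x * indicator (\<Union>i. A i) x \<partial>leb01)"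
      proof (rule integral_dominated_convergence[where w="\<lambda>x. norm (f x)"])
        show "(\<lambda>x. f x * indicator (\<Union>i. A i) x) \<in> borel_measurable leb01" 
          "\<And>n. (\<lambda>x. f x * indicator (\<Union>i<n. A i) x) \<in> borel_measurable leb01"
          using A by (auto intro!: borel_measurable_times mi)
        show "integrable leb01 (\<lambda>x. norm (f x))" using f by auto
        show "AE x in leb01. (\<lambda>n. f x * indicator (\<Union>i<n. A i) x) \<longlonglongrightarrow> f x * indicator (\<Union>i. A i) x"
          by (intro AE_I2 tendsto_mult_left LIMSEQ_indicator_UN)
        show "\<And>n. AE x in leb01. norm (f x * indicator (\<Union>i<n. A i) x) \<le> norm (f x)"
          by (auto simp: indicator_def)
      qed
      moreover have "(\<integral>x. f x * indicator (\<Union>i<n. A i) x \<partial>leb01) = 0" for n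
      proof -
        have "(\<integral>x. f x * indicator (\<Union>i<n. A i) x \<partial>leb01) = (\<integral>x. (\<Sum>i<n. f x * indicator (A i) x) \<partial>leb01)"
          using union(1) by (subst indicator_UN_disjoint) (auto simp: sum_distrib_left disjoint_family_on_def)
        also have "\<dots> = (\<Sum>i<n. \<integral>x. f x * indicator (A i) x \<partial>leb01)"
          by (rule Bochner_Integration.integral_sum) (rule fi[OF A])
        also have "\<dots> = 0" using union(3) by simp
        finally show ?thesis .
      qed
      ultimately show ?case by (simp add: LIMSEQ_const_iff)
    qed auto
  qed
  show ?thesis
  proof (rule leb01.density_zero[OF f])
    fix A assume "A \<in> sets leb01"
    then have "A \<in> sets borel" by (auto simp: sets_restrict_space)
    from main[OF this] show "set_lebesgue_integral leb01 A f = 0"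
      by (simp add: set_lebesgue_integral_def mult.commute)
  qed
qed

lemma weak_deriv_unique:
  assumes "weak_deriv u g" "weak_deriv u h" "g \<in> L2_01" "h \<in> L2_01"
  shows "AE x in leb01. g x = h x"
proof -
  have "AE x in leb01. g x - h x = 0"
  proof (rule fundamental_lemma)
    show "integrable leb01 (\<lambda>x. g x - h x)" using assms L2_diff L2_integrable by blast
    fix \<phi> assume "\<phi> \<in> test_functions"
    then show "(\<integral>x. (g x - h x) * \<phi> x \<partial>leb01) = 0"
      using assms by (auto simp: weak_deriv_def algebra_simps L2_mult test_L2)
  qed
  then show ?thesis by simp
qed

lemma integral_leb01: "(\<integral>x. f x \<partial>leb01) = (\<integral>x. f x * indicator {0..1} x \<partial>lborel)" for f :: "real \<Rightarrow> real"
  by (subst integral_restrict_space) (auto simp: mult.commute)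

lemma FTC01:
  assumes "\<And>x::real. (F has_real_derivative f x) (at x)" "continuous_on UNIV f" "0 \<le> y" "y \<le> 1"
  shows "(\<integral>x. f x * indicator {y..} x \<partial>leb01) = F 1 - F y"
proof -
  have "(\<integral>x. f x * indicator {y..} x \<partial>leb01) = (\<integral>x. f x * indicator {y..1} x \<partial>lborel)"
    unfolding integral_leb01 
    by (rule Bochner_Integration.integral_cong) (use assms in \<open>auto simp: indicator_def\<close>)
  also have "\<dots> = F 1 - F y"
    by (rule integral_FTC_Icc_real)
       (use assms in \<open>auto simp: has_real_derivative_iff_has_vector_derivative[symmetric] 
         intro: has_field_derivative_at_within continuous_on_interior continuous_on_eq_continuous_at[THEN iffD1, rule_format, OF open_UNIV]\<close>)
  finally show ?thesis .
qed

lemma cont_AE_zero: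
  assumes "continuous_on {0..1} h" "AE x in leb01. h x = (0::real)" "x \<in> {0..1}"
  shows "h x = 0"
proof -
  have c: "continuous_on {0..1} (\<lambda>x. (h x)\<^sup>2)" by (intro continuous_intros assms)
  have "(\<integral>x. (h x)\<^sup>2 \<partial>leb01) = (\<integral>x. 0 \<partial>leb01)"
    using assms(2) L2_measurable[OF L2_continuous[OF assms(1)]]
    by (intro integral_cong_AE) auto
  then have z: "(LINT x:{0..1}|lborel. (h x)\<^sup>2) = 0"
    by (simp add: integral_leb01 set_lebesgue_integral_def mult.commute)
  have "set_integrable lborel {0..1} (\<lambda>x. (h x)\<^sup>2)"
    by (rule borel_integrable_atLeastAtMost') (rule c)
  from set_borel_integral_eq_integral(2)[OF this] z have "integral {0..1} (\<lambda>x. (h x)\<^sup>2) = 0" by simp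
  then show ?thesis
    using integral_eq_0_iff[OF c] assms(3) by auto
qed

lemma primitive_weak_deriv:
  fixes g :: "real \<Rightarrow> real"
  assumes g: "integrable leb01 g"
  shows "weak_deriv (\<lambda>x. \<integral>y. g y * indicator {..x} y \<partial>leb01) g"
proof (unfold weak_deriv_def, intro ballI)
  fix \<phi> assume t: "\<phi> \<in> test_functions"
  note d = test_functions_continuous[OF t]
  interpret P: pair_sigma_finite leb01 leb01 by standard
  have [measurable]: "g \<in> borel_measurable leb01" using g by auto
  have dm[measurable]: "deriv \<phi> \<in> borel_measurable leb01" using test_L2[OF t] L2_measurable by auto
  have id[measurable]: "(\<lambda>x. x) \<in> borel_measurable leb01" 
    by (rule measurable_restrict_space1) auto
  have di: "integrable leb01 (deriv \<phi>)" using test_L2[OF t] L2_integrable by blast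
  have prod: "integrable (leb01 \<Otimes>\<^sub>M leb01) (\<lambda>(x, y). deriv \<phi> x * g y)"
  proof (rule P.Fubini_integrable)
    have "(\<lambda>z. deriv \<phi> (fst z) * g (snd z)) \<in> borel_measurable (leb01 \<Otimes>\<^sub>M leb01)" by measurable
    then show "(\<lambda>(x, y). deriv \<phi> x * g y) \<in> borel_measurable (leb01 \<Otimes>\<^sub>M leb01)"
      by (simp add: case_prod_beta')
    show "integrable leb01 (\<lambda>x. \<integral>y. norm ((\<lambda>(x, y). deriv \<phi> x * g y) (x, y)) \<partial>leb01)"
      using di by (simp add: abs_mult)
    show "AE x in leb01. integrable leb01 (\<lambda>y. (\<lambda>(x, y). deriv \<phi> x * g y) (x, y))"
      using g by simp
  qed
  have "integrable (leb01 \<Otimes>\<^sub>M leb01) (\<lambda>(x, y). (g y * indicator {..x} y) * deriv \<phi> x)"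
  proof (rule Bochner_Integration.integrable_bound[OF prod])
    have "(\<lambda>z. (g (snd z) * (if snd z \<le> fst z then 1 else 0)) * deriv \<phi> (fst z)) \<in> borel_measurable (leb01 \<Otimes>\<^sub>M leb01)"
      by measurable
    then show "(\<lambda>(x, y). (g y * indicator {..x} y) * deriv \<phi> x) \<in> borel_measurable (leb01 \<Otimes>\<^sub>M leb01)"
      by (simp add: case_prod_beta' indicator_def of_bool_def)
    show "AE z in leb01 \<Otimes>\<^sub>M leb01. norm ((\<lambda>(x, y). (g y * indicator {..x} y) * deriv \<phi> x) z)
        \<le> norm ((\<lambda>(x, y). deriv \<phi> x * g y) z)"
      by (intro AE_I2) (auto simp: indicator_def abs_mult of_bool_def)
  qed
  from P.Fubini_integral[OF this]
  have "(\<integral>x. (\<integral>y. (g y * indicator {..x} y) * deriv \<phi> x \<partial>leb01) \<partial>leb01) 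
      = (\<integral>y. (\<integral>x. (g y * indicator {..x} y) * deriv \<phi> x \<partial>leb01) \<partial>leb01)" by simp
  also have "\<dots> = (\<integral>y. - (g y * \<phi> y) \<partial>leb01)"
  proof (rule Bochner_Integration.integral_cong[OF refl])
    fix y assume "y \<in> space leb01"
    then have y: "0 \<le> y" "y \<le> 1" by (auto simp: space_restrict_space)
    have "(\<integral>x. (g y * indicator {..x} y) * deriv \<phi> x \<partial>leb01) = (\<integral>x. g y * (deriv \<phi> x * indicator {y..} x) \<partial>leb01)"
      by (rule Bochner_Integration.integral_cong) (auto simp: indicator_def)
    also have "\<dots> = g y * (\<phi> 1 - \<phi> y)" using FTC01[OF d(3) d(2) y] by simp
    also have "\<phi> 1 = 0" using t by (auto simp: test_functions_def)
    finally show "(\<integral>x. (g y * indicator {..x} y) * deriv \<phi> x \<partial>leb01) = - (g y * \<phi> y)" by simp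
  qed
  finally show "(\<integral>x. (\<integral>y. g y * indicator {..x} y \<partial>leb01) * deriv \<phi> x \<partial>leb01) = - (\<integral>x. g x * \<phi> x \<partial>leb01)"
    by simp
qed

lemma du_Bois_Reymond_aux:
  assumes v: "continuous_on {0..1} v" and z: "weak_deriv v (\<lambda>_. 0)" and ab: "0 < a" "a < b" "b < 1"
    and x: "a < x" "x < b" and y: "a < y" "y < b"
  shows "v x = v y"
proof -
  define vt where "vt x = v (max 0 (min 1 x))" for x
  have vt: "continuous_on S vt" for S
    unfolding vt_def by (rule continuous_on_compose2[OF v]) (auto intro!: continuous_intros)
  have vteq: "vt x = v x" if "x \<in> {0..1}" for x using that by (simp add: vt_def)
  define w where "w = bump a b"
  have w: "continuous_on S w" for S by (simp add: w_def continuous_bump)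
  define m where "m = (\<integral>x. w x * vt x \<partial>leb01) / (\<integral>x. w x \<partial>leb01)"
  define \<psi> where "\<psi> x = w x * (vt x - m)" for x
  have \<psi>: "continuous_on S \<psi>" for S unfolding \<psi>_def by (intro continuous_intros w vt)
  have ci: "integrable leb01 f" if "continuous_on UNIV f" for f :: "real \<Rightarrow> real"
    by (intro L2_integrable L2_continuous continuous_on_subset[OF that]) simp
  have iw: "(\<integral>x. w x \<partial>leb01) \<noteq> 0"
  proof
    assume "(\<integral>x. w x \<partial>leb01) = 0"
    then have "AE x in leb01. w x = 0"
      by (subst (asm) integral_nonneg_eq_0_iff_AE) (use ci[OF w] in \<open>auto simp: w_def bump_nonneg\<close>)
    from cont_AE_zero[OF w this, of x] show False using x ab bump_pos[of a x b] by (auto simp: w_def)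
  qed
  have i\<psi>: "(\<integral>x. \<psi> x \<partial>leb01) = 0"
  proof -
    have "(\<integral>x. \<psi> x \<partial>leb01) = (\<integral>x. w x * vt x - m * w x \<partial>leb01)" by (simp add: \<psi>_def algebra_simps)
    also have "\<dots> = (\<integral>x. w x * vt x \<partial>leb01) - m * (\<integral>x. w x \<partial>leb01)"
      by (subst Bochner_Integration.integral_diff) (auto intro!: ci continuous_intros w vt)
    also have "\<dots> = 0" using iw by (simp add: m_def)
    finally show ?thesis .
  qed
  have "\<exists>F. \<forall>x::real. -\<infinity> < ereal x \<longrightarrow> ereal x < \<infinity> \<longrightarrow> (F has_vector_derivative \<psi> x) (at x)"
    by (rule einterval_antiderivative) (auto intro: continuous_on_interior \<psi> simp: continuous_on_eq_continuous_at[THEN iffD1, rule_format, OF open_UNIV \<psi>])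
  then obtain F where F: "\<And>x. (F has_real_derivative \<psi> x) (at x)"
    by (auto simp: has_real_derivative_iff_has_vector_derivative)
  define \<phi> where "\<phi> x = F x - F 0" for x
  have \<phi>d: "(\<phi> has_real_derivative \<psi> x) (at x)" for x
    unfolding \<phi>_def using F by (auto intro!: derivative_eq_intros)
  have F1: "F 1 = F 0"
  proof -
    have "(\<integral>x. \<psi> x * indicator {0..} x \<partial>leb01) = (\<integral>x. \<psi> x \<partial>leb01)"
      by (rule Bochner_Integration.integral_cong) (auto simp: space_restrict_space)
    then show ?thesis using FTC01[OF F \<psi>, of 0] i\<psi> by simp
  qed
  have \<psi>0: "\<psi> x = 0" if "x \<le> a \<or> b \<le> x" for x using that by (auto simp: \<psi>_def w_def bump_zero)
  have lo: "F x = F 0" if "x \<le> a" for x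
  proof -
    have "\<exists>c. \<forall>x\<in>{..a}. F x = c"
    proof (rule has_field_derivative_zero_constant)
      fix x assume "x \<in> {..a}"
      then have "\<psi> x = 0" using \<psi>0 by simp
      with F[of x] show "(F has_field_derivative 0) (at x within {..a})"
        by (simp add: has_field_derivative_at_within)
    qed simp
    then show ?thesis using that ab by (metis atMost_iff less_imp_le)
  qed
  have hi: "F x = F 1" if "b \<le> x" for x
  proof -
    have "\<exists>c. \<forall>x\<in>{b..}. F x = c"
    proof (rule has_field_derivative_zero_constant)
      fix x assume "x \<in> {b..}"
      then have "\<psi> x = 0" using \<psi>0 by simp
      with F[of x] show "(F has_field_derivative 0) (at x within {b..})"
        by (simp add: has_field_derivative_at_within)
    qed simp
    then show ?thesis using that ab by (metis atLeast_iff less_imp_le)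
  qed
  have t: "\<phi> \<in> test_functions"
  proof -
    have "\<phi> x = 0" if "x \<notin> {a..b}" for x
      using that lo[of x] hi[of x] F1 by (cases "x \<le> a") (auto simp: \<phi>_def)
    then show ?thesis
      using C1_I[of \<phi> \<psi>] \<phi>d \<psi> ab unfolding test_functions_def by blast
  qed
  have "deriv \<phi> = \<psi>" using \<phi>d by (auto intro: DERIV_imp_deriv)
  then have "(\<integral>x. v x * \<psi> x \<partial>leb01) = 0" using z t by (auto simp: weak_deriv_def)
  moreover have "(\<integral>x. v x * \<psi> x \<partial>leb01) = (\<integral>x. vt x * \<psi> x \<partial>leb01)"
    by (rule Bochner_Integration.integral_cong) (auto simp: space_restrict_space vteq)
  ultimately have v\<psi>: "(\<integral>x. vt x * \<psi> x \<partial>leb01) = 0" by simp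
  have "(\<integral>x. w x * (vt x - m)\<^sup>2 \<partial>leb01) = (\<integral>x. vt x * \<psi> x - m * \<psi> x \<partial>leb01)"
    by (simp add: \<psi>_def power2_eq_square algebra_simps)
  also have "\<dots> = 0"
    using v\<psi> i\<psi> by (subst Bochner_Integration.integral_diff) (auto intro!: ci continuous_intros \<psi> vt)
  finally have "AE x in leb01. w x * (vt x - m)\<^sup>2 = 0"
    by (subst (asm) integral_nonneg_eq_0_iff_AE) (auto intro!: ci continuous_intros vt w simp: w_def bump_nonneg)
  then have *: "w x * (vt x - m)\<^sup>2 = 0" if "x \<in> {0..1}" for x
    by (rule cont_AE_zero[rotated]) (use that in \<open>auto intro!: continuous_intros vt w\<close>)
  have "vt x = m" "vt y = m"
    using *[of x] *[of y] x y ab bump_pos[of a x b] bump_pos[of a y b] by (auto simp: w_def)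
  then show ?thesis using vteq x y ab by simp
qed

lemma du_Bois_Reymond:
  assumes v: "continuous_on {0..1} v" and z: "weak_deriv v (\<lambda>_. 0)" and x: "x \<in> {0..1}"
  shows "v x = v (1/2)"
proof (rule continuous_constant_on_closure[of "{0<..<1}" v])
  show "continuous_on (closure {0<..<1}) v" using v by simp
  show "x \<in> closure {0<..<1}" using x by simp
  fix y :: real assume y: "y \<in> {0<..<1}"
  show "v y = v (1/2)"
    by (rule du_Bois_Reymond_aux[OF v z, of "min y (1/2) / 2" "(1 + max y (1/2)) / 2"]) (use y in \<open>auto simp: min_def max_def\<close>)
qed

lemma primitive_continuous:
  fixes g :: "real \<Rightarrow> real"
  assumes g: "integrable leb01 g"
  shows "continuous_on S (\<lambda>x. \<integral>y. g y * indicator {..x} y \<partial>leb01)"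
proof (rule continuous_at_imp_continuous_on, intro ballI)
  fix x
  have [measurable]: "g \<in> borel_measurable leb01" using g by auto
  show "isCont (\<lambda>x. \<integral>y. g y * indicator {..x} y \<partial>leb01) x"
    unfolding continuous_at_sequentially o_def
  proof (intro allI impI)
    fix X assume X: "X \<longlonglongrightarrow> x"
    show "(\<lambda>n. \<integral>y. g y * indicator {..X n} y \<partial>leb01) \<longlonglongrightarrow> (\<integral>y. g y * indicator {..x} y \<partial>leb01)"
    proof (rule integral_dominated_convergence[where w="\<lambda>y. norm (g y)" and s="\<lambda>n y. g y * indicator {..X n} y"])
      have mi: "indicat_real {..a} \<in> borel_measurable leb01" for a
        by (rule measurable_restrict_space1) auto
      show "(\<lambda>y. g y * indicator {..x} y) \<in> borel_measurable leb01" 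
        "\<And>n. (\<lambda>y. g y * indicator {..X n} y) \<in> borel_measurable leb01"
        by (auto intro!: borel_measurable_times mi)
      show "integrable leb01 (\<lambda>x. norm (g x))" using g by auto
      show "\<And>n. AE y in leb01. norm (g y * indicator {..X n} y) \<le> norm (g y)"
        by (auto simp: indicator_def)
      have "AE y in lborel. y \<noteq> x" by (rule AE_lborel_singleton)
      then have "AE y in leb01. y \<noteq> x"
        by (subst AE_restrict_space_iff) (auto elim: eventually_mono)
      then show "AE y in leb01. (\<lambda>n. g y * indicator {..X n} y) \<longlonglongrightarrow> g y * indicator {..x} y"
      proof eventually_elim
        fix y assume "y \<noteq> x"
        then consider "y < x" | "x < y" by linarith
        then have "eventually (\<lambda>n. indicator {..X n} y = (indicator {..x} y :: real)) sequentially"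
        proof cases
          case 1 with order_tendstoD(1)[OF X 1] show ?thesis by (auto elim!: eventually_mono)
        next
          case 2 with order_tendstoD(2)[OF X 2] show ?thesis by (auto elim!: eventually_mono)
        qed
        then show "(\<lambda>n. g y * indicator {..X n} y) \<longlonglongrightarrow> g y * indicator {..x} y"
          by (intro tendsto_mult_left tendsto_eventually)
      qed
    qed
  qed
qed

lemma weak_deriv_iff_primitive:
  assumes u: "continuous_on {0..1} u" and g: "g \<in> L2_01"
  shows "weak_deriv u g \<longleftrightarrow> (\<forall>x\<in>{0..1}. u x = u 0 + (\<integral>y. g y * indicator {..x} y \<partial>leb01))"
proof -
  define G where "G x = (\<integral>y. g y * indicator {..x} y \<partial>leb01)" for x
  note gi = L2_integrable[OF g]
  have Gw: "weak_deriv G g" unfolding G_def by (rule primitive_weak_deriv[OF gi])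
  have Gc: "continuous_on {0..1} G" unfolding G_def by (rule primitive_continuous[OF gi])
  have G0: "G 0 = 0"
  proof -
    have m: "(\<lambda>y. g y * indicator {..0} y) \<in> borel_measurable leb01"
      by (intro borel_measurable_times L2_measurable[OF g] measurable_restrict_space1) auto
    have "G 0 = (\<integral>y. 0 \<partial>leb01)" unfolding G_def 
      by (intro integral_cong_AE m eventually_mono[OF AE_leb01_interior]) auto
    then show ?thesis by simp
  qed
  show ?thesis unfolding G_def[symmetric]
  proof
    assume w: "weak_deriv u g"
    have "weak_deriv (\<lambda>x. u x + (-1) * G x) (\<lambda>x. g x + (-1) * g x)"
      by (intro weak_deriv_add weak_deriv_scale w Gw L2_scale L2_continuous g Gc u)
    then have "weak_deriv (\<lambda>x. u x - G x) (\<lambda>_. 0)" by simp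
    then have *: "u x - G x = u (1/2) - G (1/2)" if "x \<in> {0..1}" for x
      by (rule du_Bois_Reymond[OF continuous_on_diff[OF u Gc] _ that])
    have "u 0 - G 0 = u (1/2) - G (1/2)" by (rule *) simp
    then have "u x = u 0 + G x" if "x \<in> {0..1}" for x 
      using *[OF that] G0 by linarith
    then show "\<forall>x\<in>{0..1}. u x = u 0 + G x" by blast
  next
    assume e: "\<forall>x\<in>{0..1}. u x = u 0 + G x"
    have c0: "weak_deriv (\<lambda>_. k) (\<lambda>_. 0)" for k
      unfolding weak_deriv_def
    proof (intro ballI)
      fix \<phi> assume t: "\<phi> \<in> test_functions"
      have "(\<integral>x. deriv \<phi> x \<partial>leb01) = (\<integral>x. deriv \<phi> x * indicator {0..} x \<partial>leb01)"
        by (rule Bochner_Integration.integral_cong) (auto simp: space_restrict_space)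
      also have "\<dots> = \<phi> 1 - \<phi> 0" by (rule FTC01) (auto intro: test_functions_continuous t)
      also have "\<dots> = 0" using t by (auto simp: test_functions_def)
      finally show "(\<integral>x. k * deriv \<phi> x \<partial>leb01) = - (\<integral>x. 0 * \<phi> x \<partial>leb01)" by simp
    qed
    have "weak_deriv (\<lambda>x. u 0 + G x) (\<lambda>x. 0 + g x)"
      by (intro weak_deriv_add c0 Gw L2_continuous g Gc continuous_on_const)
    then have "weak_deriv (\<lambda>x. u 0 + G x) g" by simp
    then show "weak_deriv u g" by (rule weak_deriv_cong) (rule e[rule_format, symmetric])
  qed
qed

lemma L2_square_nonneg: "0 \<le> (\<integral>x. (f x)\<^sup>2 \<partial>leb01)" for f :: "real \<Rightarrow> real"
  by simp

lemma L2_square: "f \<in> L2_01 \<Longrightarrow> integrable leb01 (\<lambda>x. (f x)\<^sup>2)"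
  by (simp add: L2_01_def)

lemma L2_Cauchy_Schwarz:
  assumes f: "f \<in> L2_01" and h: "h \<in> L2_01"
  shows "(\<integral>x. f x * h x \<partial>leb01)\<^sup>2 \<le> (\<integral>x. (f x)\<^sup>2 \<partial>leb01) * (\<integral>x. (h x)\<^sup>2 \<partial>leb01)"
proof -
  define a b c where "a = (\<integral>x. (f x)\<^sup>2 \<partial>leb01)" and "b = (\<integral>x. f x * h x \<partial>leb01)" and "c = (\<integral>x. (h x)\<^sup>2 \<partial>leb01)"
  have q: "0 \<le> s\<^sup>2 * a - 2 * s * t * b + t\<^sup>2 * c" for s t
  proof -
    have "0 \<le> (\<integral>x. (s * f x - t * h x)\<^sup>2 \<partial>leb01)" by simp
    also have "(\<lambda>x. (s * f x - t * h x)\<^sup>2) = (\<lambda>x. s\<^sup>2 * (f x)\<^sup>2 - (2 * s * t) * (f x * h x) + t\<^sup>2 * (h x)\<^sup>2)"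
      by (auto simp: power2_eq_square algebra_simps)
    also have "(\<integral>x. s\<^sup>2 * (f x)\<^sup>2 - (2 * s * t) * (f x * h x) + t\<^sup>2 * (h x)\<^sup>2 \<partial>leb01) = s\<^sup>2 * a - 2 * s * t * b + t\<^sup>2 * c"
      unfolding a_def b_def c_def using L2_square[OF f] L2_square[OF h] L2_mult[OF f h] by simp
    finally show ?thesis .
  qed
  have a: "0 \<le> a" and c: "0 \<le> c" by (auto simp: a_def c_def)
  have "b\<^sup>2 \<le> a * c"
  proof (cases "c = 0")
    case False
    then have c: "c > 0" using c by simp
    have "0 \<le> c\<^sup>2 * a - 2 * c * b * b + b\<^sup>2 * c" by (rule q)
    then have "0 \<le> c * (a * c - b\<^sup>2)" by (simp add: power2_eq_square algebra_simps)
    then show ?thesis using c by (simp add: zero_le_mult_iff)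
  next
    case True
    have "b = 0"
    proof (rule ccontr)
      assume b: "b \<noteq> 0"
      have "0 \<le> 1\<^sup>2 * a - 2 * 1 * ((a + 1) / b) * b + ((a + 1) / b)\<^sup>2 * c" by (rule q)
      then show False using b a True by simp
    qed
    then show ?thesis using True by simp
  qed
  then show ?thesis by (simp add: a_def b_def c_def)
qed

lemma measure_leb01: "measure leb01 (space leb01) = 1"
  by (simp add: measure_restrict_space space_restrict_space)

lemma L1_le_L2:
  assumes f: "f \<in> L2_01"
  shows "(\<integral>x. \<bar>f x\<bar> \<partial>leb01)\<^sup>2 \<le> (\<integral>x. (f x)\<^sup>2 \<partial>leb01)"
proof -
  have "(\<lambda>x. \<bar>f x\<bar>) \<in> L2_01" "(\<lambda>x. 1) \<in> L2_01"
    using f L2_continuous[of "\<lambda>_. 1"] by (auto simp: L2_01_def)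
  from L2_Cauchy_Schwarz[OF this] show ?thesis using measure_leb01 by simp
qed

lemma L2_complete:
  assumes g: "\<And>n::nat. g n \<in> L2_01"
    and C: "\<And>e. e > 0 \<Longrightarrow> \<exists>N. \<forall>m\<ge>N. \<forall>n\<ge>N. (\<integral>x. (g m x - g n x)\<^sup>2 \<partial>leb01) < e"
  obtains h where "h \<in> L2_01" "(\<lambda>n. \<integral>x. (g n x - h x)\<^sup>2 \<partial>leb01) \<longlonglongrightarrow> 0"
proof -
  have [measurable]: "g n \<in> borel_measurable leb01" for n using g L2_measurable by auto
  have "\<forall>k. \<exists>N. \<forall>m\<ge>N. \<forall>n\<ge>N. (\<integral>x. (g m x - g n x)\<^sup>2 \<partial>leb01) < ((1/2)^k)\<^sup>2"
    by (intro allI C) simp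
  then obtain N where N: "\<And>k m n. m \<ge> N k \<Longrightarrow> n \<ge> N k \<Longrightarrow> (\<integral>x. (g m x - g n x)\<^sup>2 \<partial>leb01) < ((1/2)^k)\<^sup>2"
    by metis
  define r where "r k = (\<Sum>i\<le>k. N i)" for k
  have rN: "N k \<le> r j" if "k \<le> j" for k j
    unfolding r_def using that by (intro member_le_sum) auto
  define D where "D k x = \<bar>g (r (Suc k)) x - g (r k) x\<bar>" for k x
  have [measurable]: "D k \<in> borel_measurable leb01" for k unfolding D_def by measurable
  have DL: "D k \<in> L2_01" for k
    using L2_diff[OF g g, of "r (Suc k)" "r k"] by (auto simp: D_def[abs_def] L2_01_def)
  have Di: "(\<integral>x. D k x \<partial>leb01) \<le> (1/2)^k" for k
  proof (rule power2_le_imp_le)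
    have "(\<integral>x. D k x \<partial>leb01)\<^sup>2 \<le> (\<integral>x. (D k x)\<^sup>2 \<partial>leb01)"
      using L1_le_L2[OF DL[of k]] by (simp add: D_def)
    also have "\<dots> \<le> ((1/2)^k)\<^sup>2"
      using N[of k "r (Suc k)" "r k"] rN[of k k] rN[of k "Suc k"] by (simp add: D_def)
    finally show "(\<integral>x. D k x \<partial>leb01)\<^sup>2 \<le> ((1/2)^k)\<^sup>2" .
  qed simp
  have "(\<integral>\<^sup>+x. (\<Sum>k. ennreal (D k x)) \<partial>leb01) = (\<Sum>k. \<integral>\<^sup>+x. ennreal (D k x) \<partial>leb01)"
    by (rule nn_integral_suminf) measurable
  also have "\<dots> \<le> (\<Sum>k. ennreal ((1/2)^k))"
  proof (intro suminf_le allI summableI)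
    fix k 
    have "(\<integral>\<^sup>+x. ennreal (D k x) \<partial>leb01) = ennreal (\<integral>x. D k x \<partial>leb01)"
      by (rule nn_integral_eq_integral) (auto simp: L2_integrable DL, simp add: D_def)
    then show "(\<integral>\<^sup>+x. ennreal (D k x) \<partial>leb01) \<le> ennreal ((1/2)^k)" using Di[of k] by (simp add: ennreal_leI)
  qed
  also have "\<dots> = ennreal (\<Sum>k. (1/2)^k)"
    by (rule suminf_ennreal2) (auto intro: summable_geometric)
  also have "\<dots> < \<infinity>" by simp
  finally have "(\<integral>\<^sup>+x. (\<Sum>k. ennreal (D k x)) \<partial>leb01) \<noteq> \<infinity>" by simp
  then have "AE x in leb01. (\<Sum>k. ennreal (D k x)) \<noteq> \<infinity>"
    by (rule nn_integral_noteq_infinite[rotated]) measurable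
  then have conv: "AE x in leb01. (\<lambda>j. g (r j) x) \<longlonglongrightarrow> lim (\<lambda>j. g (r j) x)"
  proof eventually_elim
    case (elim x)
    then have "summable (\<lambda>k. D k x)"
      by (intro summable_suminf_not_top) (auto simp: D_def)
    then have "summable (\<lambda>k. g (r (Suc k)) x - g (r k) x)"
      unfolding D_def by (rule summable_rabs_cancel)
    then have "convergent (\<lambda>n. (\<Sum>k<n. g (r (Suc k)) x - g (r k) x) + g (r 0) x)"
      by (intro convergent_add convergent_const) (simp add: summable_iff_convergent)
    moreover have "(\<Sum>k<n. g (r (Suc k)) x - g (r k) x) = g (r n) x - g (r 0) x" for n
      by (rule sum_lessThan_telescope)
    ultimately have "convergent (\<lambda>n. g (r n) x)" by simp
    then show ?case by (simp add: convergent_LIMSEQ_iff)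
  qed
  define h where "h x = lim (\<lambda>j. g (r j) x)" for x
  have [measurable]: "h \<in> borel_measurable leb01"
    unfolding h_def[abs_def] by (rule borel_measurable_lim_metric) measurable
  have est: "(\<integral>\<^sup>+x. ennreal ((g m x - h x)\<^sup>2) \<partial>leb01) \<le> ennreal (((1/2)^k)\<^sup>2)" if m: "m \<ge> r k" for m k
  proof -
    have "(\<integral>\<^sup>+x. ennreal ((g m x - h x)\<^sup>2) \<partial>leb01) = (\<integral>\<^sup>+x. liminf (\<lambda>j. ennreal ((g m x - g (r j) x)\<^sup>2)) \<partial>leb01)"
    proof (rule nn_integral_cong_AE)
      show "AE x in leb01. ennreal ((g m x - h x)\<^sup>2) = liminf (\<lambda>j. ennreal ((g m x - g (r j) x)\<^sup>2))"
        using conv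
      proof eventually_elim
        case (elim x)
        then have "(\<lambda>j. ennreal ((g m x - g (r j) x)\<^sup>2)) \<longlonglongrightarrow> ennreal ((g m x - h x)\<^sup>2)"
          unfolding h_def by (intro tendsto_ennrealI tendsto_intros)
        from lim_imp_Liminf[OF sequentially_bot this] show ?case by (rule sym)
      qed
    qed
    also have "\<dots> \<le> liminf (\<lambda>j. \<integral>\<^sup>+x. ennreal ((g m x - g (r j) x)\<^sup>2) \<partial>leb01)"
      by (rule nn_integral_liminf) measurable
    also have "\<dots> \<le> liminf (\<lambda>j. ennreal (((1/2)^k)\<^sup>2))"
    proof (rule Liminf_mono)
      show "\<forall>\<^sub>F j in sequentially. (\<integral>\<^sup>+x. ennreal ((g m x - g (r j) x)\<^sup>2) \<partial>leb01) \<le> ennreal (((1/2)^k)\<^sup>2)"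
        using eventually_ge_at_top[of k]
      proof eventually_elim
        case (elim j)
        have "(\<integral>\<^sup>+x. ennreal ((g m x - g (r j) x)\<^sup>2) \<partial>leb01) = ennreal (\<integral>x. (g m x - g (r j) x)\<^sup>2 \<partial>leb01)"
          by (rule nn_integral_eq_integral[OF L2_square[OF L2_diff[OF g g]]]) simp
        also have "\<dots> \<le> ennreal (((1/2)^k)\<^sup>2)"
          using N[of k m "r j"] rN[of k k] rN[of k j] m elim by (intro ennreal_leI) auto
        finally show ?case .
      qed
    qed
    also have "\<dots> = ennreal (((1/2)^k)\<^sup>2)" by (simp add: Liminf_const)
    finally show ?thesis .
  qed
  have gh: "(\<lambda>x. g m x - h x) \<in> L2_01" if m: "m \<ge> r 0" for m
  proof -
    have "integrable leb01 (\<lambda>x. (g m x - h x)\<^sup>2)"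
      by (rule integrableI_nonneg) (use order.strict_trans1[OF est[OF m]] in auto)
    then show ?thesis by (simp add: L2_01_def)
  qed
  have hL: "h \<in> L2_01" using L2_diff[OF g[of "r 0"] gh[OF order_refl]] by simp
  have est2: "(\<integral>x. (g m x - h x)\<^sup>2 \<partial>leb01) \<le> ((1/2)^k)\<^sup>2" if m: "m \<ge> r k" for m k
    using est[OF m] nn_integral_eq_integral[OF L2_square[OF L2_diff[OF g hL]], of m] by simp
  have "(\<lambda>n. \<integral>x. (g n x - h x)\<^sup>2 \<partial>leb01) \<longlonglongrightarrow> 0"
  proof (rule LIMSEQ_I)
    fix e :: real assume e: "e > 0"
    have "(\<lambda>k. ((1/2)^k)\<^sup>2 :: real) \<longlonglongrightarrow> 0\<^sup>2" by (intro tendsto_intros) auto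
    then have "\<forall>\<^sub>F k in sequentially. ((1/2)^k)\<^sup>2 < e" using e by (intro order_tendstoD(2)) auto
    then obtain k where k: "((1/2)^k)\<^sup>2 < e" by (auto simp: eventually_sequentially)
    show "\<exists>no. \<forall>n\<ge>no. norm ((\<integral>x. (g n x - h x)\<^sup>2 \<partial>leb01) - 0) < e"
      using est2 k by (intro exI[of _ "r k"] allI impI) (fastforce intro: order.strict_trans1)
  qed
  with hL show thesis by (rule that)
qed

text \<open>The Hilbert space $H^1(0,1)$. Every class in $H^1(0,1)$ has exactly one representative that is
  continuous on $[0,1]$, and point values refer to that representative; it is extended by zero
  outside $[0,1]$ so that equality of representatives is equality in $H^1(0,1)$.\<close>

typedef h1 = "{u :: real \<Rightarrow> real. continuous_on {0..1} u \<and> (\<forall>x. x \<notin> {0..1} \<longrightarrow> u x = 0) \<and>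
    (\<exists>g\<in>L2_01. weak_deriv u g)}"
  morphisms h1_fun Abs_h1
proof (intro exI CollectI conjI)
  show "\<exists>g\<in>L2_01. weak_deriv (\<lambda>_. 0) g"
    by (rule bexI[of _ "\<lambda>_. 0"]) (simp_all add: weak_deriv_def L2_continuous)
qed auto

text \<open>A representative of the weak derivative, determined almost everywhere.\<close>

definition h1_deriv :: "h1 \<Rightarrow> real \<Rightarrow> real"
  where "h1_deriv u = (SOME g. g \<in> L2_01 \<and> weak_deriv (h1_fun u) g)"

lemma h1_deriv: "h1_deriv u \<in> L2_01" "weak_deriv (h1_fun u) (h1_deriv u)"
proof -
  have "\<exists>g. g \<in> L2_01 \<and> weak_deriv (h1_fun u) g" using h1_fun[of u] by auto
  from someI_ex[OF this] show "h1_deriv u \<in> L2_01" "weak_deriv (h1_fun u) (h1_deriv u)"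
    by (auto simp: h1_deriv_def)
qed

lemma h1_continuous: "continuous_on {0..1} (h1_fun u)" and h1_outside: "x \<notin> {0..1} \<Longrightarrow> h1_fun u x = 0"
  using h1_fun[of u] by auto

lemma h1_L2: "h1_fun u \<in> L2_01" by (rule L2_continuous[OF h1_continuous])

lemma h1_deriv_unique: "g \<in> L2_01 \<Longrightarrow> weak_deriv (h1_fun u) g \<Longrightarrow> AE x in leb01. h1_deriv u x = g x"
  using weak_deriv_unique h1_deriv by blast

lemma h1_eqI: "(\<And>x. x \<in> {0..1} \<Longrightarrow> h1_fun u x = h1_fun v x) \<Longrightarrow> u = v"
  by (metis h1_fun_inject h1_outside ext)

lemma h1_fun_Abs:
  assumes "continuous_on {0..1} u" "g \<in> L2_01" "weak_deriv u g"
  shows "h1_fun (Abs_h1 (\<lambda>x. if x \<in> {0..1} then u x else 0)) = (\<lambda>x. if x \<in> {0..1} then u x else 0)"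
proof (rule Abs_h1_inverse, intro CollectI conjI bexI)
  show "continuous_on {0..1} (\<lambda>x. if x \<in> {0..1} then u x else 0)"
    by (rule continuous_on_eq[OF assms(1)]) simp
  show "weak_deriv (\<lambda>x. if x \<in> {0..1} then u x else 0) g"
    by (rule weak_deriv_cong[OF assms(3)]) simp
qed (use assms in auto)

instantiation h1 :: real_vector
begin
definition "0 = Abs_h1 (\<lambda>_. 0)"
definition "u + v = Abs_h1 (\<lambda>x. h1_fun u x + h1_fun v x)"
definition "a *\<^sub>R u = Abs_h1 (\<lambda>x. a * h1_fun u x)"
definition "- u = Abs_h1 (\<lambda>x. - h1_fun u x)"
definition "u - v = Abs_h1 (\<lambda>x. h1_fun u x - h1_fun v x)"

lemma h1_mem_lincomb: "(\<lambda>x. a * h1_fun u x + b * h1_fun v x) \<in> 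
  {u :: real \<Rightarrow> real. continuous_on {0..1} u \<and> (\<forall>x. x \<notin> {0..1} \<longrightarrow> u x = 0) \<and> (\<exists>g\<in>L2_01. weak_deriv u g)}"
proof (intro CollectI conjI bexI)
  show "weak_deriv (\<lambda>x. a * h1_fun u x + b * h1_fun v x) (\<lambda>x. a * h1_deriv u x + b * h1_deriv v x)"
    by (intro weak_deriv_add weak_deriv_scale h1_deriv L2_scale h1_L2)
  show "(\<lambda>x. a * h1_deriv u x + b * h1_deriv v x) \<in> L2_01"
    by (intro L2_add h1_deriv L2_scale)
qed (auto intro!: continuous_intros h1_continuous simp: h1_outside)

lemma h1_fun_simps [simp]:
  "h1_fun 0 x = 0" "h1_fun (u + v) x = h1_fun u x + h1_fun v x" "h1_fun (a *\<^sub>R u) x = a * h1_fun u x"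
  "h1_fun (- u) x = - h1_fun u x" "h1_fun (u - v) x = h1_fun u x - h1_fun v x"
  using h1_mem_lincomb[of 0 undefined 0 undefined] h1_mem_lincomb[of 1 u 1 v] h1_mem_lincomb[of a u 0 u] 
    h1_mem_lincomb[of "-1" u 0 u] h1_mem_lincomb[of 1 u "-1" v]
  by (simp_all add: zero_h1_def plus_h1_def scaleR_h1_def uminus_h1_def minus_h1_def Abs_h1_inverse)

instance
  by standard (auto intro!: h1_eqI simp: algebra_simps)
end

lemma h1_deriv_add: "AE x in leb01. h1_deriv (u + v) x = h1_deriv u x + h1_deriv v x"
proof (rule h1_deriv_unique)
  show "weak_deriv (h1_fun (u + v)) (\<lambda>x. h1_deriv u x + h1_deriv v x)"
    using weak_deriv_add[OF h1_deriv(2) h1_deriv(2) h1_L2 h1_L2 h1_deriv(1) h1_deriv(1), of u v]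
    by (rule weak_deriv_cong) simp
qed (intro L2_add h1_deriv)

lemma h1_deriv_scaleR: "AE x in leb01. h1_deriv (a *\<^sub>R u) x = a * h1_deriv u x"
proof (rule h1_deriv_unique)
  show "weak_deriv (h1_fun (a *\<^sub>R u)) (\<lambda>x. a * h1_deriv u x)"
    using weak_deriv_scale[OF h1_deriv(2)[of u], of a]
    by (rule weak_deriv_cong) simp
qed (intro L2_scale h1_deriv)

instantiation h1 :: real_inner
begin

definition inner_h1_def:
  "u \<bullet> v = (\<integral>x. h1_fun u x * h1_fun v x \<partial>leb01) + (\<integral>x. h1_deriv u x * h1_deriv v x \<partial>leb01)"
definition norm_h1_def: "norm u = sqrt (u \<bullet> u)" for u :: h1
definition sgn_h1_def: "sgn u = u /\<^sub>R norm u" for u :: h1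
definition dist_h1_def: "dist u v = norm (u - v)" for u v :: h1
definition uniformity_h1_def [code del]:
  "(uniformity :: (h1 \<times> h1) filter) = (INF e\<in>{0<..}. principal {(x, y). dist x y < e})"
definition open_h1_def [code del]:
  "open (U :: h1 set) \<longleftrightarrow> (\<forall>x\<in>U. eventually (\<lambda>(x', y). x' = x \<longrightarrow> y \<in> U) uniformity)"

instance
proof
  note [measurable] = L2_measurable[OF h1_deriv(1)] L2_measurable[OF h1_L2]
  fix u v w :: h1 and a :: real
  show "u \<bullet> v = v \<bullet> u" by (simp add: inner_h1_def mult.commute)
  have "(\<integral>x. h1_deriv (u + v) x * h1_deriv w x \<partial>leb01) = (\<integral>x. h1_deriv u x * h1_deriv w x + h1_deriv v x * h1_deriv w x \<partial>leb01)"
    by (rule integral_cong_AE) (measurable, use h1_deriv_add[of u v] in eventually_elim, simp add: algebra_simps)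
  then show "(u + v) \<bullet> w = u \<bullet> w + v \<bullet> w"
    by (simp add: inner_h1_def L2_mult h1_L2 h1_deriv distrib_right)
  have "(\<integral>x. h1_deriv (a *\<^sub>R u) x * h1_deriv v x \<partial>leb01) = (\<integral>x. a * (h1_deriv u x * h1_deriv v x) \<partial>leb01)"
    by (rule integral_cong_AE) (measurable, use h1_deriv_scaleR[of a u] in eventually_elim, simp add: algebra_simps)
  then show "(a *\<^sub>R u) \<bullet> v = a * (u \<bullet> v)"
    by (simp add: inner_h1_def mult.assoc distrib_left)
  show "0 \<le> u \<bullet> u" by (simp add: inner_h1_def)
  show "u \<bullet> u = 0 \<longleftrightarrow> u = 0"
  proof
    assume z: "u \<bullet> u = 0"
    have "(\<integral>x. h1_fun u x * h1_fun u x \<partial>leb01) = 0"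
      using z by (simp add: inner_h1_def add_nonneg_eq_0_iff)
    then have "AE x in leb01. h1_fun u x = 0"
      by (subst (asm) integral_nonneg_eq_0_iff_AE) (auto simp: L2_mult h1_L2)
    from cont_AE_zero[OF h1_continuous this] show "u = 0" by (intro h1_eqI) simp
  next
    assume u: "u = 0"
    have "0 \<bullet> (0::h1) = (0 *\<^sub>R 0) \<bullet> (0::h1)" by simp
    also have "\<dots> = 0"
    proof -
      have "AE x in leb01. h1_deriv (0::h1) x = 0" using h1_deriv_scaleR[of 0 0] by simp
      then have "(\<integral>x. h1_deriv (0::h1) x * h1_deriv (0::h1) x \<partial>leb01) = (\<integral>x. 0 \<partial>leb01)"
        by (intro integral_cong_AE) (auto intro: L2_measurable h1_deriv L2_mult simp: borel_measurable_times[OF L2_measurable L2_measurable] h1_deriv)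
      then show ?thesis by (simp add: inner_h1_def)
    qed
    finally show "u \<bullet> u = 0" using u by simp
  qed
  show "norm u = sqrt (u \<bullet> u)" by (rule norm_h1_def)
qed (rule sgn_h1_def dist_h1_def uniformity_h1_def open_h1_def)+

end

lemma h1_norm_square: "(norm u)\<^sup>2 = (\<integral>x. (h1_fun u x)\<^sup>2 \<partial>leb01) + (\<integral>x. (h1_deriv u x)\<^sup>2 \<partial>leb01)" for u :: h1
  unfolding power2_norm_eq_inner inner_h1_def by (simp add: power2_eq_square)

lemma h1_sup_bound:
  assumes x: "x \<in> {0..1}"
  shows "\<bar>h1_fun u x\<bar> \<le> 2 * norm u"
proof -
  have i: "integrable leb01 (\<lambda>y. \<bar>h1_fun u y\<bar>)" "integrable leb01 (\<lambda>y. \<bar>h1_deriv u y\<bar>)"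
    by (auto intro: L2_integrable h1_deriv h1_L2)
  have l: "(\<integral>y. \<bar>h1_fun u y\<bar> \<partial>leb01) \<le> norm u"
    by (rule power2_le_imp_le) (use L1_le_L2[OF h1_L2[of u]] in \<open>auto simp: h1_norm_square intro: order_trans\<close>)
  have l': "(\<integral>y. \<bar>h1_deriv u y\<bar> \<partial>leb01) \<le> norm u"
    by (rule power2_le_imp_le) (use L1_le_L2[OF h1_deriv(1)[of u]] in \<open>auto simp: h1_norm_square intro: order_trans\<close>)
  define G where "G x = (\<integral>y. h1_deriv u y * indicator {..x} y \<partial>leb01)" for x
  have G: "\<And>x. x \<in> {0..1} \<Longrightarrow> h1_fun u x = h1_fun u 0 + G x"
    unfolding G_def
    using weak_deriv_iff_primitive[OF h1_continuous h1_deriv(1), of u u, THEN iffD1, OF h1_deriv(2)] by blast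
  have mi: "indicat_real {..a} \<in> borel_measurable leb01" for a
    by (rule measurable_restrict_space1) auto
  have gi: "integrable leb01 (\<lambda>y. h1_deriv u y * indicator {..a} y)" for a
  proof (rule Bochner_Integration.integrable_bound[OF i(2)])
    show "(\<lambda>y. h1_deriv u y * indicator {..a} y) \<in> borel_measurable leb01"
      by (intro borel_measurable_times mi L2_measurable h1_deriv)
  qed (auto simp: indicator_def)
  have d: "\<bar>h1_fun u x\<bar> \<le> \<bar>h1_fun u y\<bar> + norm u" if y: "y \<in> {0..1}" for y
  proof -
    have "h1_fun u x - h1_fun u y = (\<integral>z. h1_deriv u z * indicator {..x} z - h1_deriv u z * indicator {..y} z \<partial>leb01)"
    proof -
      have "h1_fun u x - h1_fun u y = G x - G y" using G[OF x] G[OF y] by linarith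
      also have "\<dots> = (\<integral>z. h1_deriv u z * indicator {..x} z - h1_deriv u z * indicator {..y} z \<partial>leb01)"
        unfolding G_def using gi by (intro Bochner_Integration.integral_diff[symmetric])
      finally show ?thesis .
    qed
    also have "\<bar>\<dots>\<bar> \<le> (\<integral>z. \<bar>h1_deriv u z * indicator {..x} z - h1_deriv u z * indicator {..y} z\<bar> \<partial>leb01)"
      by (rule integral_abs_bound)
    also have "\<dots> \<le> (\<integral>z. \<bar>h1_deriv u z\<bar> \<partial>leb01)"
      by (rule integral_mono) (use gi i in \<open>auto simp: indicator_def\<close>)
    finally show ?thesis using l' by linarith
  qed
  have "\<bar>h1_fun u x\<bar> = (\<integral>y. \<bar>h1_fun u x\<bar> \<partial>leb01)" using measure_leb01 by simp
  also have "\<dots> \<le> (\<integral>y. \<bar>h1_fun u y\<bar> + norm u \<partial>leb01)"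
    by (rule integral_mono) (use i d in \<open>auto simp: space_restrict_space\<close>)
  also have "\<dots> = (\<integral>y. \<bar>h1_fun u y\<bar> \<partial>leb01) + norm u" using i measure_leb01 by simp
  finally show ?thesis using l by simp
qed

lemma L2_tendsto:
  assumes f: "\<And>n. f n \<in> L2_01" "k \<in> L2_01" and h: "h \<in> L2_01" and z: "(\<lambda>n. \<integral>x. (f n x - k x)\<^sup>2 \<partial>leb01) \<longlonglongrightarrow> 0"
  shows "(\<lambda>n. \<integral>x. f n x * h x \<partial>leb01) \<longlonglongrightarrow> (\<integral>x. k x * h x \<partial>leb01)"
proof (rule LIM_zero_cancel)
  have "(\<lambda>n. sqrt ((\<integral>x. (f n x - k x)\<^sup>2 \<partial>leb01) * (\<integral>x. (h x)\<^sup>2 \<partial>leb01))) \<longlonglongrightarrow> sqrt (0 * (\<integral>x. (h x)\<^sup>2 \<partial>leb01))"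
    by (intro tendsto_intros z)
  then have lim: "(\<lambda>n. sqrt ((\<integral>x. (f n x - k x)\<^sup>2 \<partial>leb01) * (\<integral>x. (h x)\<^sup>2 \<partial>leb01))) \<longlonglongrightarrow> 0" by simp
  show "(\<lambda>n. (\<integral>x. f n x * h x \<partial>leb01) - (\<integral>x. k x * h x \<partial>leb01)) \<longlonglongrightarrow> 0"
  proof (rule Lim_null_comparison[OF _ lim], intro always_eventually allI)
    fix n
    have "(\<integral>x. f n x * h x \<partial>leb01) - (\<integral>x. k x * h x \<partial>leb01) = (\<integral>x. (f n x - k x) * h x \<partial>leb01)"
      using f h by (simp add: L2_mult left_diff_distrib)
    then show "norm ((\<integral>x. f n x * h x \<partial>leb01) - (\<integral>x. k x * h x \<partial>leb01))
       \<le> sqrt ((\<integral>x. (f n x - k x)\<^sup>2 \<partial>leb01) * (\<integral>x. (h x)\<^sup>2 \<partial>leb01))"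
      using real_sqrt_le_mono[OF L2_Cauchy_Schwarz[OF L2_diff[OF f(1) f(2)] h, of n]] by simp
  qed
qed

lemma h1_deriv_diff: "AE x in leb01. h1_deriv (u - v) x = h1_deriv u x - h1_deriv v x"
  using h1_deriv_add[of u "(-1) *\<^sub>R v"] h1_deriv_scaleR[of "-1" v] by eventually_elim simp

instance h1 :: complete_space
proof
  fix X :: "nat \<Rightarrow> h1" assume X: "Cauchy X"
  note [measurable] = L2_measurable[OF h1_deriv(1)] L2_measurable[OF h1_L2]
  have dd: "(\<integral>x. (h1_deriv (u - v) x)\<^sup>2 \<partial>leb01) = (\<integral>x. (h1_deriv u x - h1_deriv v x)\<^sup>2 \<partial>leb01)" for u v
    by (rule integral_cong_AE) (measurable, use h1_deriv_diff[of u v] in eventually_elim, simp)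
  have "\<exists>N. \<forall>m\<ge>N. \<forall>n\<ge>N. (\<integral>x. (h1_deriv (X m) x - h1_deriv (X n) x)\<^sup>2 \<partial>leb01) < e" if e: "e > 0" for e
  proof -
    obtain N where N: "\<And>m n. m \<ge> N \<Longrightarrow> n \<ge> N \<Longrightarrow> norm (X m - X n) < sqrt e"
      using X e unfolding Cauchy_iff by (metis real_sqrt_gt_zero)
    show ?thesis
    proof (intro exI allI impI)
      fix m n assume "N \<le> m" "N \<le> n"
      then have "(norm (X m - X n))\<^sup>2 < e" using N[of m n] e by (metis norm_ge_zero real_less_rsqrt real_sqrt_less_iff real_sqrt_unique not_less power2_eq_square real_sqrt_le_mono)
      then show "(\<integral>x. (h1_deriv (X m) x - h1_deriv (X n) x)\<^sup>2 \<partial>leb01) < e"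
        using L2_square_nonneg[of "h1_fun (X m - X n)"] unfolding h1_norm_square dd by linarith
    qed
  qed
  from L2_complete[OF h1_deriv(1) this] obtain g where g: "g \<in> L2_01"
    "(\<lambda>n. \<integral>x. (h1_deriv (X n) x - g x)\<^sup>2 \<partial>leb01) \<longlonglongrightarrow> 0" by blast
  have "uniformly_convergent_on {0..1} (\<lambda>n. h1_fun (X n))"
  proof (rule Cauchy_uniformly_convergent, unfold uniformly_Cauchy_on_def, intro allI impI)
    fix e :: real assume e: "e > 0"
    obtain N where N: "\<And>m n. m \<ge> N \<Longrightarrow> n \<ge> N \<Longrightarrow> norm (X m - X n) < e / 2"
      using X e unfolding Cauchy_iff by (metis half_gt_zero)
    show "\<exists>M. \<forall>x\<in>{0..1}. \<forall>m\<ge>M. \<forall>n\<ge>M. dist (h1_fun (X m) x) (h1_fun (X n) x) < e"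
    proof (intro exI ballI allI impI)
      fix x :: real and m n assume "x \<in> {0..1}" "N \<le> m" "N \<le> n"
      then show "dist (h1_fun (X m) x) (h1_fun (X n) x) < e"
        using h1_sup_bound[of x "X m - X n"] N[of m n] by (simp add: dist_real_def)
    qed
  qed
  then obtain u where u: "uniform_limit {0..1} (\<lambda>n. h1_fun (X n)) u sequentially"
    by (auto simp: uniformly_convergent_on_def)
  have uc: "continuous_on {0..1} u"
    by (rule uniform_limit_theorem[OF _ u]) (auto intro: h1_continuous always_eventually)
  note uL = L2_continuous[OF uc]
  have lu: "(\<lambda>n. \<integral>x. (h1_fun (X n) x - u x)\<^sup>2 \<partial>leb01) \<longlonglongrightarrow> 0"
  proof (rule LIMSEQ_I)
    fix e :: real assume e: "e > 0"
    have "0 < sqrt (e/2)" using e by simp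
    from uniform_limitD[OF u this]
    obtain N where N: "\<And>n x. n \<ge> N \<Longrightarrow> x \<in> {0..1} \<Longrightarrow> \<bar>h1_fun (X n) x - u x\<bar> < sqrt (e/2)"
      unfolding eventually_sequentially dist_real_def by blast
    show "\<exists>no. \<forall>n\<ge>no. norm ((\<integral>x. (h1_fun (X n) x - u x)\<^sup>2 \<partial>leb01) - 0) < e"
    proof (intro exI allI impI)
      fix n assume n: "N \<le> n"
      have "(\<integral>x. (h1_fun (X n) x - u x)\<^sup>2 \<partial>leb01) \<le> (\<integral>x. e/2 \<partial>leb01)"
      proof (rule integral_mono)
        show "integrable leb01 (\<lambda>x. (h1_fun (X n) x - u x)\<^sup>2)" by (intro L2_square L2_diff h1_L2 uL)
        fix x assume "x \<in> space leb01"
        then have "\<bar>h1_fun (X n) x - u x\<bar> \<le> sqrt (e/2)" using N[OF n, of x] by (simp add: space_restrict_space)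
        then have "\<bar>h1_fun (X n) x - u x\<bar>\<^sup>2 \<le> (sqrt (e/2))\<^sup>2" by (intro power_mono) auto
        then show "(h1_fun (X n) x - u x)\<^sup>2 \<le> e/2" using e by simp
      qed simp
      then show "norm ((\<integral>x. (h1_fun (X n) x - u x)\<^sup>2 \<partial>leb01) - 0) < e" using e measure_leb01 by simp
    qed
  qed
  have w: "weak_deriv u g"
    unfolding weak_deriv_def
  proof (intro ballI)
    fix \<phi> assume t: "\<phi> \<in> test_functions"
    have "(\<lambda>n. \<integral>x. h1_fun (X n) x * deriv \<phi> x \<partial>leb01) \<longlonglongrightarrow> (\<integral>x. u x * deriv \<phi> x \<partial>leb01)"
      by (intro L2_tendsto h1_L2 uL test_L2 t lu)
    moreover have "(\<lambda>n. - (\<integral>x. h1_deriv (X n) x * \<phi> x \<partial>leb01)) \<longlonglongrightarrow> - (\<integral>x. g x * \<phi> x \<partial>leb01)"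
      by (intro tendsto_minus L2_tendsto h1_deriv test_L2 t g)
    moreover have "(\<integral>x. h1_fun (X n) x * deriv \<phi> x \<partial>leb01) = - (\<integral>x. h1_deriv (X n) x * \<phi> x \<partial>leb01)" for n
      using h1_deriv(2)[of "X n"] t by (simp add: weak_deriv_def)
    ultimately show "(\<integral>x. u x * deriv \<phi> x \<partial>leb01) = - (\<integral>x. g x * \<phi> x \<partial>leb01)"
      by (simp add: LIMSEQ_unique)
  qed
  define U where "U = Abs_h1 (\<lambda>x. if x \<in> {0..1} then u x else 0)"
  have U: "h1_fun U = (\<lambda>x. if x \<in> {0..1} then u x else 0)"
    unfolding U_def by (rule h1_fun_Abs[OF uc g(1) w])
  have "weak_deriv (h1_fun U) g" by (rule weak_deriv_cong[OF w]) (simp add: U)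
  then have Ug: "AE x in leb01. h1_deriv U x = g x" by (rule h1_deriv_unique[OF g(1)])
  have e1: "(\<integral>x. (h1_fun (X n - U) x)\<^sup>2 \<partial>leb01) = (\<integral>x. (h1_fun (X n) x - u x)\<^sup>2 \<partial>leb01)" for n
    by (rule Bochner_Integration.integral_cong) (auto simp: U space_restrict_space)
  have gm[measurable]: "g \<in> borel_measurable leb01" using g L2_measurable by auto
  have e2: "(\<integral>x. (h1_deriv (X n - U) x)\<^sup>2 \<partial>leb01) = (\<integral>x. (h1_deriv (X n) x - g x)\<^sup>2 \<partial>leb01)" for n
    unfolding dd by (rule integral_cong_AE) (measurable, use Ug in eventually_elim, simp)
  have "(\<lambda>n. sqrt ((norm (X n - U))\<^sup>2)) \<longlonglongrightarrow> sqrt (0 + 0)"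
    unfolding h1_norm_square e1 e2 by (intro tendsto_intros lu g)
  then have "(\<lambda>n. norm (X n - U)) \<longlonglongrightarrow> 0" by simp
  then have "X \<longlonglongrightarrow> U" by (simp add: LIM_zero_iff tendsto_norm_zero_iff)
  then show "convergent X" by (auto simp: convergent_def)
qed

lemma weak_deriv_C1:
  assumes d: "\<And>x::real. (u has_real_derivative u' x) (at x)" and c: "continuous_on UNIV u'"
  shows "weak_deriv u u'"
  unfolding weak_deriv_def
proof (intro ballI)
  fix \<phi> assume t: "\<phi> \<in> test_functions"
  have cu: "continuous_on S u" for S
    by (meson DERIV_isCont continuous_at_imp_continuous_on d)
  have L: "u \<in> L2_01" "u' \<in> L2_01" by (auto intro: L2_continuous cu continuous_on_subset[OF c])
  note \<phi> = test_functions_continuous[OF t]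
  have "(\<integral>x. (u x * deriv \<phi> x + u' x * \<phi> x) * indicator {0..} x \<partial>leb01) = u 1 * \<phi> 1 - u 0 * \<phi> 0"
    by (rule FTC01) (auto intro!: derivative_eq_intros d \<phi> continuous_intros cu c)
  also have "(\<integral>x. (u x * deriv \<phi> x + u' x * \<phi> x) * indicator {0..} x \<partial>leb01)
      = (\<integral>x. u x * deriv \<phi> x + u' x * \<phi> x \<partial>leb01)"
    by (rule Bochner_Integration.integral_cong) (auto simp: space_restrict_space)
  also have "\<dots> = (\<integral>x. u x * deriv \<phi> x \<partial>leb01) + (\<integral>x. u' x * \<phi> x \<partial>leb01)"
    using L t by (simp add: L2_mult test_L2)
  also have "u 1 * \<phi> 1 - u 0 * \<phi> 0 = 0" using t by (auto simp: test_functions_def)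
  finally show "(\<integral>x. u x * deriv \<phi> x \<partial>leb01) = - (\<integral>x. u' x * \<phi> x \<partial>leb01)" by simp
qed

lemma weak_deriv_cong_right:
  assumes "weak_deriv u g" "\<And>x. x \<in> {0..1} \<Longrightarrow> g x = h x"
  shows "weak_deriv u h"
proof -
  have "(\<integral>x. h x * \<phi> x \<partial>leb01) = (\<integral>x. g x * \<phi> x \<partial>leb01)" for \<phi>
    by (rule Bochner_Integration.integral_cong) (auto simp: space_restrict_space assms)
  with assms show ?thesis by (simp add: weak_deriv_def)
qed

text \<open>The weak derivative itself lies in $H^1(0,1)$, that is, the first argument is in $H^2(0,1)$.\<close>

definition h1_has_deriv :: "h1 \<Rightarrow> h1 \<Rightarrow> bool"
  where "h1_has_deriv z p \<longleftrightarrow> weak_deriv (h1_fun z) (h1_fun p)"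

lemma h1_has_deriv_unique: "h1_has_deriv z p \<Longrightarrow> h1_has_deriv z q \<Longrightarrow> p = q"
proof (rule h1_eqI)
  fix x :: real assume "h1_has_deriv z p" "h1_has_deriv z q" and x: "x \<in> {0..1}"
  then have "AE y in leb01. h1_fun p y = h1_fun q y"
    by (auto simp: h1_has_deriv_def intro: weak_deriv_unique h1_L2)
  then have "AE y in leb01. h1_fun p y - h1_fun q y = 0" by simp
  from cont_AE_zero[OF _ this x] show "h1_fun p x = h1_fun q x"
    by (simp add: continuous_on_diff h1_continuous)
qed

text \<open>The domain of the Neumann Laplacian as a generator on $H^1(0,1)$: those $z \in H^2(0,1)$ with
  $z_x(0) = z_x(1) = 0$ and $z_{xx} \in H^1(0,1)$, where $p = z_x$ and $w = z_{xx}$.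
  Outside \<open>dom_neumann\<close> the value of \<open>neumann_laplacian\<close> is irrelevant.\<close>

definition dom_neumann :: "h1 set"
  where "dom_neumann = {z. \<exists>p w. h1_has_deriv z p \<and> h1_has_deriv p w \<and> h1_fun p 0 = 0 \<and> h1_fun p 1 = 0}"

definition neumann_laplacian :: "h1 \<Rightarrow> h1"
  where "neumann_laplacian z = (THE w. \<exists>p. h1_has_deriv z p \<and> h1_has_deriv p w)"

lemma neumann_laplacian_eq: "h1_has_deriv z p \<Longrightarrow> h1_has_deriv p w \<Longrightarrow> neumann_laplacian z = w"
  unfolding neumann_laplacian_def by (rule the_equality) (blast, metis h1_has_deriv_unique)

text \<open>$-\rho_{xx} + k \rho = 0$, $\rho_x(0) = 0$, $\rho_x(1) = 1$. Requiring $w = \rho_{xx}$ to be in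
  $H^1(0,1)$ is no restriction, because the equation forces $w = k \rho$.\<close>

definition solves_rho_problem :: "real \<Rightarrow> h1 \<Rightarrow> bool"
  where "solves_rho_problem k \<rho> \<longleftrightarrow>
    (\<exists>p w. h1_has_deriv \<rho> p \<and> h1_has_deriv p w \<and> - w + k *\<^sub>R \<rho> = 0 \<and> h1_fun p 0 = 0 \<and> h1_fun p 1 = 1)"

text \<open>Normalised in the $H^1$ inner product, not in $L^2$.\<close>

definition neumann_coeff :: "nat \<Rightarrow> real"
  where "neumann_coeff n = (if n = 0 then 1 else sqrt (2 / (1 + pi\<^sup>2 * (real n)\<^sup>2)))"

definition neumann_phi :: "nat \<Rightarrow> h1"
  where "neumann_phi n = Abs_h1 (\<lambda>x. if x \<in> {0..1} then neumann_coeff n * cos (real n * pi * x) else 0)"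

lemma h1_fun_C1:
  assumes d: "\<And>x::real. (u has_real_derivative u' x) (at x)" and c: "continuous_on UNIV u'"
  shows "h1_fun (Abs_h1 (\<lambda>x. if x \<in> {0..1} then u x else 0)) = (\<lambda>x. if x \<in> {0..1} then u x else 0)"
proof (rule h1_fun_Abs)
  show "continuous_on {0..1} u" by (meson DERIV_isCont continuous_at_imp_continuous_on d)
  show "u' \<in> L2_01" by (rule L2_continuous) (rule continuous_on_subset[OF c], simp)
qed (rule weak_deriv_C1[OF d c])

lemma h1_fun_neumann_phi:
  "h1_fun (neumann_phi n) = (\<lambda>x. if x \<in> {0..1} then neumann_coeff n * cos (real n * pi * x) else 0)"
  unfolding neumann_phi_def
  by (rule h1_fun_C1[where u'="\<lambda>x. - (neumann_coeff n * (real n * pi)) * sin (real n * pi * x)"])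
     (auto intro!: derivative_eq_intros continuous_intros)

lemma neumann_phi_eigen:
  "neumann_phi n \<in> dom_neumann" "neumann_laplacian (neumann_phi n) = - (pi\<^sup>2 * (real n)\<^sup>2) *\<^sub>R neumann_phi n"
proof -
  define a where "a = real n * pi"
  define k where "k = neumann_coeff n"
  define p where "p = Abs_h1 (\<lambda>x. if x \<in> {0..1} then - (k * a) * sin (a * x) else 0)"
  have p: "h1_fun p = (\<lambda>x. if x \<in> {0..1} then - (k * a) * sin (a * x) else 0)"
    unfolding p_def 
    by (rule h1_fun_C1[where u'="\<lambda>x. - (k * a\<^sup>2) * cos (a * x)"])
       (auto intro!: derivative_eq_intros continuous_intros simp: power2_eq_square)
  have "weak_deriv (\<lambda>x. k * cos (a * x)) (\<lambda>x. - (k * a) * sin (a * x))"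
    by (rule weak_deriv_C1) (auto intro!: derivative_eq_intros continuous_intros)
  then have 1: "weak_deriv (h1_fun (neumann_phi n)) (\<lambda>x. - (k * a) * sin (a * x))"
    by (rule weak_deriv_cong) (simp add: h1_fun_neumann_phi k_def a_def)
  have 1: "h1_has_deriv (neumann_phi n) p"
    unfolding h1_has_deriv_def by (rule weak_deriv_cong_right[OF 1]) (simp add: p)
  have "weak_deriv (\<lambda>x. - (k * a) * sin (a * x)) (\<lambda>x. - (k * a\<^sup>2) * cos (a * x))"
    by (rule weak_deriv_C1) (auto intro!: derivative_eq_intros continuous_intros simp: power2_eq_square)
  then have "weak_deriv (h1_fun p) (\<lambda>x. - (k * a\<^sup>2) * cos (a * x))"
    by (rule weak_deriv_cong) (simp add: p)
  then have 2: "h1_has_deriv p (- (pi\<^sup>2 * (real n)\<^sup>2) *\<^sub>R neumann_phi n)"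
    unfolding h1_has_deriv_def 
    by (rule weak_deriv_cong_right) (simp add: h1_fun_neumann_phi k_def a_def power2_eq_square)
  have "h1_fun p 0 = 0" "h1_fun p 1 = 0"
    by (simp_all add: p a_def)
  with 1 2 show "neumann_phi n \<in> dom_neumann" unfolding dom_neumann_def by blast
  show "neumann_laplacian (neumann_phi n) = - (pi\<^sup>2 * (real n)\<^sup>2) *\<^sub>R neumann_phi n"
    by (rule neumann_laplacian_eq[OF 1 2])
qed

text \<open>The product instance of \<^class>\<open>real_inner\<close> makes this the product Hilbert space. The columns
  $B, D \in \mathbb{R}^{d \times 1}$ are rendered as vectors, and the functional $\gamma_0^*$ is
  evaluation at $0$.\<close>

type_synonym 'd state = "(real^'d) \<times> real \<times> h1"

definition dom_Delta_tilde :: "'d::finite state set"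
  where "dom_Delta_tilde = {(X, Y, z). z \<in> dom_neumann}"

definition Delta_tilde :: "'d::finite state \<Rightarrow> 'd state"
  where "Delta_tilde = (\<lambda>(X, Y, z). (0, 0, neumann_laplacian z))"

definition A_tilde :: "real^'d^'d \<Rightarrow> real^'d \<Rightarrow> real \<Rightarrow> real \<Rightarrow> h1 \<Rightarrow> 'd::finite state \<Rightarrow> 'd state"
  where "A_tilde A B c \<mu> \<rho> = (\<lambda>(X, Y, z).
    (A *v X - (h1_fun \<rho> 0 * Y) *\<^sub>R B + h1_fun z 0 *\<^sub>R B, \<mu> * Y, c *\<^sub>R z))"

definition C_tilde :: "real^'d^'d \<Rightarrow> real^'d \<Rightarrow> h1 \<Rightarrow> 'd::finite state \<Rightarrow> 'd state"
  where "C_tilde C D \<rho> = (\<lambda>(X, Y, z).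
    (C *v X - (h1_fun \<rho> 0 * Y) *\<^sub>R D + h1_fun z 0 *\<^sub>R D, 0, 0))"

definition B_tilde :: "h1 \<Rightarrow> real \<Rightarrow> 'd::finite state"
  where "B_tilde \<rho> v = v *\<^sub>R (0, 1, - \<rho>)"

definition Q_tilde :: "real^'d^'d \<Rightarrow> real \<Rightarrow> 'd::finite state \<Rightarrow> 'd state"
  where "Q_tilde Q r = (\<lambda>(X, Y, z). (Q *v X, r * Y, 0))"

definition G_tilde :: "real^'d^'d \<Rightarrow> 'd::finite state \<Rightarrow> 'd state"
  where "G_tilde G = (\<lambda>(X, Y, z). (G *v X, 0, 0))"

definition H_N :: "nat \<Rightarrow> 'd::finite state set"
  where "H_N N = {(X, Y, z). z \<in> span (neumann_phi ` {..N})}"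

definition proj_N :: "nat \<Rightarrow> 'd::finite state \<Rightarrow> 'd state"
  where "proj_N N = (\<lambda>(X, Y, z). (X, Y, \<Sum>n\<le>N. (z \<bullet> neumann_phi n) *\<^sub>R neumann_phi n))"

definition C0_semigroup :: "(real \<Rightarrow> 'a::real_normed_vector \<Rightarrow>\<^sub>L 'a) \<Rightarrow> bool"
  where "C0_semigroup S \<longleftrightarrow>
    S 0 = id_blinfun \<and> (\<forall>s\<ge>0. \<forall>t\<ge>0. S (s + t) = S s o\<^sub>L S t) \<and>
    (\<forall>x. continuous_on {0..} (\<lambda>t. S t x))"

text \<open>The (unbounded) generator of \<open>S\<close> has domain exactly \<open>D\<close> and agrees there with \<open>L\<close>.\<close>

definition generated_by :: "(real \<Rightarrow> 'a::real_normed_vector \<Rightarrow>\<^sub>L 'a) \<Rightarrow> 'a set \<Rightarrow> ('a \<Rightarrow> 'a) \<Rightarrow> bool"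
  where "generated_by S D L \<longleftrightarrow> C0_semigroup S \<and>
    D = {x. \<exists>y. ((\<lambda>h. (S h x - x) /\<^sub>R h) \<longlongrightarrow> y) (at_right 0)} \<and>
    (\<forall>x\<in>D. ((\<lambda>h. (S h x - x) /\<^sub>R h) \<longlongrightarrow> L x) (at_right 0))"

text \<open>\<open>has_integral\<close> on \<open>{t..T}\<close> states at once that the integrand is integrable and that the mild
  equation holds.\<close>

definition mild_riccati_solution ::
    "real \<Rightarrow> (real \<Rightarrow> 'a::real_inner \<Rightarrow>\<^sub>L 'a) \<Rightarrow> ('a \<Rightarrow> 'a) \<Rightarrow> (real \<Rightarrow> 'a) \<Rightarrow> ('a \<Rightarrow> 'a) \<Rightarrow>
     ('a \<Rightarrow> 'a) \<Rightarrow> ('a \<Rightarrow> 'a) \<Rightarrow> real \<Rightarrow> (real \<Rightarrow> 'a \<Rightarrow>\<^sub>L 'a) \<Rightarrow> bool"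
  where "mild_riccati_solution T S A B C Q G \<delta> P \<longleftrightarrow>
    (\<forall>Z. continuous_on {0..T} (\<lambda>t. P t Z)) \<and>
    (\<forall>t\<in>{0..T}. \<forall>x y. P t x \<bullet> y = x \<bullet> P t y) \<and>
    (\<forall>t\<in>{0..T}. \<forall>Z.
      ((\<lambda>\<tau>. let z = S (\<tau> - t) Z in adjoint (S (\<tau> - t))
          (adjoint A (P \<tau> z) + P \<tau> (A z) + Q z + adjoint C (P \<tau> (C z))
            - (1 / \<delta>) *\<^sub>R P \<tau> (B (adjoint B (P \<tau> z)))))
        has_integral P t Z - adjoint (S (T - t)) (G (S (T - t) Z))) {t..T})"

text \<open>The adjoint with respect to the inner product restricted to the subspace \<open>V\<close> of the domain.\<close>

definition adjoint_on :: "'a::real_inner set \<Rightarrow> ('a \<Rightarrow> 'b::real_inner) \<Rightarrow> 'b \<Rightarrow> 'a"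
  where "adjoint_on V f y = (THE w. w \<in> V \<and> (\<forall>x\<in>V. f x \<bullet> y = x \<bullet> w))"

text \<open>Operators on a subspace \<open>V\<close> are functions on the ambient space; only their values on \<open>V\<close>
  matter. In this encoding the inclusion of \<open>V\<close> into the ambient space is the identity, so
  $P_N F P_N^*$ is \<open>proj_N N \<circ> F\<close> on \<open>H_N N\<close>.\<close>

definition linear_operator_on :: "'a::real_vector set \<Rightarrow> ('a \<Rightarrow> 'a) \<Rightarrow> bool"
  where "linear_operator_on V f \<longleftrightarrow> (\<forall>x\<in>V. f x \<in> V) \<and>
    (\<forall>x\<in>V. \<forall>y\<in>V. f (x + y) = f x + f y) \<and> (\<forall>a. \<forall>x\<in>V. f (a *\<^sub>R x) = a *\<^sub>R f x)"

definition matrix_riccati_solution ::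
    "'a::real_inner set \<Rightarrow> real \<Rightarrow> ('a \<Rightarrow> 'a) \<Rightarrow> ('a \<Rightarrow> 'a) \<Rightarrow> (real \<Rightarrow> 'a) \<Rightarrow> ('a \<Rightarrow> 'a) \<Rightarrow>
     ('a \<Rightarrow> 'a) \<Rightarrow> ('a \<Rightarrow> 'a) \<Rightarrow> real \<Rightarrow> (real \<Rightarrow> 'a \<Rightarrow> 'a) \<Rightarrow> bool"
  where "matrix_riccati_solution V T L A B C Q G \<delta> P \<longleftrightarrow>
    (\<forall>t\<in>{0..T}. linear_operator_on V (P t)) \<and>
    (\<forall>t\<in>{0..T}. \<forall>x\<in>V. \<exists>d. ((\<lambda>s. P s x) has_vector_derivative d) (at t within {0..T}) \<and>
      d + P t (L x + A x) + (L (P t x) + adjoint_on V A (P t x))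
        + adjoint_on V C (P t (C x)) + Q x
        - (1 / \<delta>) *\<^sub>R P t (B (adjoint_on UNIV B (P t x))) = 0) \<and>
    (\<forall>x\<in>V. P T x = G x)"

end

theory Submission
  imports Defs
begin

text \<open>Tested against pairs of vectors, both Riccati equations become scalar integral equations with
  the same bilinear form \<open>riccati_form\<close> in the same operators; the Galerkin equation merely evaluates it
  at $P_N x$, $P_N y$. The scalar $c$ acts diagonally, \<open>Q_tilde\<close> and \<open>G_tilde\<close> do not see the $H^1$ component,
  and $P_N \tilde B$ enters only through operators that already absorb $P_N$, so the only consistency error
  comes from the trace $z(0) = \langle\gamma_0, z\rangle$ and is at most a constant times
  $\|\gamma_0 - P_N\gamma_0\|$, uniformly on bounded sets. Hence the operator norm $e(t)$ of
  $\Pi(t) - \Pi_N(t) P_N$ satisfies $e(t) \le \int_t^T (\varepsilon_N + L e + L e^2)$ with $\varepsilon_N \to 0$,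
  and a Gronwall argument gives convergence even in operator norm. Positivity of the solutions plays no
  role: the quadratic term is controlled by a bootstrap from $e(T) = 0$.\<close>

subsection \<open>Uniform boundedness and eigenvectors of semigroups\<close>

text \<open>P_N does not tend to the identity in operator norm, so every occurrence of I - P_N must
  cancel, be absorbed by Pi_N P_N, or fall on one fixed vector; pairing both equations with test
  vectors makes this visible. The semigroup causes no error: H_N is spanned by eigenvectors of its
  generator, so S(s) commutes with P_N. As S is given only through its generator, its action on
  eigenvectors and then its self-adjointness have to be derived first. Bounds on Pi_N come merely
  from continuity on [0,T] for each fixed N and may grow with N. This is why the Gronwall estimate
  must forget its a priori bound, and why Pi_N is measured as Pi plus the error e, which makes the
  inequality quadratic.\<close>

lemma uniform_boundedness:
  fixes F :: "'i \<Rightarrow> 'a::{real_normed_vector,complete_space} \<Rightarrow>\<^sub>L 'b::real_normed_vector"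
  assumes pointwise: "\<And>x. \<exists>M. \<forall>i\<in>I. norm (F i x) \<le> M"
  shows "\<exists>M. \<forall>i\<in>I. norm (F i) \<le> M"
proof -
  define C where "C n = {x. \<forall>i\<in>I. norm (F i x) \<le> real n}" for n :: nat
  have closed: "closed (C n)" for n
  proof -
    have "C n = (\<Inter>i\<in>I. {x. norm (F i x) \<le> real n})" by (auto simp: C_def)
    then show ?thesis
      by (auto intro!: closed_INT closed_Collect_le continuous_intros)
  qed
  have "(\<Union>n. C n) = UNIV"
  proof -
    have "x \<in> (\<Union>n. C n)" for x
    proof -
      obtain M where M: "\<forall>i\<in>I. norm (F i x) \<le> M" using pointwise by blast
      obtain n where "M \<le> real n" using real_arch_simple by blast
      then have "x \<in> C n" using M by (fastforce simp: C_def)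
      then show ?thesis by blast
    qed
    then show ?thesis by blast
  qed
  moreover have "\<exists>n. interior (C n) \<noteq> {}"
  proof (rule ccontr)
    assume "\<not> ?thesis"
    then have "euclidean interior_of \<Union>(range C) = {}"
      using closed by (intro Baire_category_alt) (auto simp: completely_metrizable_space_euclidean)
    then show False using calculation by simp
  qed
  then obtain n x r where r: "r > 0" "cball x r \<subseteq> C n"
    by (meson ex_in_conv mem_interior_cball)
  have "norm (F i) \<le> 2 * real n / r" if i: "i \<in> I" for i
  proof (rule norm_blinfun_bound)
    fix y
    show "norm (F i y) \<le> 2 * real n / r * norm y"
    proof (cases "y = 0")
      case False
      \<comment> \<open>The ball has some centre \<open>x\<close>, so values near 0 are controlled
        by the difference of the values at \<open>x + z\<close> and \<open>x\<close>.\<close>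
      define z where "z = (r / norm y) *\<^sub>R y"
      have "x + z \<in> cball x r" "x \<in> cball x r" using r False by (auto simp: z_def dist_norm)
      then have "x + z \<in> C n" "x \<in> C n" using r by blast+
      then have "norm (F i (x + z)) \<le> real n" "norm (F i x) \<le> real n" using i by (auto simp: C_def)
      moreover have "F i z = F i (x + z) - F i x" by (simp add: blinfun.bilinear_simps)
      ultimately have "norm (F i z) \<le> 2 * real n"
        using norm_triangle_ineq4[of "F i (x + z)" "F i x"] by simp
      then show ?thesis using r False by (simp add: z_def blinfun.bilinear_simps field_simps)
    qed simp
  qed (use r in auto)
  then show ?thesis by blast
qed

text \<open>Operator norms need not depend continuously on t, so compactness is applied to each
  orbit and Banach-Steinhaus does the rest.\<close>

lemma strongly_continuous_bounded:
  fixes F :: "real \<Rightarrow> 'a::{real_normed_vector,complete_space} \<Rightarrow>\<^sub>L 'b::real_normed_vector"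
  assumes "\<And>x. continuous_on {a..b} (\<lambda>t. F t x)"
  obtains M where "\<And>t. t \<in> {a..b} \<Longrightarrow> norm (F t) \<le> M"
proof -
  have "\<exists>M. \<forall>t\<in>{a..b}. norm (F t x) \<le> M" for x
    using compact_imp_bounded[OF compact_continuous_image[OF assms[of x] compact_Icc]]
    by (auto simp: bounded_iff)
  from uniform_boundedness[of "{a..b}" F, OF this] show thesis using that by blast
qed

text \<open>The semigroup law writes each increment of exp(-a s) S(s) x as a uniformly bounded
  operator applied to the same vector \<open>v h\<close>, which is o(h). Cutting [0,t] into n equal
  steps and telescoping gives n o(1/n), so this function is constant.\<close>

lemma C0_semigroup_eigenvector:
  fixes S :: "real \<Rightarrow> 'a::{real_normed_vector,complete_space} \<Rightarrow>\<^sub>L 'a"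
  assumes S: "C0_semigroup S" and x: "((\<lambda>h. (S h x - x) /\<^sub>R h) \<longlongrightarrow> a *\<^sub>R x) (at_right 0)" and t: "0 \<le> t"
  shows "S t x = exp (a * t) *\<^sub>R x"
proof (cases "t = 0")
  case True
  then show ?thesis using S by (simp add: C0_semigroup_def)
next
  case False
  then have t: "0 < t" using t by simp
  define u where "u s = exp (- (a * s)) *\<^sub>R S s x" for s
  define v where "v h = exp (- (a * h)) *\<^sub>R S h x - x" for h
  have "continuous_on {0..t} (\<lambda>s. S s y)" for y
    by (rule continuous_on_subset[of "{0..}"]) (use S in \<open>auto simp: C0_semigroup_def\<close>)
  then obtain M where M: "\<And>s. s \<in> {0..t} \<Longrightarrow> norm (S s) \<le> M"
    using strongly_continuous_bounded[of 0 t S] by blast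
  \<comment> \<open>Bounds exp(-a s) \<open>norm (S s)\<close> for all s in [0,t]; the summand 1
    keeps \<open>K\<close> positive for the divisions below.\<close>
  define K where "K = exp (\<bar>a\<bar> * t) * (\<bar>M\<bar> + 1)"
  have K: "K > 0" by (simp add: K_def add_nonneg_pos)
  have v: "((\<lambda>h. v h /\<^sub>R h) \<longlongrightarrow> 0) (at_right 0)"
  proof -
    have 1: "((\<lambda>h. (exp (- (a * h)) - 1) / h) \<longlongrightarrow> -a) (at_right 0)"
    proof -
      have "((\<lambda>h. exp (- (a * h))) has_real_derivative -a) (at 0)"
        by (auto intro!: derivative_eq_intros)
      then have "((\<lambda>h. (exp (- (a * h)) - 1) / h) \<longlongrightarrow> -a) (at 0)"
        by (simp add: DERIV_def)
      then show ?thesis by (rule filterlim_mono) (auto simp: at_le)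
    qed
    have 2: "((\<lambda>h::real. exp (- (a * h))) \<longlongrightarrow> exp (- (a * 0))) (at_right 0)"
      by (intro tendsto_intros)
    \<comment> \<open>Product rule at 0: the contributions a x and -a x cancel.\<close>
    have "((\<lambda>h. exp (- (a * h)) *\<^sub>R ((S h x - x) /\<^sub>R h) + ((exp (- (a * h)) - 1) / h) *\<^sub>R x)
        \<longlongrightarrow> exp (- (a * 0)) *\<^sub>R (a *\<^sub>R x) + (-a) *\<^sub>R x) (at_right 0)"
      by (intro tendsto_intros 1 2 x)
    moreover have "exp (- (a * h)) *\<^sub>R ((S h x - x) /\<^sub>R h) + ((exp (- (a * h)) - 1) / h) *\<^sub>R x = v h /\<^sub>R h" for h
      by (simp add: v_def algebra_simps divide_inverse)
    ultimately show ?thesis by simp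
  qed
  have uv: "u (s + h) - u s = exp (- (a * s)) *\<^sub>R S s (v h)" if "0 \<le> s" "0 \<le> h" for s h
  proof -
    have "S (s + h) x = S s (S h x)" using S that by (simp add: C0_semigroup_def)
    then show ?thesis
      by (simp add: u_def v_def blinfun.bilinear_simps algebra_simps exp_add[symmetric])
  qed
  have ub: "norm (u (s + h) - u s) \<le> K * norm (v h)" if s: "s \<in> {0..t}" "0 \<le> h" for s h
  proof -
    have "- (a * s) \<le> \<bar>a\<bar> * s" using s by (metis abs_ge_minus_self abs_mult abs_of_nonneg atLeastAtMost_iff)
    also have "\<dots> \<le> \<bar>a\<bar> * t" using s by (intro mult_left_mono) auto
    finally have e: "exp (- (a * s)) \<le> exp (\<bar>a\<bar> * t)" by simp
    have "norm (S s (v h)) \<le> norm (S s) * norm (v h)" by (rule norm_blinfun)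
    also have "\<dots> \<le> (\<bar>M\<bar> + 1) * norm (v h)" using M[of s] s by (intro mult_right_mono) auto
    finally have "exp (- (a * s)) * norm (S s (v h)) \<le> exp (\<bar>a\<bar> * t) * ((\<bar>M\<bar> + 1) * norm (v h))"
      using e by (intro mult_mono) auto
    then show ?thesis using uv[of s h] s by (simp add: K_def mult.assoc)
  qed
  have "norm (u t - u 0) \<le> \<epsilon>" if \<epsilon>: "\<epsilon> > 0" for \<epsilon>
  proof -
    have "\<forall>\<^sub>F h in at_right 0. dist (v h /\<^sub>R h) 0 < \<epsilon> / (K * t)"
      using v \<epsilon> K t by (intro tendstoD) auto
    then obtain d where d: "d > 0" "\<And>h. 0 < h \<Longrightarrow> h < d \<Longrightarrow> norm (v h /\<^sub>R h) < \<epsilon> / (K * t)"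
      by (auto simp: eventually_at_right_field)
    obtain n :: nat where n: "t / d < real n" using reals_Archimedean2 by blast
    then have n0: "n > 0" using t d by (metis divide_pos_pos gr0I less_asym of_nat_0)
    define h where "h = t / real n"
    have h: "0 < h" "h < d" using n n0 t d by (auto simp: h_def field_simps)
    have vh: "norm (v h) \<le> h * (\<epsilon> / (K * t))"
      using d(2)[OF h] h by (simp add: field_simps)
    have "norm (u (real k * h) - u 0) \<le> real k * (K * (h * (\<epsilon> / (K * t))))" if "k \<le> n" for k
      using that
    proof (induction k)
      case (Suc k)
      have "real k * h \<le> real n * h" using Suc h by (intro mult_right_mono) auto
      then have "real k * h \<le> t" using n0 by (simp add: h_def)
      then have k: "real k * h \<in> {0..t}" using h by simp
      have "norm (u (real k * h + h) - u (real k * h)) \<le> K * norm (v h)"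
        using ub[OF k] h by simp
      also have "\<dots> \<le> K * (h * (\<epsilon> / (K * t)))" using vh K by (intro mult_left_mono) auto
      finally have "norm (u (real (Suc k) * h) - u (real k * h)) \<le> K * (h * (\<epsilon> / (K * t)))"
        by (simp add: algebra_simps)
      moreover have "norm (u (real (Suc k) * h) - u 0)
          \<le> norm (u (real (Suc k) * h) - u (real k * h)) + norm (u (real k * h) - u 0)"
        using norm_triangle_ineq[of "u (real (Suc k) * h) - u (real k * h)" "u (real k * h) - u 0"] by simp
      moreover have "norm (u (real k * h) - u 0) \<le> real k * (K * (h * (\<epsilon> / (K * t))))"
        using Suc by simp
      moreover have "real (Suc k) * X = X + real k * X" for X :: real by (simp add: algebra_simps)
      ultimately show ?case by (smt (verit))
    qed simp
    from this[of n] show ?thesis using n0 K t by (simp add: h_def)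
  qed
  then have "u t = u 0" using field_le_epsilon[of "norm (u t - u 0)" 0] by simp
  then have "exp (- (a * t)) *\<^sub>R S t x = x" using S by (simp add: u_def C0_semigroup_def)
  then have "exp (a * t) *\<^sub>R (exp (- (a * t)) *\<^sub>R S t x) = exp (a * t) *\<^sub>R x" by simp
  then show ?thesis by (simp add: exp_minus)
qed

subsection \<open>A quadratic Gronwall inequality\<close>

text \<open>Neither continuity nor measurability of \<open>e\<close> is available, because the operator norm of a strongly
  continuous family need not be continuous; hence the step hypothesis compares with an integrable
  majorant \<open>w\<close>. The bound \<open>e \<le> 1\<close> is propagated backwards from \<open>T\<close> in steps whose
  length depends only on \<open>K\<close>, while the resulting estimate does not depend on \<open>K\<close>.\<close>

lemma bootstrap_gronwall:
  fixes e :: "real \<Rightarrow> real"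
  assumes T: "0 \<le> T" and L: "0 < L" and \<epsilon>: "0 \<le> \<epsilon>"
    and nonneg: "\<And>t. t \<in> {0..T} \<Longrightarrow> 0 \<le> e t" and bound: "\<And>t. t \<in> {0..T} \<Longrightarrow> e t \<le> K"
    and step: "\<And>t w. t \<in> {0..T} \<Longrightarrow> w integrable_on {t..T} \<Longrightarrow>
      (\<And>\<tau>. \<tau> \<in> {t..T} \<Longrightarrow> \<epsilon> + L * e \<tau> + L * (e \<tau>)\<^sup>2 \<le> w \<tau>) \<Longrightarrow> e t \<le> integral {t..T} w"
    and small: "\<epsilon> * T * (1 + 2 * exp (4 * L * T)) \<le> 1 / 2"
    and t: "t \<in> {0..T}"
  shows "e t \<le> 2 * \<epsilon> * T * exp (4 * L * T)"
proof -
  have int: "((\<lambda>\<tau>. \<epsilon> + 4 * L * c * exp (4 * L * (T - \<tau>))) has_integral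
      \<epsilon> * (T - t) + c * (exp (4 * L * (T - t)) - 1)) {t..T}" if "t \<le> T" for t c
  proof -
    have "((\<lambda>\<tau>. \<epsilon> + 4 * L * c * exp (4 * L * (T - \<tau>))) has_integral
      (\<epsilon> * T - c * exp (4 * L * (T - T))) - (\<epsilon> * t - c * exp (4 * L * (T - t)))) {t..T}"
      by (rule fundamental_theorem_of_calculus[OF that])
         (auto intro!: derivative_eq_intros simp: has_real_derivative_iff_has_vector_derivative[symmetric])
    then show ?thesis by (simp add: algebra_simps)
  qed
  \<comment> \<open>While e stays below 1, the quadratic term is dominated by the linear one, at the
    price of doubling the rate to 2 L.\<close>
  have quad: "\<epsilon> + L * e \<tau> + L * (e \<tau>)\<^sup>2 \<le> \<epsilon> + 2 * L * e \<tau>" if "\<tau> \<in> {0..T}" "e \<tau> \<le> 1" for \<tau>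
  proof -
    have "(e \<tau>)\<^sup>2 \<le> e \<tau>" using nonneg[OF that(1)] that(2) by (simp add: power2_eq_square mult_left_le)
    then have "L * (e \<tau>)\<^sup>2 \<le> L * e \<tau>" using L by simp
    then show ?thesis by simp
  qed
  \<comment> \<open>Weighted supremum: damping with rate 4 L, twice the linear rate 2 L, makes the
    integral operator a contraction with factor 1/2, so E is at most \<epsilon> T + E/2. The
    majorant is built from the number E, so e itself is never integrated.\<close>
  have refine: "e t \<le> 2 * \<epsilon> * T * exp (4 * L * (T - t))"
    if t0: "0 \<le> t0" and le1: "\<And>t. t \<in> {t0..T} \<Longrightarrow> e t \<le> 1" and t: "t \<in> {t0..T}" for t0 t
  proof -
    define f where "f s = e s * exp (- (4 * L * (T - s)))" for s
    define E where "E = (SUP s\<in>{t0..T}. f s)"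
    have ne: "{t0..T} \<noteq> {}" using t by auto
    have f1: "f s \<le> 1" if "s \<in> {t0..T}" for s
    proof -
      have "f s \<le> 1 * 1" unfolding f_def using le1[OF that] nonneg[of s] that t0 L by (intro mult_mono) auto
      then show ?thesis by simp
    qed
    have bdd: "bdd_above (f ` {t0..T})" using f1 by (intro bdd_aboveI2) auto
    have fE: "f s \<le> E" if "s \<in> {t0..T}" for s unfolding E_def by (rule cSUP_upper[OF that bdd])
    have eE: "e s \<le> E * exp (4 * L * (T - s))" if "s \<in> {t0..T}" for s
    proof -
      have "e s = f s * exp (4 * L * (T - s))" by (simp add: f_def mult.assoc exp_add[symmetric])
      then show ?thesis using fE[OF that] by simp
    qed
    have "0 \<le> f t" unfolding f_def using nonneg[of t] t t0 by simp
    then have E0: "0 \<le> E" using fE[OF t] by simp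
    have "f s \<le> \<epsilon> * T + E / 2" if s: "s \<in> {t0..T}" for s
    proof -
      have "e s \<le> integral {s..T} (\<lambda>\<tau>. \<epsilon> + 4 * L * (E/2) * exp (4 * L * (T - \<tau>)))"
      proof (rule step)
        show "s \<in> {0..T}" using s t0 by auto
        show "(\<lambda>\<tau>. \<epsilon> + 4 * L * (E/2) * exp (4 * L * (T - \<tau>))) integrable_on {s..T}"
          using int[of s "E/2"] s by auto
        fix \<tau> assume \<tau>: "\<tau> \<in> {s..T}"
        have "2 * L * e \<tau> \<le> 2 * L * (E * exp (4 * L * (T - \<tau>)))"
          using eE[of \<tau>] \<tau> s L by (intro mult_left_mono) auto
        then show "\<epsilon> + L * e \<tau> + L * (e \<tau>)\<^sup>2 \<le> \<epsilon> + 4 * L * (E/2) * exp (4 * L * (T - \<tau>))"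
          using quad[of \<tau>] le1[of \<tau>] \<tau> s t0 by (simp add: mult.assoc mult.left_commute)
      qed
      also have "\<dots> = \<epsilon> * (T - s) + E / 2 * (exp (4 * L * (T - s)) - 1)"
        using int[of s "E/2"] s by (intro integral_unique) auto
      also have "\<dots> \<le> \<epsilon> * T + E / 2 * exp (4 * L * (T - s))"
        using E0 \<epsilon> s t0 by (intro add_mono mult_left_mono) auto
      finally have "f s \<le> (\<epsilon> * T + E / 2 * exp (4 * L * (T - s))) * exp (- (4 * L * (T - s)))"
        unfolding f_def by (intro mult_right_mono) auto
      also have "\<dots> = \<epsilon> * T * exp (- (4 * L * (T - s))) + E / 2"
        by (simp add: algebra_simps exp_add[symmetric])
      also have "\<epsilon> * T * exp (- (4 * L * (T - s))) \<le> \<epsilon> * T * 1"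
        using \<epsilon> T L s by (intro mult_left_mono) auto
      finally show ?thesis by simp
    qed
    then have "E \<le> \<epsilon> * T + E / 2" unfolding E_def by (intro cSUP_least[OF ne])
    then have "E \<le> 2 * \<epsilon> * T" by simp
    then have "E * exp (4 * L * (T - t)) \<le> 2 * \<epsilon> * T * exp (4 * L * (T - t))" by (intro mult_right_mono) auto
    then show ?thesis using eE[OF t] by linarith
  qed
  have K: "0 \<le> K" using nonneg[OF t] bound[OF t] by simp
  \<comment> \<open>\<kappa> dominates the integrand by means of the crude bound K alone; h is
    chosen so that an interval of length h contributes at most 1/2.\<close>
  define \<kappa> where "\<kappa> = \<epsilon> + L * K + L * K\<^sup>2"
  have \<kappa>: "0 \<le> \<kappa>" using \<epsilon> L K by (simp add: \<kappa>_def)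
  define h where "h = 1 / (2 * (\<kappa> + 1))"
  have h: "0 < h" "\<kappa> * h \<le> 1/2" using \<kappa> by (auto simp: h_def field_simps)
  have e\<kappa>: "\<epsilon> + L * e \<tau> + L * (e \<tau>)\<^sup>2 \<le> \<kappa>" if "\<tau> \<in> {0..T}" for \<tau>
    unfolding \<kappa>_def using bound[OF that] nonneg[OF that] L by (intro add_mono mult_left_mono power_mono) auto
  \<comment> \<open>One backward step: the new piece, of length at most h, costs 1/2 by \<kappa>;
    the part where e is already below 1 costs at most 1/2 by \<open>refine\<close> and
    \<open>small\<close>.\<close>
  have extend: "e t \<le> 1"
    if t0: "0 \<le> t0" "t0 \<le> T" and le1: "\<And>t. t \<in> {t0..T} \<Longrightarrow> e t \<le> 1"
      and t: "0 \<le> t" "t0 - h \<le> t" "t \<le> T" for t0 t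
  proof (cases "t0 \<le> t")
    case True then show ?thesis using le1 t by auto
  next
    case False
    \<comment> \<open>\<kappa> is added to the refined majorant rather than substituted for it, so
      that the second summand can be integrated over all of [t,T] by \<open>int\<close>.\<close>
    define w where "w \<tau> = (if \<tau> \<in> {t..t0} then \<kappa> else 0) + (\<epsilon> + 4 * L * (\<epsilon> * T) * exp (4 * L * (T - \<tau>)))" for \<tau>
    have 1: "((\<lambda>\<tau>. if \<tau> \<in> {t..t0} then \<kappa> else 0) has_integral (t0 - t) * \<kappa>) {t..T}"
    proof (subst has_integral_restrict)
      show "{t..t0} \<subseteq> {t..T}" using t0 by auto
      show "((\<lambda>\<tau>. \<kappa>) has_integral (t0 - t) * \<kappa>) {t..t0}"
        using has_integral_const_real[of \<kappa> t t0] False by simp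
    qed
    have i: "(w has_integral (t0 - t) * \<kappa> + (\<epsilon> * (T - t) + (\<epsilon> * T) * (exp (4 * L * (T - t)) - 1))) {t..T}"
      unfolding w_def by (intro has_integral_add 1 int t)
    have "e t \<le> integral {t..T} w"
    proof (rule step)
      show "t \<in> {0..T}" using t by simp
      show "w integrable_on {t..T}" using i by blast
      fix \<tau> assume \<tau>: "\<tau> \<in> {t..T}"
      have p: "0 \<le> \<epsilon> + 4 * L * (\<epsilon> * T) * exp (4 * L * (T - \<tau>))" using \<epsilon> L T by simp
      show "\<epsilon> + L * e \<tau> + L * (e \<tau>)\<^sup>2 \<le> w \<tau>"
      proof (cases "\<tau> \<le> t0")
        case True then show ?thesis using e\<kappa>[of \<tau>] p \<tau> t by (simp add: w_def)
      next
        case False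
        then have \<tau>': "\<tau> \<in> {t0..T}" "\<tau> \<in> {0..T}" using \<tau> t by auto
        have "2 * L * e \<tau> \<le> 2 * L * (2 * \<epsilon> * T * exp (4 * L * (T - \<tau>)))"
          using refine[OF t0(1) le1 \<tau>'(1)] L by (intro mult_left_mono) auto
        then show ?thesis using quad[OF \<tau>'(2) le1[OF \<tau>'(1)]] False by (simp add: w_def mult.assoc mult.left_commute)
      qed
    qed
    also have "\<dots> = (t0 - t) * \<kappa> + (\<epsilon> * (T - t) + (\<epsilon> * T) * (exp (4 * L * (T - t)) - 1))"
      using i by (rule integral_unique)
    also have "\<dots> \<le> h * \<kappa> + (\<epsilon> * T + (\<epsilon> * T) * (2 * exp (4 * L * T)))"
    proof (intro add_mono mult_right_mono mult_left_mono)
      have "exp (4 * L * (T - t)) \<le> exp (4 * L * T)" using L t by simp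
      then show "exp (4 * L * (T - t)) - 1 \<le> 2 * exp (4 * L * T)"
        using exp_gt_zero[of "4 * L * T"] by linarith
    qed (use t \<kappa> \<epsilon> T in auto)
    also have "\<dots> \<le> 1" using h small by (simp add: algebra_simps)
    finally show ?thesis .
  qed
  \<comment> \<open>The integral over the degenerate interval vanishes, which starts the
    bootstrap.\<close>
  have eT: "e T \<le> 1"
    using step[of T "\<lambda>_. \<kappa>"] e\<kappa>[of T] T by (simp add: integrable_on_refl[where a=T, simplified])
  have all: "\<forall>t. 0 \<le> t \<and> T - real n * h \<le> t \<and> t \<le> T \<longrightarrow> e t \<le> 1" for n
  proof (induction n)
    case 0 then show ?case using eT by auto
  next
    case (Suc n)
    show ?case
    proof (intro allI impI)
      fix t assume t: "0 \<le> t \<and> T - real (Suc n) * h \<le> t \<and> t \<le> T"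
      show "e t \<le> 1"
      proof (rule extend[of "max 0 (T - real n * h)"])
        show "max 0 (T - real n * h) \<le> T" using T h by simp
        show "max 0 (T - real n * h) - h \<le> t" using t h by (auto simp: algebra_simps max_def)
      qed (use Suc t in auto)
    qed
  qed
  obtain n where "T / h < real n" using reals_Archimedean2 by blast
  then have "T - real n * h \<le> 0" using h by (simp add: field_simps)
  then have "e s \<le> 1" if "s \<in> {0..T}" for s using all[of n] that by auto
  then have "e t \<le> 2 * \<epsilon> * T * exp (4 * L * (T - t))" using refine[of 0 t] t by simp
  also have "\<dots> \<le> 2 * \<epsilon> * T * exp (4 * L * T)" using t L \<epsilon> T by (intro mult_left_mono) auto
  finally show ?thesis .
qed

subsection \<open>Weak forms of the Riccati equations\<close>

text \<open>Adjoints sit on the test vector and the control operator is the single vector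
  \<open>b\<close>. Adjoints taken in H and in H_N differ, but tested this way both equations share
  one formula, with \<open>F\<close> equal to \<open>P \<tau>\<close> or to
  \<open>F \<tau> \<circ> p\<close>.\<close>

definition riccati_form ::
    "('a::real_inner \<Rightarrow> 'a) \<Rightarrow> 'a \<Rightarrow> ('a \<Rightarrow> 'a) \<Rightarrow> ('a \<Rightarrow> 'a) \<Rightarrow> real \<Rightarrow> ('a \<Rightarrow> 'a) \<Rightarrow> 'a \<Rightarrow> 'a \<Rightarrow> real"
  where "riccati_form A b C Q \<delta> F x y =
    F x \<bullet> A y + F (A x) \<bullet> y + F (C x) \<bullet> C y + Q x \<bullet> y - (1 / \<delta>) * (b \<bullet> F x) * (F b \<bullet> y)"

lemma riccati_form_bilinear:
  assumes "linear A" "linear C" "linear Q" "linear F"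
  shows "linear (\<lambda>x. riccati_form A b C Q \<delta> F x y)" "linear (\<lambda>y. riccati_form A b C Q \<delta> F x y)"
  by (rule linearI; simp add: riccati_form_def assms[THEN linear_add] assms[THEN linear_scale]
    inner_add_left inner_add_right algebra_simps add_divide_distrib)+

text \<open>With F = D + F', each term splits into parts containing D, of size e, and parts where F'
  meets a defect of A or C, of size \<eta>. Since F' absorbs \<open>p\<close> on both sides,
  \<open>b\<close>, \<open>x\<close> and \<open>y\<close> themselves create no defect.\<close>

lemma riccati_form_diff_bound:
  fixes F F' :: "'a::real_inner \<Rightarrow>\<^sub>L 'a"
  assumes p: "\<And>x. norm (p x) \<le> norm x"
    and F': "\<And>x. F' (p x) = F' x" "\<And>x y. F' x \<bullet> p y = F' x \<bullet> y"
    and A: "linear A" "\<And>x. norm (A x) \<le> a * norm x" "\<And>x. norm (p (A x) - p (A (p x))) \<le> \<eta> * norm x"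
    and C: "linear C" "\<And>x. norm (C x) \<le> a * norm x" "\<And>x. norm (C x - C (p x)) \<le> \<eta> * norm x"
    and Q: "Q (p x) \<bullet> p y = Q x \<bullet> y"
    and b: "norm b \<le> a" and a: "0 \<le> a" and \<eta>: "0 \<le> \<eta>" "\<eta> \<le> 1" and \<delta>: "0 < \<delta>" and M: "norm F \<le> M"
  defines "e \<equiv> norm (F - F')" and "L \<equiv> 2 + 4 * a + a\<^sup>2 + (2 * M + 1) * a\<^sup>2 / \<delta>"
  shows "\<bar>riccati_form A b C Q \<delta> F x y - riccati_form A b C Q \<delta> F' (p x) (p y)\<bar>
    \<le> (2 * M * (1 + a) * \<eta> + L * e + L * e\<^sup>2) * (norm x * norm y)"
proof -
  define D where "D = F - F'"
  define X Y where "X = norm x" and "Y = norm y"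
  have e: "0 \<le> e" by (simp add: e_def)
  have M0: "0 \<le> M" using M norm_ge_zero order_trans by blast
  have X: "0 \<le> X" and Y: "0 \<le> Y" by (auto simp: X_def Y_def)
  \<comment> \<open>F' is bounded through F, because no bound on F' uniform in the dimension is at
    hand; in the quadratic term this produces e^2.\<close>
  have nF': "norm F' \<le> M + e"
    using norm_triangle_ineq4[of F "F - F'"] M by (simp add: e_def)
  have bd: "\<bar>D u \<bullet> v\<bar> \<le> e * r * s" "\<bar>F' u \<bullet> v\<bar> \<le> (M + e) * r * s" "\<bar>F u \<bullet> v\<bar> \<le> M * r * s"
    if "norm u \<le> r" "norm v \<le> s" for u v r s
  proof -
    have rs: "0 \<le> r" "0 \<le> s" using that norm_ge_zero order_trans by blast+
    have gen: "\<bar>H u \<bullet> v\<bar> \<le> k * r * s" if H: "norm H \<le> k" for H :: "'a \<Rightarrow>\<^sub>L 'a" and k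
    proof -
      have k: "0 \<le> k" using H norm_ge_zero order_trans by blast
      have "\<bar>H u \<bullet> v\<bar> \<le> norm (H u) * norm v" by (rule Cauchy_Schwarz_ineq2)
      also have "\<dots> \<le> (norm H * norm u) * norm v" by (intro mult_right_mono norm_blinfun) auto
      also have "\<dots> \<le> (k * r) * s"
        using H k \<open>norm u \<le> r\<close> \<open>norm v \<le> s\<close> rs by (intro mult_mono) auto
      finally show ?thesis .
    qed
    show "\<bar>D u \<bullet> v\<bar> \<le> e * r * s" "\<bar>F' u \<bullet> v\<bar> \<le> (M + e) * r * s" "\<bar>F u \<bullet> v\<bar> \<le> M * r * s"
      by (intro gen; simp add: D_def e_def nF'[unfolded e_def] M)+
  qed
  have xX: "norm x \<le> X" "norm y \<le> Y" by (auto simp: X_def Y_def)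
  note Ax = A(2)[of x, folded X_def] A(2)[of y, folded Y_def] A(3)[of x, folded X_def] A(3)[of y, folded Y_def]
  note Cx = C(2)[of x, folded X_def] C(2)[of y, folded Y_def] C(3)[of x, folded X_def] C(3)[of y, folded Y_def]
  have Cpx: "norm (C (p x)) \<le> a * X"
    using C(2)[of "p x"] p[of x] a by (metis X_def mult_left_mono order_trans)
  have FF: "F u = D u + F' u" for u by (simp add: D_def blinfun.bilinear_simps)
  have t1: "F x \<bullet> A y - F' (p x) \<bullet> A (p y) = D x \<bullet> A y + F' x \<bullet> (p (A y) - p (A (p y)))"
    by (simp add: FF F' inner_diff_right inner_add_left)
  have t2: "F (A x) \<bullet> y - F' (A (p x)) \<bullet> p y = D (A x) \<bullet> y + F' (p (A x) - p (A (p x))) \<bullet> y"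
    by (simp add: FF F' inner_diff_left inner_add_left blinfun.bilinear_simps)
  have t3: "F (C x) \<bullet> C y - F' (C (p x)) \<bullet> C (p y)
      = D (C x) \<bullet> C y + F' (C x - C (p x)) \<bullet> C y + F' (C (p x)) \<bullet> (C y - C (p y))"
    by (simp add: FF inner_diff_left inner_diff_right inner_add_left blinfun.bilinear_simps)
  have t4: "(b \<bullet> F x) * (F b \<bullet> y) - (b \<bullet> F' (p x)) * (F' b \<bullet> p y)
      = (D x \<bullet> b) * (F b \<bullet> y) + (F' x \<bullet> b) * (D b \<bullet> y)"
    unfolding F' by (simp add: FF inner_add_right inner_add_left inner_commute algebra_simps)
  have b1: "\<bar>F x \<bullet> A y - F' (p x) \<bullet> A (p y)\<bar> \<le> e * X * (a * Y) + (M + e) * X * (\<eta> * Y)"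
    unfolding t1 by (intro order_trans[OF abs_triangle_ineq] add_mono bd xX Ax)
  have b2: "\<bar>F (A x) \<bullet> y - F' (A (p x)) \<bullet> p y\<bar> \<le> e * (a * X) * Y + (M + e) * (\<eta> * X) * Y"
    unfolding t2 by (intro order_trans[OF abs_triangle_ineq] add_mono bd xX Ax)
  have b3: "\<bar>F (C x) \<bullet> C y - F' (C (p x)) \<bullet> C (p y)\<bar>
      \<le> e * (a * X) * (a * Y) + (M + e) * (\<eta> * X) * (a * Y) + (M + e) * (a * X) * (\<eta> * Y)"
    unfolding t3 by (intro order_trans[OF abs_triangle_ineq] add_mono bd xX Cx Cpx)
  have b4: "\<bar>(b \<bullet> F x) * (F b \<bullet> y) - (b \<bullet> F' (p x)) * (F' b \<bullet> p y)\<bar>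
      \<le> (e * X * a) * (M * a * Y) + ((M + e) * X * a) * (e * a * Y)"
    unfolding t4 by (intro order_trans[OF abs_triangle_ineq] add_mono order_trans[OF eq_refl[OF abs_mult]] mult_mono bd xX b
      mult_nonneg_nonneg add_nonneg_nonneg e X Y M0 a abs_ge_zero)
  define U where "U = (b \<bullet> F x) * (F b \<bullet> y) - (b \<bullet> F' (p x)) * (F' b \<bullet> p y)"
  have "riccati_form A b C Q \<delta> F x y - riccati_form A b C Q \<delta> F' (p x) (p y)
    = (F x \<bullet> A y - F' (p x) \<bullet> A (p y)) + (F (A x) \<bullet> y - F' (A (p x)) \<bullet> p y)
      + (F (C x) \<bullet> C y - F' (C (p x)) \<bullet> C (p y)) - U / \<delta>"
    using Q by (simp add: riccati_form_def U_def diff_divide_distrib)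
  moreover have "\<bar>U / \<delta>\<bar> \<le> ((e * X * a) * (M * a * Y) + ((M + e) * X * a) * (e * a * Y)) / \<delta>"
    using b4 \<delta> by (simp add: U_def abs_divide divide_right_mono)
  ultimately have "\<bar>riccati_form A b C Q \<delta> F x y - riccati_form A b C Q \<delta> F' (p x) (p y)\<bar>
    \<le> (e * X * (a * Y) + (M + e) * X * (\<eta> * Y)) + (e * (a * X) * Y + (M + e) * (\<eta> * X) * Y)
      + (e * (a * X) * (a * Y) + (M + e) * (\<eta> * X) * (a * Y) + (M + e) * (a * X) * (\<eta> * Y))
      + ((e * X * a) * (M * a * Y) + ((M + e) * X * a) * (e * a * Y)) / \<delta>"
    using b1 b2 b3 by linarith
  also have "\<dots> = (2 * M * (1 + a) * \<eta> + (2 * a + a\<^sup>2 + 2 * (1 + a) * \<eta> + 2 * M * a\<^sup>2 / \<delta>) * e + (a\<^sup>2 / \<delta>) * e\<^sup>2) * (X * Y)"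
    using \<delta> by (simp add: field_simps power2_eq_square)
  \<comment> \<open>\<open>L\<close> dominates the coefficients of both e and e^2; \<eta> \<le> 1
    turns 2 (1 + a) \<eta> into 2 + 2 a, which together with 2 a gives the 2 + 4 a in
    \<open>L\<close>.\<close>
  also have "\<dots> \<le> (2 * M * (1 + a) * \<eta> + L * e + L * e\<^sup>2) * (X * Y)"
  proof (intro mult_right_mono add_mono order_refl mult_nonneg_nonneg X Y e)
    have "2 * (1 + a) * \<eta> \<le> 2 * (1 + a) * 1" using a \<eta> by (intro mult_left_mono) auto
    moreover have q: "0 \<le> a\<^sup>2 / \<delta>" "0 \<le> M * a\<^sup>2 / \<delta>" using \<delta> M0 by auto
    moreover have L: "L = 2 + 4 * a + a\<^sup>2 + 2 * (M * a\<^sup>2 / \<delta>) + a\<^sup>2 / \<delta>"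
      by (simp add: L_def add_divide_distrib algebra_simps)
    ultimately show "2 * a + a\<^sup>2 + 2 * (1 + a) * \<eta> + 2 * M * a\<^sup>2 / \<delta> \<le> L" by simp
    show "a\<^sup>2 / \<delta> \<le> L" using q L a zero_le_power2[of a] by linarith
  qed (use M0 a \<eta> in auto)
  finally show ?thesis by (simp add: X_def Y_def)
qed

section \<open>Relative adjoints and testing on a subspace\<close>

lemma linear_operator_on_comp:
  assumes "linear_operator_on V F" "linear p" "\<And>x. p x \<in> V"
  shows "linear (F \<circ> p)"
  using assms by (intro linearI) (auto simp: linear_operator_on_def linear_add linear_scale)

text \<open>The candidate p (A' y) lies in V, and any other one differs from it by a vector of V
  orthogonal to itself. This resolves the description in \<open>adjoint_on\<close>; paired with a
  vector of V, the projection disappears again.\<close>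

lemma inner_adjoint_on_comp:
  assumes V: "subspace V" and p: "\<And>x. p x \<in> V" "\<And>x. x \<in> V \<Longrightarrow> p x = x" "\<And>x y. p x \<bullet> y = x \<bullet> p y"
    and A: "\<And>x y. A x \<bullet> y = x \<bullet> A' y" and xy: "x \<in> V" "y \<in> V"
  shows "adjoint_on V (p \<circ> A) y \<bullet> x = y \<bullet> A x"
proof -
  have "adjoint_on V (p \<circ> A) y = p (A' y)"
    unfolding adjoint_on_def
  proof (rule the_equality)
    have *: "p (A u) \<bullet> y = u \<bullet> p (A' y)" if "u \<in> V" for u
      using p(3)[of "A u" y] p(3)[of u "A' y"] p(2)[OF that] p(2)[OF xy(2)] A by simp
    then show "p (A' y) \<in> V \<and> (\<forall>x\<in>V. (p \<circ> A) x \<bullet> y = x \<bullet> p (A' y))" using p by simp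
    fix w assume w: "w \<in> V \<and> (\<forall>x\<in>V. (p \<circ> A) x \<bullet> y = x \<bullet> w)"
    define v where "v = w - p (A' y)"
    have "v \<in> V" using w p V by (simp add: v_def subspace_diff)
    then have "v \<bullet> w = v \<bullet> p (A' y)" using w * by auto
    then have "v \<bullet> v = 0" by (subst (2) v_def) (simp add: inner_diff_right)
    then show "w = p (A' y)" by (simp add: v_def)
  qed
  then show ?thesis
    using p(3)[of "A' y" x] p(2)[OF xy(1)] A[of x y] by (simp add: inner_commute)
qed

text \<open>Allows \<open>span_minimal\<close> to carry an integral identity from a basis to its
  span, one argument at a time.\<close>

lemma subspace_has_integral:
  fixes f :: "'a::real_vector \<Rightarrow> 'b::euclidean_space \<Rightarrow> 'c::real_normed_vector"
  assumes f: "\<And>\<tau>. \<tau> \<in> S \<Longrightarrow> linear (\<lambda>x. f x \<tau>)" and g: "linear g"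
  shows "subspace {x. (f x has_integral g x) S}"
proof (rule subspaceI)
  show "0 \<in> {x. (f x has_integral g x) S}"
    using linear_0[OF f] linear_0[OF g] by (auto intro!: has_integral_is_0)
next
  fix u v assume "u \<in> {x. (f x has_integral g x) S}" "v \<in> {x. (f x has_integral g x) S}"
  then have "((\<lambda>\<tau>. f u \<tau> + f v \<tau>) has_integral g u + g v) S" by (auto intro: has_integral_add)
  then show "u + v \<in> {x. (f x has_integral g x) S}"
    using linear_add[OF f, of _ u v] linear_add[OF g] by (auto elim: has_integral_eq[rotated])
next
  fix c u assume "u \<in> {x. (f x has_integral g x) S}"
  then have "((\<lambda>\<tau>. c *\<^sub>R f u \<tau>) has_integral c *\<^sub>R g u) S" by (auto intro: has_integral_cmul)
  then show "c *\<^sub>R u \<in> {x. (f x has_integral g x) S}"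
    using linear_scale[OF f, of _ c u] linear_scale[OF g] by (auto elim: has_integral_eq[rotated])
qed

text \<open>Testing against eigenvectors of \<open>S\<close> turns the mild equation into the fundamental theorem of
  calculus for a scalar function; the general case follows by bilinearity.\<close>

lemma matrix_riccati_weak_mild:
  fixes S :: "real \<Rightarrow> 'a::real_inner \<Rightarrow>\<^sub>L 'a"
  assumes sol: "matrix_riccati_solution V T (p \<circ> \<Lambda>) (p \<circ> A) (p \<circ> (\<lambda>v. v *\<^sub>R b)) (p \<circ> C) (p \<circ> Q) (p \<circ> G) \<delta> F"
    and V: "subspace V" "V \<subseteq> span E" "E \<subseteq> V"
    and p: "linear p" "\<And>x. p x \<in> V" "\<And>x. x \<in> V \<Longrightarrow> p x = x" "\<And>x y. p x \<bullet> y = x \<bullet> p y"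
    and A: "linear A" "\<And>x y. A x \<bullet> y = x \<bullet> A' y" and C: "linear C" "\<And>x y. C x \<bullet> y = x \<bullet> C' y"
    and Q: "linear Q" and G: "linear G"
    and eigen: "\<And>x. x \<in> E \<Longrightarrow> \<exists>\<alpha>. \<Lambda> x = \<alpha> *\<^sub>R x \<and> (\<forall>s\<ge>0. S s x = exp (\<alpha> * s) *\<^sub>R x)"
    and sym: "\<And>x y. x \<in> V \<Longrightarrow> y \<in> E \<Longrightarrow> p (\<Lambda> x) \<bullet> y = x \<bullet> \<Lambda> y"
    and t: "t \<in> {0..T}" and xy: "x \<in> V" "y \<in> V"
  shows "((\<lambda>\<tau>. riccati_form A b C Q \<delta> (F \<tau> \<circ> p) (S (\<tau> - t) x) (S (\<tau> - t) y))
    has_integral (F t x \<bullet> y - G (S (T - t) x) \<bullet> S (T - t) y)) {t..T}"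
proof -
  have lin: "linear_operator_on V (F \<tau>)" if "\<tau> \<in> {0..T}" for \<tau>
    using sol that by (auto simp: matrix_riccati_solution_def)
  have FV: "F \<tau> u \<in> V" if "\<tau> \<in> {0..T}" "u \<in> V" for \<tau> u using lin[OF that(1)] that by (auto simp: linear_operator_on_def)
  have linp: "linear (F \<tau> \<circ> p)" if "\<tau> \<in> {0..T}" for \<tau> by (rule linear_operator_on_comp[OF lin[OF that] p(1,2)])
  have pin: "p u \<bullet> v = u \<bullet> v" if "v \<in> V" for u v using p(3)[OF that] p(4)[of u v] by simp
  have basis: "((\<lambda>\<tau>. riccati_form A b C Q \<delta> (F \<tau> \<circ> p) (S (\<tau> - t) x) (S (\<tau> - t) y))
      has_integral (F t x \<bullet> y - G (S (T - t) x) \<bullet> S (T - t) y)) {t..T}"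
    if xE: "x \<in> E" and yE: "y \<in> E" for x y
  proof -
    have xV: "x \<in> V" and yV: "y \<in> V" using xE yE V by auto
    obtain \<alpha> where \<alpha>: "\<Lambda> x = \<alpha> *\<^sub>R x" "\<And>s. 0 \<le> s \<Longrightarrow> S s x = exp (\<alpha> * s) *\<^sub>R x" using eigen[OF xE] by blast
    obtain \<beta> where \<beta>: "\<Lambda> y = \<beta> *\<^sub>R y" "\<And>s. 0 \<le> s \<Longrightarrow> S s y = exp (\<beta> * s) *\<^sub>R y" using eigen[OF yE] by blast
    \<comment> \<open>Product of the factors by which S acts on x and y; as an integrating factor it
      cancels the terms that \<Lambda> contributes.\<close>
    define w where "w s = exp ((\<alpha> + \<beta>) * (s - t))" for s
    have SS: "riccati_form A b C Q \<delta> (F s \<circ> p) (S (s - t) x) (S (s - t) y)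
        = w s * riccati_form A b C Q \<delta> (F s \<circ> p) x y" if "s \<in> {t..T}" for s
    proof -
      have s: "s \<in> {0..T}" "0 \<le> s - t" using that t by auto
      note l = riccati_form_bilinear[OF A(1) C(1) Q linp[OF s(1)], THEN linear_scale]
      show ?thesis unfolding \<alpha>(2)[OF s(2)] \<beta>(2)[OF s(2)] l w_def
        by (simp add: mult.assoc[symmetric] exp_add[symmetric]) (simp add: algebra_simps)
    qed
    have der: "((\<lambda>s. w s * (F s x \<bullet> y)) has_vector_derivative
        - riccati_form A b C Q \<delta> (F s \<circ> p) (S (s - t) x) (S (s - t) y)) (at s within {t..T})"
      if s: "s \<in> {t..T}" for s
    proof -
      have s0: "s \<in> {0..T}" using s t by auto
      have sub: "{t..T} \<subseteq> {0..T}" using t by auto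
      obtain d where d: "((\<lambda>s. F s x) has_vector_derivative d) (at s within {0..T})"
        and eq: "d + F s ((p \<circ> \<Lambda>) x + (p \<circ> A) x) + ((p \<circ> \<Lambda>) (F s x) + adjoint_on V (p \<circ> A) (F s x))
          + adjoint_on V (p \<circ> C) (F s ((p \<circ> C) x)) + (p \<circ> Q) x
          - (1 / \<delta>) *\<^sub>R F s ((p \<circ> (\<lambda>v. v *\<^sub>R b)) (adjoint_on UNIV (p \<circ> (\<lambda>v. v *\<^sub>R b)) (F s x))) = 0"
        using sol s0 xV unfolding matrix_riccati_solution_def by blast
      \<comment> \<open>The control space is the real line, so the adjoint over \<open>UNIV\<close>
        is pairing with p b.\<close>
      have adjB: "adjoint_on UNIV (p \<circ> (\<lambda>v. v *\<^sub>R b)) u = p b \<bullet> u" for u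
        unfolding adjoint_on_def
      proof (rule the_equality)
        show "p b \<bullet> u \<in> UNIV \<and> (\<forall>x\<in>UNIV. (p \<circ> (\<lambda>v. v *\<^sub>R b)) x \<bullet> u = x \<bullet> (p b \<bullet> u))"
          by (simp add: linear_scale[OF p(1)])
        fix c assume "c \<in> UNIV \<and> (\<forall>x\<in>UNIV. (p \<circ> (\<lambda>v. v *\<^sub>R b)) x \<bullet> u = x \<bullet> c)"
        then have "(p \<circ> (\<lambda>v. v *\<^sub>R b)) 1 \<bullet> u = 1 \<bullet> c" by blast
        then show "c = p b \<bullet> u" by simp
      qed
      note Fx = FV[OF s0 xV] FV[OF s0 p(2)]
      note ls = linear_add[OF linp[OF s0]] linear_scale[OF linp[OF s0]]
      have F1: "F s ((p \<circ> \<Lambda>) x + (p \<circ> A) x) = \<alpha> *\<^sub>R F s x + F s (p (A x))"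
        using ls(1)[of "\<Lambda> x" "A x"] ls(2)[of \<alpha> x] p(3)[OF xV] by (simp add: \<alpha>(1) linear_add[OF p(1)])
      have F2: "F s ((p \<circ> (\<lambda>v. v *\<^sub>R b)) c) = c *\<^sub>R F s (p b)" for c
        using ls(2)[of c b] by simp
      have "0 = (d + F s ((p \<circ> \<Lambda>) x + (p \<circ> A) x) + ((p \<circ> \<Lambda>) (F s x) + adjoint_on V (p \<circ> A) (F s x))
          + adjoint_on V (p \<circ> C) (F s ((p \<circ> C) x)) + (p \<circ> Q) x
          - (1 / \<delta>) *\<^sub>R F s ((p \<circ> (\<lambda>v. v *\<^sub>R b)) (adjoint_on UNIV (p \<circ> (\<lambda>v. v *\<^sub>R b)) (F s x)))) \<bullet> y"
        unfolding eq by simp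
      also have "\<dots> = d \<bullet> y + (\<alpha> + \<beta>) * (F s x \<bullet> y) + riccati_form A b C Q \<delta> (F s \<circ> p) x y"
        unfolding F1 F2 adjB riccati_form_def
        using inner_adjoint_on_comp[OF V(1) p(2,3,4) A(2) yV Fx(1)]
          inner_adjoint_on_comp[OF V(1) p(2,3,4) C(2) yV Fx(2)[of "C x"]]
          sym[OF Fx(1) yE] pin[OF Fx(1)] pin[OF yV] p(3)[OF xV]
        by (simp add: \<beta>(1) inner_add_left inner_diff_left algebra_simps)
      finally have dy: "d \<bullet> y = - ((\<alpha> + \<beta>) * (F s x \<bullet> y)) - riccati_form A b C Q \<delta> (F s \<circ> p) x y" by simp
      have "((\<lambda>s. F s x \<bullet> y) has_real_derivative d \<bullet> y) (at s within {t..T})"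
        using bounded_linear.has_vector_derivative[OF bounded_linear_inner_left has_vector_derivative_within_subset[OF d sub]]
        by (simp add: has_real_derivative_iff_has_vector_derivative)
      moreover have "(w has_real_derivative (\<alpha> + \<beta>) * w s) (at s within {t..T})"
        unfolding w_def by (auto intro!: derivative_eq_intros)
      ultimately have "((\<lambda>s. w s * (F s x \<bullet> y)) has_real_derivative
          (\<alpha> + \<beta>) * w s * (F s x \<bullet> y) + d \<bullet> y * w s) (at s within {t..T})"
        by (intro DERIV_mult)
      moreover have "(\<alpha> + \<beta>) * w s * (F s x \<bullet> y) + d \<bullet> y * w s = - (w s * riccati_form A b C Q \<delta> (F s \<circ> p) x y)"
        by (simp add: dy algebra_simps)
      ultimately show ?thesis
        using SS[OF s] by (simp add: has_real_derivative_iff_has_vector_derivative)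
    qed
    have "((\<lambda>s. - riccati_form A b C Q \<delta> (F s \<circ> p) (S (s - t) x) (S (s - t) y)) has_integral
        w T * (F T x \<bullet> y) - w t * (F t x \<bullet> y)) {t..T}"
      using t by (intro fundamental_theorem_of_calculus der) auto
    from has_integral_neg[OF this]
    have "((\<lambda>s. riccati_form A b C Q \<delta> (F s \<circ> p) (S (s - t) x) (S (s - t) y)) has_integral
        F t x \<bullet> y - w T * (F T x \<bullet> y)) {t..T}" by (simp add: w_def)
    moreover have "w T * (F T x \<bullet> y) = G (S (T - t) x) \<bullet> S (T - t) y"
    proof -
      have "F T x = p (G x)" using sol xV by (auto simp: matrix_riccati_solution_def)
      then show ?thesis using \<alpha>(2)[of "T - t"] \<beta>(2)[of "T - t"] t pin[OF yV, of "G x"]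
        by (simp add: w_def linear_scale[OF G] mult.assoc[symmetric] exp_add[symmetric]) (simp add: algebra_simps)
    qed
    ultimately show ?thesis by simp
  qed
  \<comment> \<open>\<open>F t\<close> is linear only on V; with \<open>F t \<circ> p\<close> in its
    place, the identity is linear in x and in y on the whole space and extends to spans.\<close>
  define \<Phi> where "\<Phi> x y \<longleftrightarrow> ((\<lambda>\<tau>. riccati_form A b C Q \<delta> (F \<tau> \<circ> p) (S (\<tau> - t) x) (S (\<tau> - t) y))
      has_integral ((F t \<circ> p) x \<bullet> y - G (S (T - t) x) \<bullet> S (T - t) y)) {t..T}" for x y
  have lint: "linear (F t \<circ> p)" by (rule linp[OF t])
  note form_linear = riccati_form_bilinear[OF A(1) C(1) Q linp, unfolded linear_iff]
  have \<Phi>_left: "subspace {x. \<Phi> x y}" for y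
    unfolding \<Phi>_def
  proof (rule subspace_has_integral)
    show "linear (\<lambda>x. riccati_form A b C Q \<delta> (F \<tau> \<circ> p) (S (\<tau> - t) x) (S (\<tau> - t) y))"
      if "\<tau> \<in> {t..T}" for \<tau>
      using form_linear(1)[of \<tau>] that t by (simp add: linear_iff blinfun.bilinear_simps)
    show "linear (\<lambda>x. (F t \<circ> p) x \<bullet> y - G (S (T - t) x) \<bullet> S (T - t) y)"
      using lint G by (simp add: linear_iff blinfun.bilinear_simps inner_add_left algebra_simps)
  qed
  have \<Phi>_right: "subspace {y. \<Phi> x y}" for x
    unfolding \<Phi>_def
  proof (rule subspace_has_integral)
    show "linear (\<lambda>y. riccati_form A b C Q \<delta> (F \<tau> \<circ> p) (S (\<tau> - t) x) (S (\<tau> - t) y))"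
      if "\<tau> \<in> {t..T}" for \<tau>
      using form_linear(2)[of \<tau>] that t by (simp add: linear_iff blinfun.bilinear_simps)
    show "linear (\<lambda>y. (F t \<circ> p) x \<bullet> y - G (S (T - t) x) \<bullet> S (T - t) y)"
      by (simp add: linear_iff blinfun.bilinear_simps inner_add_right algebra_simps)
  qed
  have "\<Phi> u v" if "u \<in> E" "v \<in> E" for u v
    using basis[OF that] p(3)[of u] that V(3) by (auto simp: \<Phi>_def)
  then have "E \<subseteq> {y. \<Phi> u y}" if "u \<in> E" for u using that by blast
  then have "\<Phi> u y" if "u \<in> E" for u using span_minimal[OF _ \<Phi>_right] xy V(2) that by blast
  then have "E \<subseteq> {u. \<Phi> u y}" by blast
  then have "\<Phi> x y" using span_minimal[OF _ \<Phi>_left] xy V(2) by blast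
  then show ?thesis using p(3)[OF xy(1)] by (simp add: \<Phi>_def)
qed

text \<open>That p fixes V stands in for orthonormality of I: with the symmetry read off from the
  sum it gives norm(p x)^2 = x \<bullet> p x, hence contractivity.\<close>

lemma finite_rank_projection:
  fixes p :: "'a::real_inner \<Rightarrow> 'a"
  assumes V: "subspace V" and I: "finite I" "I \<subseteq> V"
    and p: "\<And>x. p x = (\<Sum>e\<in>I. (x \<bullet> e) *\<^sub>R e)" "\<forall>x\<in>V. p x = x"
  shows "linear p" "\<And>x. p x \<in> V" "\<And>x y. p x \<bullet> y = x \<bullet> p y" "\<And>x. norm (p x) \<le> norm x" "V \<subseteq> span I"
proof -
  show "linear p"
    by (rule linearI) (simp_all add: p(1) inner_add_left scaleR_left_distrib sum.distrib scaleR_sum_right)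
  show r: "p x \<in> V" for x
    unfolding p(1) using V I by (intro subspace_sum subspace_mul) auto
  show s: "p x \<bullet> y = x \<bullet> p y" for x y
    by (simp add: p(1) inner_sum_left inner_sum_right inner_commute mult.commute)
  show "norm (p x) \<le> norm x" for x
  proof -
    have "(norm (p x))\<^sup>2 = x \<bullet> p x" using s[of x "p x"] p(2) r by (simp add: power2_norm_eq_inner)
    also have "\<dots> \<le> norm x * norm (p x)" by (rule norm_cauchy_schwarz)
    finally show ?thesis by (cases "p x = 0") (auto simp: power2_eq_square)
  qed
  show "V \<subseteq> span I"
  proof
    fix x assume "x \<in> V"
    then have "x = p x" using p(2) by simp
    also have "p x \<in> span I" unfolding p(1) by (intro span_sum span_mul span_base)
    finally show "x \<in> span I" .
  qed
qed

text \<open>Pairing with y is a bounded functional, so it passes under the integral, where the outer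
  S acts on y by self-adjointness. As \<open>adjoint\<close> is a choice operator, explicit adjoints
  A' and C' are supplied to pin it down.\<close>

lemma mild_riccati_weak:
  fixes S P :: "real \<Rightarrow> 'a::real_inner \<Rightarrow>\<^sub>L 'a"
  assumes sol: "mild_riccati_solution T S A (\<lambda>v. v *\<^sub>R b) C Q G \<delta> P"
    and A: "\<And>x y. A x \<bullet> y = x \<bullet> A' y" and C: "\<And>x y. C x \<bullet> y = x \<bullet> C' y"
    and S: "\<And>s x y. 0 \<le> s \<Longrightarrow> S s x \<bullet> y = x \<bullet> S s y"
    and t: "t \<in> {0..T}"
  shows "((\<lambda>\<tau>. riccati_form A b C Q \<delta> (P \<tau>) (S (\<tau> - t) x) (S (\<tau> - t) y))
    has_integral (P t x \<bullet> y - G (S (T - t) x) \<bullet> S (T - t) y)) {t..T}"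
proof -
  have A': "adjoint A = A'" and C': "adjoint C = C'" using A C by (auto intro!: adjoint_unique)
  have B': "adjoint (\<lambda>v. v *\<^sub>R b) = (\<lambda>u. b \<bullet> u)" by (rule adjoint_unique) simp
  have S': "adjoint (S s) = S s" if "0 \<le> s" for s using S[OF that] by (auto intro!: adjoint_unique)
  have i: "((\<lambda>\<tau>. let z = S (\<tau> - t) x in adjoint (S (\<tau> - t))
          (adjoint A (P \<tau> z) + P \<tau> (A z) + Q z + adjoint C (P \<tau> (C z))
            - (1 / \<delta>) *\<^sub>R P \<tau> (adjoint (\<lambda>v. v *\<^sub>R b) (P \<tau> z) *\<^sub>R b)))
        has_integral P t x - adjoint (S (T - t)) (G (S (T - t) x))) {t..T}"
    using sol t unfolding mild_riccati_solution_def by blast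
  have "((\<lambda>\<tau>. (let z = S (\<tau> - t) x in adjoint (S (\<tau> - t))
          (adjoint A (P \<tau> z) + P \<tau> (A z) + Q z + adjoint C (P \<tau> (C z))
            - (1 / \<delta>) *\<^sub>R P \<tau> (adjoint (\<lambda>v. v *\<^sub>R b) (P \<tau> z) *\<^sub>R b))) \<bullet> y)
        has_integral (P t x - adjoint (S (T - t)) (G (S (T - t) x))) \<bullet> y) {t..T}"
    using has_integral_linear[OF i bounded_linear_inner_left] by (simp add: o_def)
  moreover have "(P t x - adjoint (S (T - t)) (G (S (T - t) x))) \<bullet> y = P t x \<bullet> y - G (S (T - t) x) \<bullet> S (T - t) y"
    using S t by (simp add: S' inner_diff_left)
  ultimately have "((\<lambda>\<tau>. (let z = S (\<tau> - t) x in adjoint (S (\<tau> - t))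
          (adjoint A (P \<tau> z) + P \<tau> (A z) + Q z + adjoint C (P \<tau> (C z))
            - (1 / \<delta>) *\<^sub>R P \<tau> (adjoint (\<lambda>v. v *\<^sub>R b) (P \<tau> z) *\<^sub>R b))) \<bullet> y)
        has_integral P t x \<bullet> y - G (S (T - t) x) \<bullet> S (T - t) y) {t..T}" by simp
  then show ?thesis
  proof (rule has_integral_eq[rotated])
    fix \<tau> assume "\<tau> \<in> {t..T}"
    then have \<tau>: "0 \<le> \<tau> - t" by simp
    have AA: "A' u \<bullet> v = u \<bullet> A v" "C' u \<bullet> v = u \<bullet> C v" for u v
      using A[of v u] C[of v u] by (simp_all add: inner_commute)
    show "(let z = S (\<tau> - t) x in adjoint (S (\<tau> - t))
          (adjoint A (P \<tau> z) + P \<tau> (A z) + Q z + adjoint C (P \<tau> (C z))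
            - (1 / \<delta>) *\<^sub>R P \<tau> (adjoint (\<lambda>v. v *\<^sub>R b) (P \<tau> z) *\<^sub>R b))) \<bullet> y
        = riccati_form A b C Q \<delta> (P \<tau>) (S (\<tau> - t) x) (S (\<tau> - t) y)"
      unfolding Let_def S'[OF \<tau>] S[OF \<tau>] A' C' B' riccati_form_def
      by (simp add: inner_add_left inner_diff_left AA blinfun.scaleR_right)
  qed
qed

text \<open>Differentiability gives continuity on [0,T] for each of the finitely many basis vectors.
  The bound depends on I, hence on the dimension, and serves only as the a priori bound in
  \<open>bootstrap_gronwall\<close>.\<close>

lemma matrix_riccati_bounded:
  assumes sol: "matrix_riccati_solution V T \<Lambda> A B C Q G \<delta> F"
    and V: "subspace V" and I: "finite I" "I \<subseteq> V"
    and p: "\<And>x. p x = (\<Sum>e\<in>I. (x \<bullet> e) *\<^sub>R e)"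
  obtains K where "\<And>t x. t \<in> {0..T} \<Longrightarrow> norm (F t (p x)) \<le> K * norm x"
proof -
  have "\<exists>k. \<forall>t\<in>{0..T}. norm (F t e) \<le> k" if "e \<in> I" for e
  proof -
    have "continuous_on {0..T} (\<lambda>t. F t e)"
      unfolding continuous_on_eq_continuous_within
    proof
      fix t assume "t \<in> {0..T}"
      moreover have "e \<in> V" using that I by blast
      ultimately obtain d where "((\<lambda>s. F s e) has_vector_derivative d) (at t within {0..T})"
        using sol unfolding matrix_riccati_solution_def by blast
      then show "continuous (at t within {0..T}) (\<lambda>t. F t e)" by (rule has_vector_derivative_continuous)
    qed
    from compact_imp_bounded[OF compact_continuous_image[OF this compact_Icc]]
    show ?thesis by (auto simp: bounded_iff)
  qed
  then obtain k where k: "\<And>e t. e \<in> I \<Longrightarrow> t \<in> {0..T} \<Longrightarrow> norm (F t e) \<le> k e" by metis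
  have "norm (F t (p x)) \<le> (\<Sum>e\<in>I. norm e * k e) * norm x" if t: "t \<in> {0..T}" for t x
  proof -
    have lin: "linear_operator_on V (F t)" using sol t by (auto simp: matrix_riccati_solution_def)
    \<comment> \<open>\<open>F t\<close> is additive only on V, so the sum is pulled out by
      induction with membership of the partial sums in V at each stage.\<close>
    have "F t (\<Sum>e\<in>J. (x \<bullet> e) *\<^sub>R e) = (\<Sum>e\<in>J. (x \<bullet> e) *\<^sub>R F t e)" if "finite J" "J \<subseteq> I" for J
      using that
    proof (induction J)
      case empty
      have "0 \<in> V" using V by (simp add: subspace_0)
      then have "F t (0 *\<^sub>R 0) = 0 *\<^sub>R F t 0" using lin unfolding linear_operator_on_def by blast
      then show ?case by simp
    next
      case (insert e J)
      then have e: "e \<in> V" and J: "J \<subseteq> V" using I by auto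
      have "(\<Sum>e\<in>J. (x \<bullet> e) *\<^sub>R e) \<in> V" "(x \<bullet> e) *\<^sub>R e \<in> V"
        using V e J by (auto intro!: subspace_sum subspace_mul)
      then have "F t ((x \<bullet> e) *\<^sub>R e + (\<Sum>e\<in>J. (x \<bullet> e) *\<^sub>R e)) = (x \<bullet> e) *\<^sub>R F t e + F t (\<Sum>e\<in>J. (x \<bullet> e) *\<^sub>R e)"
        using lin e by (simp add: linear_operator_on_def)
      then show ?case using insert by simp
    qed
    then have "norm (F t (p x)) = norm (\<Sum>e\<in>I. (x \<bullet> e) *\<^sub>R F t e)" using I by (simp add: p)
    also have "\<dots> \<le> (\<Sum>e\<in>I. (norm e * k e) * norm x)"
    proof (rule sum_norm_le)
      fix e assume e: "e \<in> I"
      have "\<bar>x \<bullet> e\<bar> * norm (F t e) \<le> (norm x * norm e) * k e"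
        using k[OF e t] by (intro mult_mono Cauchy_Schwarz_ineq2) auto
      then show "norm ((x \<bullet> e) *\<^sub>R F t e) \<le> norm e * k e * norm x" by (simp add: mult_ac)
    qed
    finally show ?thesis by (simp add: sum_distrib_right)
  qed
  then show thesis by (rule that)
qed

text \<open>In the difference of the two weak equations the terminal terms cancel, since S commutes
  with p and G does not distinguish p x from x. The integrand is controlled by
  \<open>riccati_form_diff_bound\<close>, and the two semigroup factors account for
  \<open>K\<^sup>2\<close> in L and \<epsilon>.\<close>

lemma galerkin_riccati_error:
  fixes S P :: "real \<Rightarrow> 'a::real_inner \<Rightarrow>\<^sub>L 'a"
  assumes mild: "mild_riccati_solution T S A (\<lambda>v. v *\<^sub>R b) C Q G \<delta> P"
    and sol: "matrix_riccati_solution V T (p \<circ> \<Lambda>) (p \<circ> A) (p \<circ> (\<lambda>v. v *\<^sub>R b)) (p \<circ> C) (p \<circ> Q) (p \<circ> G) \<delta> F"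
    and T: "0 < T" and \<delta>: "0 < \<delta>"
    and V: "subspace V" and I: "finite I" "I \<subseteq> V"
    and p: "\<And>x. p x = (\<Sum>e\<in>I. (x \<bullet> e) *\<^sub>R e)" "\<And>x. x \<in> V \<Longrightarrow> p x = x"
    and A: "linear A" "\<And>x y. A x \<bullet> y = x \<bullet> A' y" "\<And>x. norm (A x) \<le> a * norm x" "\<And>x. norm (p (A x) - p (A (p x))) \<le> \<eta> * norm x"
    and C: "linear C" "\<And>x y. C x \<bullet> y = x \<bullet> C' y" "\<And>x. norm (C x) \<le> a * norm x" "\<And>x. norm (C x - C (p x)) \<le> \<eta> * norm x"
    and Q: "linear Q" "\<And>x y. Q (p x) \<bullet> p y = Q x \<bullet> y"
    and G: "linear G" "\<And>x y. G (p x) \<bullet> p y = G x \<bullet> y"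
    and b: "norm b \<le> a" and \<eta>: "0 \<le> \<eta>" "\<eta> \<le> 1"
    and eigen: "\<And>x. x \<in> I \<Longrightarrow> \<exists>\<alpha>. \<Lambda> x = \<alpha> *\<^sub>R x \<and> (\<forall>s\<ge>0. S s x = exp (\<alpha> * s) *\<^sub>R x)"
    and sym: "\<And>x y. x \<in> V \<Longrightarrow> y \<in> I \<Longrightarrow> p (\<Lambda> x) \<bullet> y = x \<bullet> \<Lambda> y"
    and Ssym: "\<And>s x y. 0 \<le> s \<Longrightarrow> S s x \<bullet> y = x \<bullet> S s y"
    and K: "\<And>s. s \<in> {0..T} \<Longrightarrow> norm (S s) \<le> K" "1 \<le> K"
    and M: "\<And>t. t \<in> {0..T} \<Longrightarrow> norm (P t) \<le> M"
    and L: "L = K\<^sup>2 * (2 + 4 * a + a\<^sup>2 + (2 * M + 1) * a\<^sup>2 / \<delta>)" and \<epsilon>: "\<epsilon> = K\<^sup>2 * (2 * M * (1 + a) * \<eta>)"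
    and small: "\<epsilon> * T * (1 + 2 * exp (4 * L * T)) \<le> 1 / 2"
    and t: "t \<in> {0..T}"
  shows "norm (P t x - F t (p x)) \<le> 2 * \<epsilon> * T * exp (4 * L * T) * norm x"
proof -
  have "\<forall>x\<in>V. p x = x" using p(2) by blast
  note pr = finite_rank_projection[OF V I p(1) this]
  have a: "0 \<le> a" using b norm_ge_zero order_trans by blast
  have M0: "0 \<le> M" using M[OF t] norm_ge_zero order_trans by blast
  \<comment> \<open>For an eigenvector e, symmetry of S moves the eigenvalue from S(s) e to the
    coefficient: it becomes the coefficient of S(s) x.\<close>
  have comm: "S s (p x) = p (S s x)" if "0 \<le> s" for s x
  proof -
    have e: "(x \<bullet> e) *\<^sub>R S s e = (S s x \<bullet> e) *\<^sub>R e" if "e \<in> I" for e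
      using eigen[OF that] Ssym[OF \<open>0 \<le> s\<close>, of x e] \<open>0 \<le> s\<close> by (auto simp: mult.commute)
    then show ?thesis by (simp add: p(1) blinfun.sum_right blinfun.scaleR_right)
  qed
  obtain K' where K': "\<And>t x. t \<in> {0..T} \<Longrightarrow> norm (F t (p x)) \<le> K' * norm x"
    using matrix_riccati_bounded[OF sol V I p(1)] by blast
  define F' where "F' t = Blinfun (F t \<circ> p)" for t
  have lin: "linear_operator_on V (F t)" if "t \<in> {0..T}" for t
    using sol that by (auto simp: matrix_riccati_solution_def)
  have F': "blinfun_apply (F' t) = F t \<circ> p" if "t \<in> {0..T}" for t
  proof -
    have "bounded_linear (F t \<circ> p)"
      using linear_add[OF linear_operator_on_comp[OF lin[OF that] pr(1,2)]]
        linear_scale[OF linear_operator_on_comp[OF lin[OF that] pr(1,2)]] K'[OF that]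
      by (intro bounded_linear_intro[where K=K']) (auto simp: mult.commute)
    then show ?thesis unfolding F'_def by (rule bounded_linear_Blinfun_apply)
  qed
  have FV: "F' t x \<in> V" if "t \<in> {0..T}" for t x
    using lin[OF that] pr(2) by (simp add: F'[OF that] linear_operator_on_def)
  have F'p: "F' t (p x) = F' t x" "F' t x \<bullet> p y = F' t x \<bullet> y" if "t \<in> {0..T}" for t x y
    using p(2)[OF pr(2), of x] p(2)[OF FV[OF that], of x] pr(3)[of "F' t x" y] by (simp_all add: F'[OF that])
  define e where "e t = norm (P t - F' t)" for t
  have "e t \<le> 2 * \<epsilon> * T * exp (4 * L * T)"
  proof (rule bootstrap_gronwall[where e=e and t=t and K="M + \<bar>K'\<bar>"])
    show "0 < L" unfolding L using K(2) a M0 \<delta>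
      by (intro mult_pos_pos add_pos_nonneg mult_nonneg_nonneg divide_nonneg_pos) auto
    show "0 \<le> \<epsilon>" unfolding \<epsilon> using M0 a \<eta> by simp
    show "e s \<le> M + \<bar>K'\<bar>" if s: "s \<in> {0..T}" for s
    proof -
      have "norm (F' s) \<le> \<bar>K'\<bar>"
      proof (rule norm_blinfun_bound)
        fix x
        have "norm (F' s x) \<le> K' * norm x" using K'[OF s] by (simp add: F'[OF s])
        also have "\<dots> \<le> \<bar>K'\<bar> * norm x" by (intro mult_right_mono) auto
        finally show "norm (F' s x) \<le> \<bar>K'\<bar> * norm x" .
      qed simp
      then show ?thesis using M[OF s] norm_triangle_ineq4[of "P s" "F' s"] by (simp add: e_def)
    qed
    fix s w assume s: "s \<in> {0..T}" and w: "w integrable_on {s..T}"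
      and ew: "\<And>\<tau>. \<tau> \<in> {s..T} \<Longrightarrow> \<epsilon> + L * e \<tau> + L * (e \<tau>)\<^sup>2 \<le> w \<tau>"
    define W where "W = integral {s..T} w"
    have pos: "0 \<le> \<epsilon> + L * e \<tau> + L * (e \<tau>)\<^sup>2" for \<tau>
      using \<open>0 < L\<close> \<open>0 \<le> \<epsilon>\<close> by (simp add: e_def)
    have W0: "0 \<le> W" unfolding W_def
      by (rule integral_nonneg[OF w]) (use ew pos order_trans in blast)
    have weak: "\<bar>(P s x - F' s x) \<bullet> y\<bar> \<le> W * (norm x * norm y)" for x y
    proof -
      define \<Psi> where "\<Psi> \<tau> = riccati_form A b C Q \<delta> (P \<tau>) (S (\<tau> - s) x) (S (\<tau> - s) y)
         - riccati_form A b C Q \<delta> (F \<tau> \<circ> p) (S (\<tau> - s) (p x)) (S (\<tau> - s) (p y))" for \<tau>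
      have "(\<Psi> has_integral (P s x \<bullet> y - G (S (T - s) x) \<bullet> S (T - s) y)
          - (F s (p x) \<bullet> p y - G (S (T - s) (p x)) \<bullet> S (T - s) (p y))) {s..T}"
        unfolding \<Psi>_def
        by (intro has_integral_diff mild_riccati_weak[OF mild A(2) C(2) Ssym s]
            matrix_riccati_weak_mild[OF sol V pr(5) I(2) pr(1,2) p(2) pr(3) A(1,2) C(1,2) Q(1) G(1) eigen sym s pr(2) pr(2)])
      moreover have "G (S (T - s) (p x)) \<bullet> S (T - s) (p y) = G (S (T - s) x) \<bullet> S (T - s) y"
        using s by (simp add: comm G(2))
      moreover have "F s (p x) \<bullet> p y = F' s x \<bullet> y" using F'p(2)[OF s] by (simp add: F'[OF s])
      ultimately have i: "(\<Psi> has_integral (P s x - F' s x) \<bullet> y) {s..T}" by (simp add: inner_diff_left)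
      have "norm (integral {s..T} \<Psi>) \<le> integral {s..T} (\<lambda>\<tau>. w \<tau> * (norm x * norm y))"
      proof (rule integral_norm_bound_integral)
        show "\<Psi> integrable_on {s..T}" using i by blast
        show "(\<lambda>\<tau>. w \<tau> * (norm x * norm y)) integrable_on {s..T}" by (rule integrable_on_mult_left[OF w])
        fix \<tau> assume \<tau>s: "\<tau> \<in> {s..T}"
        then have \<tau>: "\<tau> \<in> {0..T}" "\<tau> - s \<in> {0..T}" "0 \<le> \<tau> - s" using s by auto
        have SK: "norm (S (\<tau> - s) u) \<le> K * norm u" for u
          using order_trans[OF norm_blinfun mult_right_mono[OF K(1)[OF \<tau>(2)] norm_ge_zero]] .
        define c where "c = 2 * M * (1 + a) * \<eta> + (2 + 4 * a + a\<^sup>2 + (2 * M + 1) * a\<^sup>2 / \<delta>) * e \<tau>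
          + (2 + 4 * a + a\<^sup>2 + (2 * M + 1) * a\<^sup>2 / \<delta>) * (e \<tau>)\<^sup>2"
        have cK: "K\<^sup>2 * c = \<epsilon> + L * e \<tau> + L * (e \<tau>)\<^sup>2" by (simp add: c_def L \<epsilon> algebra_simps)
        have "0 \<le> K\<^sup>2 * c" using cK pos by simp
        then have c0: "0 \<le> c" using K(2) by (simp add: zero_le_mult_iff)
        have "norm (\<Psi> \<tau>) \<le> c * (norm (S (\<tau> - s) x) * norm (S (\<tau> - s) y))"
          unfolding \<Psi>_def real_norm_def comm[OF \<tau>(3)] c_def e_def F'[OF \<tau>(1), symmetric]
          by (rule riccati_form_diff_bound[where p=p and F="P \<tau>" and F'="F' \<tau>" and A=A and C=C and Q=Q, OF pr(4) F'p[OF \<tau>(1)] A(1,3,4) C(1,3,4) Q(2) b a \<eta> \<delta> M[OF \<tau>(1)]])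
        also have "\<dots> \<le> c * ((K * norm x) * (K * norm y))"
          using SK K(2) c0 by (intro mult_left_mono mult_mono) auto
        also have "\<dots> = (K\<^sup>2 * c) * (norm x * norm y)" by (simp add: power2_eq_square mult_ac)
        also have "\<dots> \<le> w \<tau> * (norm x * norm y)"
          unfolding cK by (intro mult_right_mono ew[OF \<tau>s]) auto
        finally show "norm (\<Psi> \<tau>) \<le> w \<tau> * (norm x * norm y)" .
      qed
      then show ?thesis using integral_unique[OF i] by (simp add: W_def)
    qed
    \<comment> \<open>The bilinear bound becomes a norm bound on taking the test vector y to be (P s
      - F' s) x.\<close>
    have "norm (P s - F' s) \<le> W"
    proof (rule norm_blinfun_bound[OF W0])
      fix x
      define y where "y = P s x - F' s x"
      have "norm y * norm y \<le> W * norm x * norm y"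
        using weak[of x y] by (simp add: y_def[symmetric] mult.assoc flip: power2_norm_eq_inner power2_eq_square)
      then have "norm y \<le> W * norm x" using W0 by (cases "y = 0") auto
      then show "norm ((P s - F' s) x) \<le> W * norm x" by (simp add: y_def blinfun.diff_left)
    qed
    then show "e s \<le> integral {s..T} w" by (simp add: e_def W_def)
  qed (use T small t in \<open>auto simp: e_def\<close>)
  moreover have "norm (P t x - F t (p x)) \<le> e t * norm x"
    using norm_blinfun[of "P t - F' t" x] by (simp add: e_def blinfun.diff_left F'[OF t])
  ultimately show ?thesis by (meson mult_right_mono norm_ge_zero order_trans)
qed

subsection \<open>The cosine basis of $H^1(0,1)$\<close>

text \<open>Bessel's inequality makes the partial sums Cauchy; their limit has the same coefficients
  as z, so totality identifies the two.\<close>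

lemma orthonormal_expansion:
  fixes e :: "nat \<Rightarrow> 'a::{real_inner,complete_space}"
  assumes orthonormal: "\<And>m n. e m \<bullet> e n = of_bool (m = n)"
    and total: "\<And>x. (\<And>n. x \<bullet> e n = 0) \<Longrightarrow> x = 0"
  shows "(\<lambda>N. \<Sum>n\<le>N. (z \<bullet> e n) *\<^sub>R e n) \<longlonglongrightarrow> z"
proof -
  define s where "s N = (\<Sum>n\<le>N. (z \<bullet> e n) *\<^sub>R e n)" for N
  define q where "q N = (\<Sum>n\<le>N. (z \<bullet> e n)\<^sup>2)" for N
  have se: "s N \<bullet> e n = (if n \<le> N then z \<bullet> e n else 0)" for N n
    by (simp add: s_def inner_sum_left orthonormal of_bool_def if_distrib sum.delta' cong: if_cong)
  have xs: "x \<bullet> s N = (\<Sum>n\<le>N. (z \<bullet> e n) * (x \<bullet> e n))" for x N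
    by (simp add: s_def inner_sum_right)
  have ss: "s M \<bullet> s N = q N" if "N \<le> M" for M N
    unfolding xs q_def using that by (intro sum.cong) (auto simp: se power2_eq_square)
  have diff: "(norm (s M - s N))\<^sup>2 = q M - q N" if "N \<le> M" for M N
    using that ss[of N M] ss[of N N] ss[of M M]
    by (simp add: power2_norm_eq_inner inner_diff_left inner_diff_right inner_commute)
  have "q N \<le> (norm z)\<^sup>2" for N
  proof -
    have "z \<bullet> s N = q N" by (simp add: xs q_def power2_eq_square)
    moreover have "0 \<le> (z - s N) \<bullet> (z - s N)" by simp
    ultimately show ?thesis
      using ss[of N N] by (simp add: power2_norm_eq_inner inner_diff_left inner_diff_right inner_commute)
  qed
  moreover have "incseq q" by (rule incseq_SucI) (simp add: q_def)
  ultimately have "convergent q"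
    using incseq_convergent[of q] by (metis convergent_def)
  then have qC: "Cauchy q" by (rule convergent_Cauchy)
  have "Cauchy s"
  proof (rule CauchyI)
    fix r :: real assume r: "r > 0"
    then obtain M where M: "\<And>m n. m \<ge> M \<Longrightarrow> n \<ge> M \<Longrightarrow> norm (q m - q n) < r\<^sup>2"
      using CauchyD[OF qC, of "r\<^sup>2"] by auto
    have "norm (s m - s n) < r" if "n \<le> m" "m \<ge> M" "n \<ge> M" for m n
    proof (rule power_less_imp_less_base)
      show "(norm (s m - s n))\<^sup>2 < r\<^sup>2" using diff[OF that(1)] M[OF that(2,3)] by simp
    qed (use r in simp)
    then show "\<exists>M. \<forall>m\<ge>M. \<forall>n\<ge>M. norm (s m - s n) < r"
      by (metis linear norm_minus_commute)
  qed
  then obtain w where w: "s \<longlonglongrightarrow> w" using Cauchy_convergent convergent_def by blast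
  have "(z - w) \<bullet> e n = 0" for n
  proof -
    have "(\<lambda>N. s N \<bullet> e n) \<longlonglongrightarrow> w \<bullet> e n" by (intro tendsto_intros w)
    moreover have "(\<lambda>N. s N \<bullet> e n) \<longlonglongrightarrow> z \<bullet> e n"
      by (rule tendsto_eventually) (rule eventually_mono[OF eventually_ge_at_top[of n]], simp add: se)
    ultimately have "w \<bullet> e n = z \<bullet> e n" by (rule LIMSEQ_unique)
    then show ?thesis by (simp add: inner_diff_left)
  qed
  then have "z = w" using total[of "z - w"] by simp
  then show ?thesis using w by (simp add: s_def[abs_def])
qed

section \<open>Integration by parts for an H^1 function against a smooth one\<close>

lemma test_functions_mult_C1:
  assumes p: "\<And>x::real. (p has_real_derivative p' x) (at x)" "continuous_on UNIV p'" and \<phi>: "\<phi> \<in> test_functions"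
  shows "(\<lambda>x. p x * \<phi> x) \<in> test_functions" "deriv (\<lambda>x. p x * \<phi> x) = (\<lambda>x. p' x * \<phi> x + p x * deriv \<phi> x)"
proof -
  note t = test_functions_continuous[OF \<phi>]
  have d: "((\<lambda>x. p x * \<phi> x) has_real_derivative p' x * \<phi> x + p x * deriv \<phi> x) (at x)" for x
    by (auto intro!: derivative_eq_intros p t)
  have "continuous_on UNIV p" by (meson DERIV_isCont continuous_at_imp_continuous_on p(1))
  then have "continuous_on UNIV (\<lambda>x. p' x * \<phi> x + p x * deriv \<phi> x)"
    by (intro continuous_intros p t)
  from C1_I[OF d this] \<phi> show "(\<lambda>x. p x * \<phi> x) \<in> test_functions"
    by (fastforce simp: test_functions_def)
  show "deriv (\<lambda>x. p x * \<phi> x) = (\<lambda>x. p' x * \<phi> x + p x * deriv \<phi> x)"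
    using d by (auto intro: DERIV_imp_deriv)
qed

lemma L2_mult_continuous:
  assumes "f \<in> L2_01" "continuous_on {0..1} p"
  shows "(\<lambda>x. f x * p x) \<in> L2_01"
proof -
  obtain M where M: "\<And>x. x \<in> {0..1} \<Longrightarrow> norm (p x) \<le> M"
    using compact_imp_bounded[OF compact_continuous_image[OF assms(2) compact_Icc]]
    unfolding bounded_iff by blast
  note [measurable] = L2_measurable[OF assms(1)] L2_measurable[OF L2_continuous[OF assms(2)]]
  have "integrable leb01 (\<lambda>x. (f x * p x)\<^sup>2)"
  proof (rule Bochner_Integration.integrable_bound)
    show "integrable leb01 (\<lambda>x. M\<^sup>2 * (f x)\<^sup>2)" using L2_square[OF assms(1)] by simp
    show "AE x in leb01. norm ((f x * p x)\<^sup>2) \<le> norm (M\<^sup>2 * (f x)\<^sup>2)"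
    proof (rule AE_I2)
      fix x assume "x \<in> space leb01"
      then have "\<bar>p x\<bar> \<le> M" using M[of x] by (simp add: space_restrict_space)
      then have "\<bar>p x\<bar>\<^sup>2 \<le> M\<^sup>2" by (intro power_mono) auto
      then show "norm ((f x * p x)\<^sup>2) \<le> norm (M\<^sup>2 * (f x)\<^sup>2)"
        by (simp add: power_mult_distrib mult.commute[of "(f x)\<^sup>2"] mult_right_mono)
    qed
  qed measurable
  then show ?thesis by (simp add: L2_01_def)
qed

text \<open>Using p \<phi> as a test function yields the product rule for the weak derivative of z
  p; its primitive representation, evaluated at 1, gives the boundary terms.\<close>

lemma h1_integral_by_parts:
  assumes p: "\<And>x::real. (p has_real_derivative p' x) (at x)" "continuous_on UNIV p'"
  shows "(\<integral>x. h1_deriv z x * p x \<partial>leb01) + (\<integral>x. h1_fun z x * p' x \<partial>leb01)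
    = h1_fun z 1 * p 1 - h1_fun z 0 * p 0"
proof -
  have pc: "continuous_on S p" for S by (meson DERIV_isCont continuous_at_imp_continuous_on p(1))
  have p'c: "continuous_on S p'" for S using p(2) continuous_on_subset by blast
  define g where "g x = h1_deriv z x * p x + h1_fun z x * p' x" for x
  have L: "(\<lambda>x. h1_deriv z x * p x) \<in> L2_01" "(\<lambda>x. h1_fun z x * p' x) \<in> L2_01"
    by (intro L2_mult_continuous h1_deriv h1_L2 pc p'c)+
  have gL: "g \<in> L2_01" unfolding g_def by (intro L2_add L)
  have "weak_deriv (\<lambda>x. h1_fun z x * p x) g"
    unfolding weak_deriv_def
  proof (intro ballI)
    fix \<phi> assume \<phi>: "\<phi> \<in> test_functions"
    note m = test_functions_mult_C1[OF p \<phi>]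
    have "(\<integral>x. h1_fun z x * (p' x * \<phi> x + p x * deriv \<phi> x) \<partial>leb01) = - (\<integral>x. h1_deriv z x * (p x * \<phi> x) \<partial>leb01)"
      using h1_deriv(2)[of z] m unfolding weak_deriv_def by fastforce
    moreover have "(\<integral>x. h1_fun z x * (p' x * \<phi> x + p x * deriv \<phi> x) \<partial>leb01)
       = (\<integral>x. (h1_fun z x * p' x) * \<phi> x \<partial>leb01) + (\<integral>x. (h1_fun z x * p x) * deriv \<phi> x \<partial>leb01)"
      using L2_mult[OF L(2) test_L2(1)[OF \<phi>]] L2_mult[OF L2_mult_continuous[OF h1_L2 pc] test_L2(2)[OF \<phi>], of z]
      by (simp add: distrib_left mult.assoc)
    moreover have "(\<integral>x. g x * \<phi> x \<partial>leb01) = (\<integral>x. (h1_deriv z x * p x) * \<phi> x \<partial>leb01) + (\<integral>x. (h1_fun z x * p' x) * \<phi> x \<partial>leb01)"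
      using L2_mult[OF L(1) test_L2(1)[OF \<phi>]] L2_mult[OF L(2) test_L2(1)[OF \<phi>]]
      by (simp add: g_def distrib_right)
    ultimately show "(\<integral>x. h1_fun z x * p x * deriv \<phi> x \<partial>leb01) = - (\<integral>x. g x * \<phi> x \<partial>leb01)"
      by (simp add: mult.assoc)
  qed
  then have "h1_fun z 1 * p 1 = h1_fun z 0 * p 0 + (\<integral>y. g y * indicator {..1} y \<partial>leb01)"
    using bspec[OF iffD1[OF weak_deriv_iff_primitive[OF continuous_on_mult[OF h1_continuous[of z] pc] gL]], of 1] by force
  also have "(\<integral>y. g y * indicator {..1} y \<partial>leb01) = (\<integral>y. g y \<partial>leb01)"
    by (rule Bochner_Integration.integral_cong) (auto simp: space_restrict_space)
  also have "\<dots> = (\<integral>x. h1_deriv z x * p x \<partial>leb01) + (\<integral>x. h1_fun z x * p' x \<partial>leb01)"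
    unfolding g_def by (intro Bochner_Integration.integral_add L2_integrable L)
  finally show ?thesis by simp
qed

text \<open>Trades the derivative of z for boundary values. The integrals cancel when u'' = u, which
  produces the trace; the boundary terms vanish for cosines.\<close>

lemma h1_inner_C2:
  assumes u: "\<And>x::real. (u has_real_derivative u' x) (at x)" "\<And>x::real. (u' has_real_derivative u'' x) (at x)"
    and c: "continuous_on UNIV u''"
  shows "z \<bullet> Abs_h1 (\<lambda>x. if x \<in> {0..1} then u x else 0) =
    (\<integral>x. h1_fun z x * u x \<partial>leb01) - (\<integral>x. h1_fun z x * u'' x \<partial>leb01) + h1_fun z 1 * u' 1 - h1_fun z 0 * u' 0"
proof -
  define v where "v = Abs_h1 (\<lambda>x. if x \<in> {0..1} then u x else 0)"
  have u'c: "continuous_on S u'" for S by (meson DERIV_isCont continuous_at_imp_continuous_on u(2))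
  have v: "h1_fun v = (\<lambda>x. if x \<in> {0..1} then u x else 0)"
    unfolding v_def by (rule h1_fun_C1[OF u(1) u'c])
  have "weak_deriv (h1_fun v) u'" by (rule weak_deriv_cong[OF weak_deriv_C1[OF u(1) u'c]]) (simp add: v)
  then have d: "AE x in leb01. h1_deriv v x = u' x" by (intro h1_deriv_unique L2_continuous u'c)
  note [measurable] = L2_measurable[OF h1_deriv(1)] L2_measurable[OF L2_continuous[OF u'c]]
  have "(\<integral>x. h1_deriv z x * h1_deriv v x \<partial>leb01) = (\<integral>x. h1_deriv z x * u' x \<partial>leb01)"
    by (rule integral_cong_AE) (measurable, use d in eventually_elim, simp)
  moreover have "(\<integral>x. h1_fun z x * h1_fun v x \<partial>leb01) = (\<integral>x. h1_fun z x * u x \<partial>leb01)"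
    by (rule Bochner_Integration.integral_cong) (auto simp: v space_restrict_space)
  ultimately have "z \<bullet> v = (\<integral>x. h1_fun z x * u x \<partial>leb01) + (\<integral>x. h1_deriv z x * u' x \<partial>leb01)"
    by (simp add: inner_h1_def)
  then show ?thesis using h1_integral_by_parts[OF u(2) c, of z] by (simp add: v_def)
qed

text \<open>The Riesz representative $\gamma_0$ of the evaluation at $0$, found by solving $u'' = u$,
  $u'(0) = -1$, $u'(1) = 0$.\<close>

definition trace_rep :: h1
  where "trace_rep = Abs_h1 (\<lambda>x. if x \<in> {0..1} then cosh (1 - x) / sinh 1 else 0)"

lemma inner_trace_rep: "z \<bullet> trace_rep = h1_fun z 0"
proof -
  have "z \<bullet> trace_rep = (\<integral>x. h1_fun z x * (cosh (1 - x) / sinh 1) \<partial>leb01) - (\<integral>x. h1_fun z x * (cosh (1 - x) / sinh 1) \<partial>leb01)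
      + h1_fun z 1 * (- sinh (1 - 1) / sinh 1) - h1_fun z 0 * (- sinh (1 - 0) / sinh 1)"
    unfolding trace_rep_def
    by (rule h1_inner_C2[where u'="\<lambda>x. - sinh (1 - x) / sinh 1"])
       (auto intro!: derivative_eq_intros continuous_intros simp: sinh_zero_iff)
  then show ?thesis by (simp add: sinh_zero_iff)
qed

text \<open>The derivative of the cosine vanishes at both ends, so only u - u'' survives and H^1
  coefficients reduce to L^2 cosine coefficients.\<close>

lemma inner_neumann_phi:
  "z \<bullet> neumann_phi n = neumann_coeff n * (1 + pi\<^sup>2 * (real n)\<^sup>2) * (\<integral>x. h1_fun z x * cos (real n * pi * x) \<partial>leb01)"
proof -
  define k a where "k = neumann_coeff n" and "a = real n * pi"
  have i: "integrable leb01 (\<lambda>x. h1_fun z x * cos (a * x))"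
    by (intro L2_integrable L2_mult_continuous h1_L2 continuous_intros)
  have "z \<bullet> neumann_phi n = (\<integral>x. h1_fun z x * (k * cos (a * x)) \<partial>leb01)
      - (\<integral>x. h1_fun z x * (- (k * a\<^sup>2) * cos (a * x)) \<partial>leb01)
      + h1_fun z 1 * (- (k * a) * sin (a * 1)) - h1_fun z 0 * (- (k * a) * sin (a * 0))"
    unfolding neumann_phi_def k_def[symmetric] a_def[symmetric]
    by (rule h1_inner_C2[where u'="\<lambda>x. - (k * a) * sin (a * x)"])
       (auto intro!: derivative_eq_intros continuous_intros simp: power2_eq_square)
  also have "(\<lambda>x. h1_fun z x * (k * cos (a * x))) = (\<lambda>x. k * (h1_fun z x * cos (a * x)))" by (auto simp: mult_ac)
  also have "(\<lambda>x. h1_fun z x * (- (k * a\<^sup>2) * cos (a * x))) = (\<lambda>x. - (k * a\<^sup>2) * (h1_fun z x * cos (a * x)))" by (auto simp: mult_ac)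
  also have "sin (a * 1) = 0" by (simp add: a_def)
  finally have "z \<bullet> neumann_phi n = k * (1 + a\<^sup>2) * (\<integral>x. h1_fun z x * cos (a * x) \<partial>leb01)"
    by (simp only: integral_mult_right_zero) (simp add: algebra_simps)
  then show ?thesis by (simp add: k_def a_def power_mult_distrib mult.commute)
qed

text \<open>Symmetry of the inner product gives two values with the same integral J but different
  factors 1 + pi^2 n^2 and 1 + pi^2 m^2, so off the diagonal both vanish; only the diagonal needs an
  explicit antiderivative.\<close>

lemma neumann_phi_orthonormal: "neumann_phi m \<bullet> neumann_phi n = of_bool (m = n)"
proof -
  define J where "J = (\<integral>x. cos (real m * pi * x) * cos (real n * pi * x) \<partial>leb01)"
  define k where "k = neumann_coeff m * neumann_coeff n"
  have aux: "neumann_phi m \<bullet> neumann_phi n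
      = neumann_coeff m * neumann_coeff n * (1 + pi\<^sup>2 * (real n)\<^sup>2) * (\<integral>x. cos (real m * pi * x) * cos (real n * pi * x) \<partial>leb01)" for m n
  proof -
    have "(\<integral>x. h1_fun (neumann_phi m) x * cos (real n * pi * x) \<partial>leb01)
      = (\<integral>x. neumann_coeff m * (cos (real m * pi * x) * cos (real n * pi * x)) \<partial>leb01)"
      by (rule Bochner_Integration.integral_cong) (auto simp: h1_fun_neumann_phi space_restrict_space)
    then show ?thesis by (simp add: inner_neumann_phi)
  qed
  have e1: "neumann_phi m \<bullet> neumann_phi n = k * (1 + pi\<^sup>2 * (real n)\<^sup>2) * J"
    by (simp add: aux J_def k_def)
  have e2: "neumann_phi m \<bullet> neumann_phi n = k * (1 + pi\<^sup>2 * (real m)\<^sup>2) * J"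
    using aux[of n m] by (simp add: J_def k_def inner_commute mult_ac)
  show ?thesis
  proof (cases "m = n")
    case False
    have "(k * J) * (pi\<^sup>2 * ((real n)\<^sup>2 - (real m)\<^sup>2)) = 0" using e1 e2 False by (auto simp: algebra_simps)
    then have "k * J = 0" using False by (auto simp: power2_eq_iff)
    then show ?thesis using e1 False by auto
  next
    case True
    have J: "J = (if n = 0 then 1 else 1/2)"
    proof (cases "n = 0")
      case True
      then show ?thesis using \<open>m = n\<close> measure_leb01 by (simp add: J_def)
    next
      case False
      define a where "a = real n * pi"
      have a: "a \<noteq> 0" using False by (simp add: a_def)
      have "J = (\<integral>x. (cos (a * x))\<^sup>2 * indicator {0..} x \<partial>leb01)" unfolding J_def
        by (rule Bochner_Integration.integral_cong) (auto simp: \<open>m = n\<close> a_def space_restrict_space power2_eq_square)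
      also have "\<dots> = (1 / 2 + sin (a * 1) * cos (a * 1) / (2 * a)) - (0 / 2 + sin (a * 0) * cos (a * 0) / (2 * a))"
      proof (rule FTC01)
        fix x
        have "1/2 + (a * cos (a * x) * cos (a * x) - sin (a * x) * (a * sin (a * x))) / (2 * a)
            = 1/2 + ((cos (a * x))\<^sup>2 - (sin (a * x))\<^sup>2) / 2"
          using a by (simp add: field_simps power2_eq_square)
        then have "(cos (a * x))\<^sup>2 = 1/2 + (a * cos (a * x) * cos (a * x) - sin (a * x) * (a * sin (a * x))) / (2 * a)"
          by (simp add: sin_squared_eq field_simps)
        moreover have "((\<lambda>x. x / 2 + sin (a * x) * cos (a * x) / (2 * a)) has_real_derivative
            1/2 + (a * cos (a * x) * cos (a * x) - sin (a * x) * (a * sin (a * x))) / (2 * a)) (at x)"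
          by (auto intro!: derivative_eq_intros simp: a field_simps)
        ultimately show "((\<lambda>x. x / 2 + sin (a * x) * cos (a * x) / (2 * a)) has_real_derivative (cos (a * x))\<^sup>2) (at x)"
          by simp
      qed (auto intro!: continuous_intros)
      also have "\<dots> = 1/2" by (simp add: a_def)
      finally show ?thesis using False by simp
    qed
    have p: "0 < 1 + pi\<^sup>2 * (real n)\<^sup>2" by (simp add: add_pos_nonneg)
    have "k = (if n = 0 then 1 else 2 / (1 + pi\<^sup>2 * (real n)\<^sup>2))"
      using p True by (simp add: k_def neumann_coeff_def flip: power2_eq_square)
    then show ?thesis using e1 J True p by auto
  qed
qed

text \<open>Since \<open>cos (\<pi> x)\<close> is injective on $[0,1]$, the polynomials in it are dense in $C[0,1]$, and they are
  combinations of the functions \<open>cos (n \<pi> x)\<close>.\<close>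

lemma neumann_phi_total:
  assumes "\<And>n. z \<bullet> neumann_phi n = 0"
  shows "z = 0"
proof -
  define f where "f = h1_fun z"
  define C where "C x = cos (pi * x)" for x :: real
  have fc: "continuous_on {0..1} f" by (simp add: f_def h1_continuous)
  have Cc: "continuous_on S C" for S unfolding C_def by (intro continuous_intros)
  have int: "integrable leb01 (\<lambda>x. f x * g x)" if "continuous_on {0..1} g" for g
    by (intro L2_integrable L2_mult_continuous that) (simp add: f_def h1_L2)
  have base: "(\<integral>x. f x * cos (real n * pi * x) \<partial>leb01) = 0" for n
  proof -
    have "0 < 1 + pi\<^sup>2 * (real n)\<^sup>2" by (simp add: add_pos_nonneg)
    moreover from this have "neumann_coeff n \<noteq> 0" by (simp add: neumann_coeff_def)
    ultimately show ?thesis using assms[of n] by (auto simp: inner_neumann_phi f_def)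
  qed
  have pow: "(\<integral>x. f x * (C x ^ i * cos (real n * pi * x)) \<partial>leb01) = 0" for i n
  proof (induction i arbitrary: n)
    case 0 then show ?case using base by simp
  next
    case (Suc i)
    \<comment> \<open>The product formula produces the index n - 1; for n = 0 this is -1, and
      evenness of the cosine replaces it by 1.\<close>
    obtain m :: nat where m: "\<And>x. C x * cos (real n * pi * x) = (cos (real (Suc n) * pi * x) + cos (real m * pi * x)) / 2"
    proof (cases n)
      case 0
      then show ?thesis by (intro that[of 1]) (simp add: C_def)
    next
      case (Suc l)
      have "C x * cos (real n * pi * x) = (cos (real (Suc n) * pi * x) + cos (real l * pi * x)) / 2" for x
      proof -
        have "real (Suc n) * pi * x = real n * pi * x + pi * x" "real l * pi * x = real n * pi * x - pi * x"
          using Suc by (auto simp: algebra_simps)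
        then show ?thesis by (simp add: C_def cos_add cos_diff)
      qed
      then show ?thesis by (rule that)
    qed
    have "(\<lambda>x. f x * (C x ^ Suc i * cos (real n * pi * x))) = 
      (\<lambda>x. (1/2) * (f x * (C x ^ i * cos (real (Suc n) * pi * x))) + (1/2) * (f x * (C x ^ i * cos (real m * pi * x))))"
    proof
      fix x
      have "f x * (C x ^ Suc i * cos (real n * pi * x)) = f x * C x ^ i * (C x * cos (real n * pi * x))" by simp
      then show "f x * (C x ^ Suc i * cos (real n * pi * x)) = 
        (1/2) * (f x * (C x ^ i * cos (real (Suc n) * pi * x))) + (1/2) * (f x * (C x ^ i * cos (real m * pi * x)))"
        unfolding m by (simp add: algebra_simps add_divide_distrib)
    qed
    moreover have "integrable leb01 (\<lambda>x. f x * (C x ^ i * cos (real k * pi * x)))" for k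
      by (intro int continuous_intros Cc)
    ultimately show ?case by (simp only: Bochner_Integration.integral_add integrable_mult_right integral_mult_right_zero Suc.IH)
  qed
  have poly: "(\<integral>x. f x * p (C x) \<partial>leb01) = 0" if rp: "real_polynomial_function p" for p
  proof -
    obtain a n where p: "p = (\<lambda>x. \<Sum>i\<le>n. a i * x ^ i)"
      using rp unfolding real_polynomial_function_iff_sum by blast
    have "(\<integral>x. f x * p (C x) \<partial>leb01) = (\<integral>x. (\<Sum>i\<le>n. a i * (f x * C x ^ i)) \<partial>leb01)"
      by (simp add: p sum_distrib_left mult_ac)
    also have "\<dots> = (\<Sum>i\<le>n. a i * (\<integral>x. f x * C x ^ i \<partial>leb01))"
      by (subst Bochner_Integration.integral_sum) (auto intro!: int continuous_intros Cc)
    also have "\<dots> = 0" using pow[of _ 0] by simp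
    finally show ?thesis .
  qed
  interpret R: function_ring_on "{\<lambda>x. p (C x) | p. real_polynomial_function p}" "{0..1::real}"
  proof
    show "continuous_on {0..1} g" if "g \<in> {\<lambda>x. p (C x) | p. real_polynomial_function p}" for g
      using that Cc by (auto intro: continuous_on_compose2[OF continuous_on_polymonial_function[where S=UNIV]] simp: real_polynomial_function_eq)
    show "\<exists>g\<in>{\<lambda>x. p (C x) | p. real_polynomial_function p}. g x \<noteq> g y"
      if "x \<in> {0..1}" "y \<in> {0..1}" "x \<noteq> y" for x y :: real
    proof (intro bexI)
      show "C x \<noteq> C y" unfolding C_def using that cos_inj_pi[of "pi * x" "pi * y"] by auto
      show "C \<in> {\<lambda>x. p (C x) | p. real_polynomial_function p}"
        by (intro CollectI exI[of _ "\<lambda>x. x"]) (auto intro: real_polynomial_function.intros)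
    qed
  qed (auto intro: real_polynomial_function.intros)
  have "(\<integral>x. (f x)\<^sup>2 \<partial>leb01) \<le> 0 + d" if d: "d > 0" for d
  proof -
    \<comment> \<open>f is orthogonal to every polynomial g in \<open>C\<close>, so the integral of
      f^2 equals that of f (f - g), at most I times the uniform error; the tolerance d / (I + 1) is
      safe also for I = 0.\<close>
    define I where "I = (\<integral>x. \<bar>f x\<bar> \<partial>leb01)"
    have I: "0 \<le> I" by (simp add: I_def)
    obtain g where g: "g \<in> {\<lambda>x. p (C x) | p. real_polynomial_function p}"
      "\<And>x. x \<in> {0..1} \<Longrightarrow> \<bar>f x - g x\<bar> < d / (I + 1)"
    proof -
      have "0 < d / (I + 1)" using d I by simp
      from R.Stone_Weierstrass_basic[OF fc this] show thesis using that by blast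
    qed
    have gi: "integrable leb01 (\<lambda>x. f x * g x)" by (rule int) (rule R.continuous[OF g(1)])
    have ff: "integrable leb01 (\<lambda>x. f x * f x)" by (rule int[OF fc])
    have af: "integrable leb01 (\<lambda>x. \<bar>f x\<bar>)" unfolding f_def by (intro integrable_abs L2_integrable h1_L2)
    have "(\<integral>x. (f x)\<^sup>2 \<partial>leb01) = (\<integral>x. f x * f x - f x * g x \<partial>leb01)"
      using g(1) poly ff gi by (auto simp: power2_eq_square)
    also have "\<dots> \<le> (\<integral>x. \<bar>f x\<bar> * (d / (I + 1)) \<partial>leb01)"
    proof (rule integral_mono)
      fix x assume "x \<in> space leb01"
      then have "\<bar>f x - g x\<bar> \<le> d / (I + 1)" using g(2)[of x] by (simp add: space_restrict_space)
      then have "\<bar>f x\<bar> * \<bar>f x - g x\<bar> \<le> \<bar>f x\<bar> * (d / (I + 1))" by (rule mult_left_mono) simp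
      moreover have "f x * f x - f x * g x \<le> \<bar>f x\<bar> * \<bar>f x - g x\<bar>"
        by (metis abs_ge_self abs_mult right_diff_distrib)
      ultimately show "f x * f x - f x * g x \<le> \<bar>f x\<bar> * (d / (I + 1))" by linarith
    qed (use ff gi af in auto)
    also have "\<dots> = I * (d / (I + 1))" by (simp add: I_def)
    also have "\<dots> \<le> d" using I d by (simp add: field_simps)
    finally show ?thesis by simp
  qed
  then have "(\<integral>x. (f x)\<^sup>2 \<partial>leb01) \<le> 0" by (rule field_le_epsilon)
  then have "(\<integral>x. (f x)\<^sup>2 \<partial>leb01) = 0" by (simp add: order_antisym)
  then have "AE x in leb01. f x = 0"
    by (subst (asm) integral_nonneg_eq_0_iff_AE) (auto simp: f_def L2_square h1_L2)
  from cont_AE_zero[OF fc this] show ?thesis by (intro h1_eqI) (simp add: f_def)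
qed

lemma neumann_phi_expansion:
  "(\<lambda>N. \<Sum>n\<le>N. (z \<bullet> neumann_phi n) *\<^sub>R neumann_phi n) \<longlonglongrightarrow> z"
  by (rule orthonormal_expansion[OF neumann_phi_orthonormal neumann_phi_total])

subsection \<open>The Galerkin projections and the block operators\<close>

definition neumann_proj :: "nat \<Rightarrow> h1 \<Rightarrow> h1"
  where "neumann_proj N z = (\<Sum>n\<le>N. (z \<bullet> neumann_phi n) *\<^sub>R neumann_phi n)"

lemma proj_N_Pair: "proj_N N (X, Y, z) = (X, Y, neumann_proj N z)"
  by (simp add: proj_N_def neumann_proj_def)

lemma neumann_proj_sym: "neumann_proj N z \<bullet> w = z \<bullet> neumann_proj N w"
  by (simp add: neumann_proj_def inner_sum_left inner_sum_right inner_commute mult.commute)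

lemma neumann_proj_phi: "n \<le> N \<Longrightarrow> neumann_proj N (neumann_phi n) = neumann_phi n"
  by (simp add: neumann_proj_def neumann_phi_orthonormal of_bool_def if_distrib[of "\<lambda>c. c *\<^sub>R _"] cong: if_cong)

lemma neumann_proj_span:
  assumes "z \<in> span (neumann_phi ` {..N})"
  shows "neumann_proj N z = z"
  using assms
proof (induction rule: span_induct)
  case base
  show ?case
    by (rule subspaceI) (auto simp: neumann_proj_def inner_add_left scaleR_left_distrib sum.distrib scaleR_sum_right[symmetric]
      simp flip: scaleR_scaleR)
qed (auto simp: neumann_proj_phi)

text \<open>An orthonormal basis of \<open>H_N N\<close> made of eigenvectors of
  \<open>Delta_tilde\<close>; the finite-dimensional directions have eigenvalue 0.\<close>

definition state_basis :: "nat \<Rightarrow> 'd::finite state set"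
  where "state_basis N = range (\<lambda>i. (axis i 1, 0, 0)) \<union> {(0, 1, 0)} \<union> (\<lambda>n. (0, 0, neumann_phi n)) ` {..N}"

lemma neumann_phi_nonzero: "neumann_phi n \<noteq> 0"
  using neumann_phi_orthonormal[of n n] by auto

lemma inj_neumann_phi: "inj neumann_phi"
  using neumann_phi_orthonormal by (intro injI) (metis of_bool_eq_1_iff)

text \<open>The sum runs over a set, so coinciding vectors would lose terms: the three blocks are
  disjoint because their vectors have nonzero entries in different components, and each block is
  indexed injectively.\<close>

lemma proj_N_eq_sum: "proj_N N x = (\<Sum>e\<in>state_basis N. (x \<bullet> e) *\<^sub>R e)" for x :: "'d::finite state"
proof -
  obtain X Y z where x: "x = (X, Y, z)" by (cases x) auto
  define I1 I2 I3 where "I1 = range (\<lambda>i. (axis i 1, 0, 0) :: 'd state)" and "I2 = {(0, 1, 0) :: 'd state}"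
    and "I3 = (\<lambda>n. (0, 0, neumann_phi n) :: 'd state) ` {..N}"
  have "(\<Sum>e\<in>state_basis N. (x \<bullet> e) *\<^sub>R e)
      = (\<Sum>e\<in>I1. (x \<bullet> e) *\<^sub>R e) + (\<Sum>e\<in>I2. (x \<bullet> e) *\<^sub>R e) + (\<Sum>e\<in>I3. (x \<bullet> e) *\<^sub>R e)"
    unfolding state_basis_def I1_def[symmetric] I2_def[symmetric] I3_def[symmetric]
    by (subst sum.union_disjoint; (subst sum.union_disjoint)?)
       (auto simp: I1_def I2_def I3_def axis_eq_0_iff neumann_phi_nonzero)
  also have "(\<Sum>e\<in>I1. (x \<bullet> e) *\<^sub>R e) = (\<Sum>i\<in>UNIV. (X $ i) *\<^sub>R (axis i 1, 0, 0))"
    unfolding I1_def by (subst sum.reindex) (auto intro!: injI simp: axis_eq_axis x inner_axis)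
  also have "\<dots> = (X, 0, 0)"
    by (rule prod_eqI) (auto simp: fst_sum snd_sum vec_eq_iff axis_def if_distrib cong: if_cong intro: prod_eqI)
  also have "(\<Sum>e\<in>I2. (x \<bullet> e) *\<^sub>R e) = (0, Y, 0)" by (simp add: I2_def x)
  also have "(\<Sum>e\<in>I3. (x \<bullet> e) *\<^sub>R e) = (\<Sum>n\<le>N. (z \<bullet> neumann_phi n) *\<^sub>R (0, 0, neumann_phi n))"
    unfolding I3_def by (subst sum.reindex) (auto intro!: inj_onI dest: injD[OF inj_neumann_phi] simp: x)
  also have "\<dots> = (0, 0, neumann_proj N z)"
    by (intro prod_eqI) (simp_all add: fst_sum snd_sum neumann_proj_def)
  finally show ?thesis by (simp add: x proj_N_Pair)
qed

lemma finite_state_basis: "finite (state_basis N :: 'd::finite state set)"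
  by (simp add: state_basis_def)

lemma state_basis_subset: "state_basis N \<subseteq> (H_N N :: 'd::finite state set)"
  by (auto simp: state_basis_def H_N_def span_zero intro: span_base)

lemma subspace_H_N: "subspace (H_N N :: 'd::finite state set)"
  by (rule subspaceI) (auto simp: H_N_def span_zero zero_prod_def intro: span_add span_scale)

lemma proj_N_H_N: "\<forall>x\<in>H_N N. proj_N N x = x"
  by (auto simp: H_N_def proj_N_Pair neumann_proj_span)

lemmas proj_N_facts = finite_rank_projection[OF subspace_H_N finite_state_basis state_basis_subset proj_N_eq_sum proj_N_H_N]

lemma neumann_proj_tendsto: "(\<lambda>N. neumann_proj N z) \<longlonglongrightarrow> z"
  unfolding neumann_proj_def by (rule neumann_phi_expansion)

lemma proj_N_tendsto: "(\<lambda>N. proj_N N x) \<longlonglongrightarrow> x"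
proof -
  obtain X Y z where x: "x = (X, Y, z)" by (cases x) auto
  show ?thesis unfolding x proj_N_Pair by (intro tendsto_intros neumann_proj_tendsto)
qed

section \<open>The Neumann Laplacian and its semigroup on the eigenbasis\<close>

lemma h1_has_deriv_add: "h1_has_deriv u p \<Longrightarrow> h1_has_deriv v q \<Longrightarrow> h1_has_deriv (u + v) (p + q)"
  unfolding h1_has_deriv_def
  by (rule weak_deriv_cong_right[OF weak_deriv_cong[OF weak_deriv_add[OF _ _ h1_L2 h1_L2 h1_L2 h1_L2]]]) auto

lemma h1_has_deriv_scaleR: "h1_has_deriv u p \<Longrightarrow> h1_has_deriv (c *\<^sub>R u) (c *\<^sub>R p)"
  unfolding h1_has_deriv_def
  by (rule weak_deriv_cong_right[OF weak_deriv_cong[OF weak_deriv_scale]]) auto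

text \<open>\<open>neumann_laplacian\<close> is a definite description, so linearity is obtained on
  its domain by combining the witnesses for the two derivatives.\<close>

lemma dom_neumann_lincomb:
  assumes "u \<in> dom_neumann" "v \<in> dom_neumann"
  shows "c *\<^sub>R u + d *\<^sub>R v \<in> dom_neumann"
    "neumann_laplacian (c *\<^sub>R u + d *\<^sub>R v) = c *\<^sub>R neumann_laplacian u + d *\<^sub>R neumann_laplacian v"
proof -
  obtain p w where u: "h1_has_deriv u p" "h1_has_deriv p w" "h1_fun p 0 = 0" "h1_fun p 1 = 0"
    using assms(1) by (auto simp: dom_neumann_def)
  obtain q x where v: "h1_has_deriv v q" "h1_has_deriv q x" "h1_fun q 0 = 0" "h1_fun q 1 = 0"
    using assms(2) by (auto simp: dom_neumann_def)
  have 1: "h1_has_deriv (c *\<^sub>R u + d *\<^sub>R v) (c *\<^sub>R p + d *\<^sub>R q)" "h1_has_deriv (c *\<^sub>R p + d *\<^sub>R q) (c *\<^sub>R w + d *\<^sub>R x)"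
    by (intro h1_has_deriv_add h1_has_deriv_scaleR u v)+
  have "h1_fun (c *\<^sub>R p + d *\<^sub>R q) 0 = 0" "h1_fun (c *\<^sub>R p + d *\<^sub>R q) 1 = 0" using u v by simp_all
  with 1 show "c *\<^sub>R u + d *\<^sub>R v \<in> dom_neumann" unfolding dom_neumann_def by blast
  show "neumann_laplacian (c *\<^sub>R u + d *\<^sub>R v) = c *\<^sub>R neumann_laplacian u + d *\<^sub>R neumann_laplacian v"
    using neumann_laplacian_eq[OF 1] neumann_laplacian_eq[OF u(1,2)] neumann_laplacian_eq[OF v(1,2)] by simp
qed

lemma zero_dom_neumann: "0 \<in> dom_neumann" "neumann_laplacian 0 = 0"
  using dom_neumann_lincomb[OF neumann_phi_eigen(1) neumann_phi_eigen(1), of 0 0 0 0] by simp_all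

text \<open>On the basis both sides follow from the eigenvalue equation and orthogonality.
  Membership in the domain is carried along in \<open>?S\<close>, because linearity is available
  only there.\<close>

lemma neumann_laplacian_sym:
  assumes "z \<in> span (neumann_phi ` {..N})"
  shows "neumann_laplacian z \<bullet> neumann_phi m = z \<bullet> neumann_laplacian (neumann_phi m)"
proof -
  let ?S = "{z \<in> dom_neumann. neumann_laplacian z \<bullet> neumann_phi m = z \<bullet> neumann_laplacian (neumann_phi m)}"
  have "subspace ?S"
  proof (rule subspaceI)
    fix c u v assume uv: "u \<in> ?S" "v \<in> ?S"
    show "u + v \<in> ?S" using dom_neumann_lincomb[of u v 1 1] uv by (simp add: inner_add_left)
    show "c *\<^sub>R u \<in> ?S" using dom_neumann_lincomb[of u u c 0] uv by simp
  qed (simp add: zero_dom_neumann)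
  moreover have "neumann_phi n \<in> ?S" for n
    by (simp add: neumann_phi_eigen neumann_phi_orthonormal)
  ultimately have "span (neumann_phi ` {..N}) \<subseteq> ?S" by (intro span_minimal) auto
  then show ?thesis using assms by blast
qed

lemma state_basis_eigen:
  assumes "x \<in> (state_basis N :: 'd::finite state set)"
  obtains \<alpha> where "x \<in> dom_Delta_tilde" "Delta_tilde x = \<alpha> *\<^sub>R x"
proof -
  consider "\<exists>X Y. x = (X, Y, 0)" | n where "x = (0, 0, neumann_phi n)"
    using assms by (auto simp: state_basis_def)
  then show thesis
  proof cases
    case 1
    then show thesis by (intro that[of 0]) (auto simp: dom_Delta_tilde_def Delta_tilde_def zero_dom_neumann zero_prod_def)
  next
    case 2
    then show thesis
      by (intro that[of "- (pi\<^sup>2 * (real n)\<^sup>2)"]) (auto simp: dom_Delta_tilde_def Delta_tilde_def neumann_phi_eigen)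
  qed
qed

lemma Delta_tilde_sym:
  assumes "x \<in> (H_N N :: 'd::finite state set)" "y \<in> state_basis N"
  shows "proj_N N (Delta_tilde x) \<bullet> y = x \<bullet> Delta_tilde y"
proof -
  obtain X Y z where x: "x = (X, Y, z)" "z \<in> span (neumann_phi ` {..N})" using assms(1) by (auto simp: H_N_def)
  have "y \<in> H_N N" using assms(2) state_basis_subset by blast
  then have "proj_N N (Delta_tilde x) \<bullet> y = Delta_tilde x \<bullet> y"
    using proj_N_facts(3)[of N "Delta_tilde x" y] bspec[OF proj_N_H_N, of y N] by simp
  also have "\<dots> = x \<bullet> Delta_tilde y"
    using assms(2) neumann_laplacian_sym[OF x(2)]
    by (auto simp: x(1) state_basis_def Delta_tilde_def zero_dom_neumann)
  finally show ?thesis .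
qed

lemma semigroup_eigen:
  fixes S :: "real \<Rightarrow> 'd::finite state \<Rightarrow>\<^sub>L 'd state"
  assumes S: "generated_by S dom_Delta_tilde Delta_tilde" and x: "x \<in> state_basis N"
  shows "\<exists>\<alpha>. Delta_tilde x = \<alpha> *\<^sub>R x \<and> (\<forall>s\<ge>0. S s x = exp (\<alpha> * s) *\<^sub>R x)"
proof -
  obtain \<alpha> where \<alpha>: "x \<in> dom_Delta_tilde" "Delta_tilde x = \<alpha> *\<^sub>R x" by (rule state_basis_eigen[OF x])
  have "\<forall>x\<in>dom_Delta_tilde. ((\<lambda>h. (S h x - x) /\<^sub>R h) \<longlongrightarrow> Delta_tilde x) (at_right 0)"
    using S unfolding generated_by_def by blast
  from bspec[OF this \<alpha>(1)] have "((\<lambda>h. (S h x - x) /\<^sub>R h) \<longlongrightarrow> \<alpha> *\<^sub>R x) (at_right 0)"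
    by (simp only: \<alpha>(2))
  then show ?thesis using C0_semigroup_eigenvector \<alpha>(2) S unfolding generated_by_def by blast
qed

text \<open>S(s) is diagonal in the eigenbasis, hence symmetric on every H_N; strong convergence of
  the projections extends this to H.\<close>

lemma semigroup_sym:
  fixes S :: "real \<Rightarrow> 'd::finite state \<Rightarrow>\<^sub>L 'd state"
  assumes S: "generated_by S dom_Delta_tilde Delta_tilde" and s: "0 \<le> s"
  shows "S s x \<bullet> y = x \<bullet> S s y"
proof -
  \<comment> \<open>The quotient by \<open>e \<bullet> e\<close> expresses the eigenvalue of S(s) at
    e without choosing an exponent for each e; the sum is then visibly symmetric in x and y.\<close>
  have form: "S s (proj_N N x) \<bullet> proj_N N y = (\<Sum>e\<in>state_basis N. (x \<bullet> e) * (S s e \<bullet> e) / (e \<bullet> e) * (y \<bullet> e))" for N x y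
  proof -
    have "(x \<bullet> e) * (S s e \<bullet> proj_N N y) = (x \<bullet> e) * (S s e \<bullet> e) / (e \<bullet> e) * (y \<bullet> e)" if e: "e \<in> state_basis N" for e
    proof -
      obtain \<alpha> where "S s e = exp (\<alpha> * s) *\<^sub>R e" using semigroup_eigen[OF S e] s by blast
      moreover have "e \<bullet> proj_N N y = y \<bullet> e"
        using proj_N_facts(3)[of N e y] bspec[OF proj_N_H_N, of e N] e state_basis_subset[of N] by (auto simp: inner_commute)
      moreover have "e \<noteq> 0" using e by (auto simp: state_basis_def zero_prod_def axis_eq_0_iff neumann_phi_nonzero)
      ultimately show ?thesis by simp
    qed
    then show ?thesis
      by (subst proj_N_eq_sum[of N x]) (simp add: blinfun.sum_right blinfun.scaleR_right inner_sum_left)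
  qed
  have "S s (proj_N N x) \<bullet> proj_N N y = proj_N N x \<bullet> S s (proj_N N y)" for N
    unfolding inner_commute[of "proj_N N x"] form by (simp add: mult_ac)
  moreover have "(\<lambda>N. S s (proj_N N x) \<bullet> proj_N N y) \<longlonglongrightarrow> S s x \<bullet> y"
    by (intro tendsto_intros proj_N_tendsto)
  moreover have "(\<lambda>N. proj_N N x \<bullet> S s (proj_N N y)) \<longlonglongrightarrow> x \<bullet> S s y"
    by (intro tendsto_intros proj_N_tendsto)
  ultimately show ?thesis using LIMSEQ_unique by simp
qed

section \<open>Block operators: boundedness, adjoints and consistency errors\<close>

lemma A_tilde_bounded_linear: "bounded_linear (A_tilde A B c \<mu> \<rho> :: 'd::finite state \<Rightarrow> _)"
proof -
  \<comment> \<open>Evaluation at 0 becomes pairing with \<open>trace_rep\<close>, so every block is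
    bounded by construction.\<close>
  have "A_tilde A B c \<mu> \<rho> = (\<lambda>x. (A *v fst x - (fst (snd x) * h1_fun \<rho> 0) *\<^sub>R B + (snd (snd x) \<bullet> trace_rep) *\<^sub>R B,
      fst (snd x) * \<mu>, c *\<^sub>R snd (snd x)))"
    by (auto simp: A_tilde_def inner_trace_rep mult.commute)
  then show ?thesis
    by (simp only:)
       (intro bounded_linear_Pair bounded_linear_add bounded_linear_sub bounded_linear_scaleR_const bounded_linear_mult_const
         bounded_linear_compose[OF matrix_vector_mul_bounded_linear] bounded_linear_compose[OF bounded_linear_inner_left]
         bounded_linear_const_scaleR bounded_linear_compose[OF bounded_linear_fst] bounded_linear_compose[OF bounded_linear_snd]
         bounded_linear_fst bounded_linear_snd)
qed

lemma C_tilde_bounded_linear: "bounded_linear (C_tilde C D \<rho> :: 'd::finite state \<Rightarrow> _)"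
proof -
  have "C_tilde C D \<rho> = (\<lambda>x. (C *v fst x - (fst (snd x) * h1_fun \<rho> 0) *\<^sub>R D + (snd (snd x) \<bullet> trace_rep) *\<^sub>R D, 0, 0))"
    by (auto simp: C_tilde_def inner_trace_rep mult.commute)
  then show ?thesis
    by (simp only:)
       (intro bounded_linear_Pair bounded_linear_add bounded_linear_sub bounded_linear_scaleR_const bounded_linear_mult_const
         bounded_linear_compose[OF matrix_vector_mul_bounded_linear] bounded_linear_compose[OF bounded_linear_inner_left]
         bounded_linear_compose[OF bounded_linear_fst] bounded_linear_compose[OF bounded_linear_snd]
         bounded_linear_fst bounded_linear_snd bounded_linear_zero)
qed

text \<open>The block sending z to z(0) B has the adjoint X \<mapsto> (B \<bullet> X)
  \<open>trace_rep\<close>; the other blocks are transposed.\<close>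

lemma A_tilde_adjoint:
  "A_tilde A B c \<mu> \<rho> x \<bullet> y = x \<bullet> (case y of (X, Y, z) \<Rightarrow>
    (X v* A, \<mu> * Y - h1_fun \<rho> 0 * (B \<bullet> X), (B \<bullet> X) *\<^sub>R trace_rep + c *\<^sub>R z))"
  using dot_lmul_matrix[of "fst y" A "fst x"]
  by (cases x; cases y)
     (simp add: A_tilde_def inner_add_left inner_add_right inner_diff_left inner_trace_rep inner_commute algebra_simps)

lemma C_tilde_adjoint:
  "C_tilde C D \<rho> x \<bullet> y = x \<bullet> (case y of (X, Y, z) \<Rightarrow>
    (X v* C, - h1_fun \<rho> 0 * (D \<bullet> X), (D \<bullet> X) *\<^sub>R trace_rep))"
  using dot_lmul_matrix[of "fst y" C "fst x"]
  by (cases x; cases y)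
     (simp add: C_tilde_def inner_add_left inner_add_right inner_diff_left inner_trace_rep inner_commute algebra_simps)

text \<open>Symmetry moves the projection from the arbitrary z to the fixed
  \<open>trace_rep\<close>, which turns strong convergence of P_N into a bound uniform in z.\<close>

lemma trace_proj_error: "\<bar>h1_fun z 0 - h1_fun (neumann_proj N z) 0\<bar> \<le> norm (trace_rep - neumann_proj N trace_rep) * norm z"
proof -
  have "h1_fun z 0 - h1_fun (neumann_proj N z) 0 = z \<bullet> (trace_rep - neumann_proj N trace_rep)"
    using inner_trace_rep[of z] inner_trace_rep[of "neumann_proj N z"] neumann_proj_sym[of N z trace_rep]
    by (simp add: inner_diff_right)
  also have "\<bar>\<dots>\<bar> \<le> norm z * norm (trace_rep - neumann_proj N trace_rep)" by (rule Cauchy_Schwarz_ineq2)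
  finally show ?thesis by (simp add: mult.commute)
qed

text \<open>The outer projection matters: without it the block c would leave c (z - P_N z), which
  for c \<noteq> 0 is not uniformly small. With it that block cancels by idempotence and only the
  trace term remains.\<close>

lemma A_tilde_proj_error:
  fixes x :: "'d::finite state"
  shows "norm (proj_N N (A_tilde A B c \<mu> \<rho> x) - proj_N N (A_tilde A B c \<mu> \<rho> (proj_N N x)))
    \<le> norm B * norm (trace_rep - neumann_proj N trace_rep) * norm x"
proof -
  obtain X Y z where x: "x = (X, Y, z)" by (cases x) auto
  have lin: "neumann_proj N (c *\<^sub>R u) = c *\<^sub>R neumann_proj N u" for u
    by (simp add: neumann_proj_def scaleR_sum_right)
  have idem: "neumann_proj N (neumann_proj N z) = neumann_proj N z"
    by (rule neumann_proj_span) (auto simp: neumann_proj_def intro!: span_sum span_scale intro: span_base)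
  have "proj_N N (A_tilde A B c \<mu> \<rho> x) - proj_N N (A_tilde A B c \<mu> \<rho> (proj_N N x))
      = ((h1_fun z 0 - h1_fun (neumann_proj N z) 0) *\<^sub>R B, 0, 0)"
    by (simp add: x A_tilde_def proj_N_Pair lin idem scaleR_left_diff_distrib zero_prod_def)
  then have "norm (proj_N N (A_tilde A B c \<mu> \<rho> x) - proj_N N (A_tilde A B c \<mu> \<rho> (proj_N N x)))
      = \<bar>h1_fun z 0 - h1_fun (neumann_proj N z) 0\<bar> * norm B" by (simp add: norm_Pair)
  also have "\<dots> \<le> (norm (trace_rep - neumann_proj N trace_rep) * norm x) * norm B"
    using norm_snd_le[of "(Y, z)" X] norm_snd_le[of z Y]
    by (intro mult_right_mono order_trans[OF trace_proj_error mult_left_mono]) (auto simp: x)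
  finally show ?thesis by (simp add: mult_ac)
qed

lemma C_tilde_proj_error:
  fixes x :: "'d::finite state"
  shows "norm (C_tilde C D \<rho> x - C_tilde C D \<rho> (proj_N N x))
    \<le> norm D * norm (trace_rep - neumann_proj N trace_rep) * norm x"
proof -
  obtain X Y z where x: "x = (X, Y, z)" by (cases x) auto
  have "C_tilde C D \<rho> x - C_tilde C D \<rho> (proj_N N x)
      = ((h1_fun z 0 - h1_fun (neumann_proj N z) 0) *\<^sub>R D, 0, 0)"
    by (simp add: x C_tilde_def proj_N_Pair scaleR_left_diff_distrib zero_prod_def)
  then have "norm (C_tilde C D \<rho> x - C_tilde C D \<rho> (proj_N N x))
      = \<bar>h1_fun z 0 - h1_fun (neumann_proj N z) 0\<bar> * norm D" by (simp add: norm_Pair)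
  also have "\<dots> \<le> (norm (trace_rep - neumann_proj N trace_rep) * norm x) * norm D"
    using norm_snd_le[of "(Y, z)" X] norm_snd_le[of z Y]
    by (intro mult_right_mono order_trans[OF trace_proj_error mult_left_mono]) (auto simp: x)
  finally show ?thesis by (simp add: mult_ac)
qed

lemma Q_tilde_linear: "linear (Q_tilde Q r :: 'd::finite state \<Rightarrow> _)"
  by (rule linearI) (auto simp: Q_tilde_def algebra_simps matrix_vector_right_distrib matrix_vector_mult_scaleR)

lemma G_tilde_linear: "linear (G_tilde G :: 'd::finite state \<Rightarrow> _)"
  by (rule linearI) (auto simp: G_tilde_def matrix_vector_right_distrib matrix_vector_mult_scaleR)

lemma Q_tilde_proj: "Q_tilde Q r (proj_N N x) \<bullet> proj_N N y = Q_tilde Q r x \<bullet> y"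
  by (cases x; cases y) (simp add: Q_tilde_def proj_N_Pair)

lemma G_tilde_proj: "G_tilde G (proj_N N x) \<bullet> proj_N N y = G_tilde G x \<bullet> y"
  by (cases x; cases y) (simp add: G_tilde_def proj_N_Pair)

subsection \<open>Convergence\<close>

theorem proposition6:
  fixes T c \<mu> r \<delta> :: real
    and A C Q G :: "real^'d^'d" and B D :: "real^'d"
    and \<rho> :: h1
    and S :: "real \<Rightarrow> 'd::finite state \<Rightarrow>\<^sub>L 'd state"
    and P :: "real \<Rightarrow> 'd state \<Rightarrow>\<^sub>L 'd state"
    and PN :: "nat \<Rightarrow> real \<Rightarrow> 'd state \<Rightarrow> 'd state"
    and Z :: "'d state"
  assumes "T > 0" "\<mu> > c" "r > 0" "\<delta> > 0"
    and "transpose Q = Q" "\<forall>x. 0 \<le> x \<bullet> (Q *v x)"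
    and "transpose G = G" "\<forall>x. 0 \<le> x \<bullet> (G *v x)"
    and "solves_rho_problem (\<mu> - c) \<rho>"
    and "generated_by S dom_Delta_tilde Delta_tilde"
    and "mild_riccati_solution T S (A_tilde A B c \<mu> \<rho>) (B_tilde \<rho>) (C_tilde C D \<rho>)
           (Q_tilde Q r) (G_tilde G) \<delta> P"
    and "\<forall>N\<ge>1. matrix_riccati_solution (H_N N) T (proj_N N \<circ> Delta_tilde)
           (proj_N N \<circ> A_tilde A B c \<mu> \<rho>) (proj_N N \<circ> B_tilde \<rho>) (proj_N N \<circ> C_tilde C D \<rho>)
           (proj_N N \<circ> Q_tilde Q r) (proj_N N \<circ> G_tilde G) \<delta> (PN N)"
  shows "(\<forall>t\<in>{0..T}. (\<lambda>N. norm (P t Z - PN N t (proj_N N Z))) \<longlonglongrightarrow> 0) \<and>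
    (\<lambda>N. SUP t\<in>{0..T}. norm (P t Z - PN N t (proj_N N Z))) \<longlonglongrightarrow> 0"
proof -
  define b :: "'d state" where "b = (0, 1, - \<rho>)"
  have B: "B_tilde \<rho> = (\<lambda>v. v *\<^sub>R b)" by (auto simp: B_tilde_def b_def)
  note S = \<open>generated_by S dom_Delta_tilde Delta_tilde\<close>
  have mild: "mild_riccati_solution T S (A_tilde A B c \<mu> \<rho>) (\<lambda>v. v *\<^sub>R b) (C_tilde C D \<rho>) (Q_tilde Q r) (G_tilde G) \<delta> P"
    using assms(11) by (simp add: B)
  have sol: "matrix_riccati_solution (H_N N) T (proj_N N \<circ> Delta_tilde) (proj_N N \<circ> A_tilde A B c \<mu> \<rho>)
      (proj_N N \<circ> (\<lambda>v. v *\<^sub>R b)) (proj_N N \<circ> C_tilde C D \<rho>) (proj_N N \<circ> Q_tilde Q r) (proj_N N \<circ> G_tilde G) \<delta> (PN N)"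
    if "N \<ge> 1" for N using assms(12) that by (simp add: B)
  obtain a1 where a1: "\<And>x. norm (A_tilde A B c \<mu> \<rho> x :: 'd state) \<le> norm x * a1"
    using bounded_linear.bounded[OF A_tilde_bounded_linear[of A B c \<mu> \<rho>]] by blast
  obtain a2 where a2: "\<And>x. norm (C_tilde C D \<rho> x :: 'd state) \<le> norm x * a2"
    using bounded_linear.bounded[OF C_tilde_bounded_linear[of C D \<rho>]] by blast
  \<comment> \<open>One constant dominates both operators and the control vector, as the abstract
    estimate requires.\<close>
  define a where "a = max (max a1 a2) (norm b)"
  have A_le: "norm (A_tilde A B c \<mu> \<rho> x) \<le> a * norm x" and C_le: "norm (C_tilde C D \<rho> x) \<le> a * norm x" for x :: "'d state"
    using order_trans[OF a1 mult_left_mono[of a1 a "norm x"]] order_trans[OF a2 mult_left_mono[of a2 a "norm x"]]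
    by (simp_all add: a_def mult.commute)
  have b_le: "norm b \<le> a" by (simp add: a_def)
  obtain M where M: "\<And>t. t \<in> {0..T} \<Longrightarrow> norm (P t) \<le> M"
    using strongly_continuous_bounded[of 0 T P] mild unfolding mild_riccati_solution_def by blast
  have "continuous_on {0..} (\<lambda>s. S s x)" for x
    using S unfolding generated_by_def C0_semigroup_def by blast
  then have "continuous_on {0..T} (\<lambda>s. S s x)" for x
    by (rule continuous_on_subset) simp
  then obtain K0 where K0: "\<And>s. s \<in> {0..T} \<Longrightarrow> norm (S s) \<le> K0"
    using strongly_continuous_bounded[of 0 T S] by blast
  define K where "K = max 1 K0"
  have K: "\<And>s. s \<in> {0..T} \<Longrightarrow> norm (S s) \<le> K" "1 \<le> K" using K0 by (auto simp: K_def le_max_iff_disj)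
  define L where "L = K\<^sup>2 * (2 + 4 * a + a\<^sup>2 + (2 * M + 1) * a\<^sup>2 / \<delta>)"
  \<comment> \<open>The sum of the two norms lets a single \<eta> bound the consistency errors of
    both A and C.\<close>
  define \<eta> where "\<eta> N = (norm B + norm D) * norm (trace_rep - neumann_proj N trace_rep)" for N
  define \<epsilon> where "\<epsilon> N = K\<^sup>2 * (2 * M * (1 + a) * \<eta> N)" for N
  \<comment> \<open>The bound does not involve t, so it yields pointwise and uniform convergence
    together.\<close>
  define R where "R N = 2 * \<epsilon> N * T * exp (4 * L * T) * norm Z" for N
  have "\<eta> \<longlonglongrightarrow> (norm B + norm D) * norm (trace_rep - trace_rep)"
    unfolding \<eta>_def by (intro tendsto_intros neumann_proj_tendsto)
  then have \<eta>: "\<eta> \<longlonglongrightarrow> 0" by simp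
  have "\<epsilon> \<longlonglongrightarrow> K\<^sup>2 * (2 * M * (1 + a) * 0)" unfolding \<epsilon>_def by (intro tendsto_intros \<eta>)
  then have \<epsilon>: "\<epsilon> \<longlonglongrightarrow> 0" by simp
  have "R \<longlonglongrightarrow> 2 * 0 * T * exp (4 * L * T) * norm Z" unfolding R_def by (intro tendsto_intros \<epsilon>)
  then have R: "R \<longlonglongrightarrow> 0" by simp
  have "(\<lambda>N. \<epsilon> N * T * (1 + 2 * exp (4 * L * T))) \<longlonglongrightarrow> 0 * T * (1 + 2 * exp (4 * L * T))"
    by (intro tendsto_intros \<epsilon>)
  then have small: "\<forall>\<^sub>F N in sequentially. \<epsilon> N * T * (1 + 2 * exp (4 * L * T)) < 1/2"
    by (intro order_tendstoD(2)) auto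
  have \<eta>1: "\<forall>\<^sub>F N in sequentially. \<eta> N < 1" by (rule order_tendstoD(2)[OF \<eta>]) simp
  \<comment> \<open>The estimate holds only eventually: N must be large enough for \<eta> \<le> 1
    and for the smallness condition of the bootstrap.\<close>
  have bound: "\<forall>\<^sub>F N in sequentially. \<forall>t\<in>{0..T}. norm (P t Z - PN N t (proj_N N Z)) \<le> R N"
    using small \<eta>1 eventually_ge_at_top[of 1]
  proof eventually_elim
    case (elim N)
    have \<eta>0: "0 \<le> \<eta> N" by (simp add: \<eta>_def)
    have le\<eta>: "k * norm (trace_rep - neumann_proj N trace_rep) * norm x \<le> \<eta> N * norm x"
      if "k \<le> norm B + norm D" for k and x :: "'d state"
      unfolding \<eta>_def using that by (intro mult_right_mono) auto
    have eA: "norm (proj_N N (A_tilde A B c \<mu> \<rho> x) - proj_N N (A_tilde A B c \<mu> \<rho> (proj_N N x))) \<le> \<eta> N * norm x" for x :: "'d state"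
      by (rule order_trans[OF A_tilde_proj_error le\<eta>]) simp
    have eC: "norm (C_tilde C D \<rho> x - C_tilde C D \<rho> (proj_N N x)) \<le> \<eta> N * norm x" for x :: "'d state"
      by (rule order_trans[OF C_tilde_proj_error le\<eta>]) simp
    show ?case
    proof
      fix t assume t: "t \<in> {0..T}"
      show "norm (P t Z - PN N t (proj_N N Z)) \<le> R N"
        unfolding R_def
        by (rule galerkin_riccati_error[OF mild sol[OF elim(3)] \<open>T > 0\<close> \<open>\<delta> > 0\<close> subspace_H_N finite_state_basis
              state_basis_subset proj_N_eq_sum bspec[OF proj_N_H_N]
              bounded_linear.linear[OF A_tilde_bounded_linear] A_tilde_adjoint A_le eA
              bounded_linear.linear[OF C_tilde_bounded_linear] C_tilde_adjoint C_le eC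
              Q_tilde_linear Q_tilde_proj G_tilde_linear G_tilde_proj b_le \<eta>0 less_imp_le[OF elim(2)]
              semigroup_eigen[OF S] Delta_tilde_sym semigroup_sym[OF S] K M L_def \<epsilon>_def less_imp_le[OF elim(1)] t])
    qed
  qed
  have "(\<lambda>N. norm (P t Z - PN N t (proj_N N Z))) \<longlonglongrightarrow> 0" if t: "t \<in> {0..T}" for t
    by (rule Lim_null_comparison[OF eventually_mono[OF bound] R]) (use t in auto)
  moreover have "(\<lambda>N. SUP t\<in>{0..T}. norm (P t Z - PN N t (proj_N N Z))) \<longlonglongrightarrow> 0"
  proof (rule Lim_null_comparison[OF eventually_mono[OF bound] R])
    fix N assume le: "\<forall>t\<in>{0..T}. norm (P t Z - PN N t (proj_N N Z)) \<le> R N"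
    have 0: "0 \<in> {0..T}" using \<open>T > 0\<close> by simp
    have "(SUP t\<in>{0..T}. norm (P t Z - PN N t (proj_N N Z))) \<le> R N"
      by (rule cSUP_least) (use 0 le in auto)
    \<comment> \<open>A real supremum is meaningful only for a nonempty set bounded above: R N
      bounds it, and the nonnegative value at t = 0 gives the lower bound.\<close>
    moreover have "0 \<le> (SUP t\<in>{0..T}. norm (P t Z - PN N t (proj_N N Z)))"
      by (rule cSUP_upper2[OF _ 0]) (use le in \<open>auto intro!: bdd_aboveI2\<close>)
    ultimately show "norm (SUP t\<in>{0..T}. norm (P t Z - PN N t (proj_N N Z))) \<le> R N" by simp
  qed
  ultimately show ?thesis by blast
qed

end
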